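(* There are no repeated values in the sequence $\{\mathrm{Tr}\,T_2(2k,\mathrm{SL}_2(\mathbb{Z}))\}_{k\geq 2}$ (indexed by integers $k \ge 2$), except for $0$, which occurs only trivially, when $k<6$ or $k=7$. That is: (1) if $k\neq k'$ are integers with $k,k'\ge 2$ and $\mathrm{Tr}\,T_2(2k,\mathrm{SL}_2(\mathbb{Z}))=\mathrm{Tr}\,T_2(2k',\mathrm{SL}_2(\mathbb{Z}))$, then this common value is $0$; and (2) for an integer $k\ge 2$, $\mathrm{Tr}\,T_2(2k,\mathrm{SL}_2(\mathbb{Z}))=0$ if and only if $k<6$ or $k=7$.
   Context: For an integer $k\geq 2$, $\mathrm{Tr}\,T_2(2k,\mathrm{SL}_2(\mathbb{Z}))$ denotes the trace of the Hecke operator $T_2$ acting on the complex vector space $\mathcal{S}_{2k}(\mathrm{SL}_2(\mathbb{Z}))$ of cusp forms of weight $2k$ and level one. Here $T_2$ has the standard normalization: if $f=\sum_{n\ge1}c(n)q^n$, then $T_2f=\sum_{n\ge1}\left(c(2n)+2^{2k-1}c(n/2)\right)q^n$, with $c(n/2)=0$ for $n$ odd. The trace on the zero space is $0$; for $k\ge 2$, $\mathcal{S}_{2k}(\mathrm{SL}_2(\mathbb{Z}))=0$ precisely when $k<6$ or $k=7$. *)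

theory Defs
  imports "HOL-Complex_Analysis.Complex_Analysis" "HOL-Library.Function_Algebras"
begin

context vector_space
begin

text \<open>The trace of a linear endomorphism of a finite-dimensional subspace \<open>V\<close>, read off from
  the coordinates in a basis of \<open>V\<close>; the choice of the basis does not matter. As with
  \<^const>\<open>dim\<close>, nothing is claimed about an infinite-dimensional \<open>V\<close>.\<close>

definition trace_on :: "'b set \<Rightarrow> ('b \<Rightarrow> 'b) \<Rightarrow> 'a" where
  "trace_on V T =
    (let B = (SOME B. B \<subseteq> V \<and> independent B \<and> V \<subseteq> span B)
     in \<Sum>b\<in>B. representation B (T b) b)"

end

interpretation cfun: vector_space "\<lambda>(c::complex) (f::complex \<Rightarrow> complex) z. c * f z"
  by unfold_locales (auto simp: fun_eq_iff algebra_simps)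

definition upper_half_plane :: "complex set" where
  "upper_half_plane = {z. Im z > 0}"

definition has_q_expansion :: "(complex \<Rightarrow> complex) \<Rightarrow> (nat \<Rightarrow> complex) \<Rightarrow> bool" where
  "has_q_expansion f c \<longleftrightarrow>
    (\<forall>z\<in>upper_half_plane. (\<lambda>n. c n * exp (2 * of_real pi * \<i> * z) ^ n) sums f z)"

text \<open>Functions on the upper half-plane are represented by functions on the complex plane that
  vanish elsewhere, so that each cusp form has exactly one representative.\<close>

definition cusp_forms :: "nat \<Rightarrow> (complex \<Rightarrow> complex) set" where
  "cusp_forms w = {f.
     f holomorphic_on upper_half_plane \<and>
     (\<forall>a b c d :: int. a * d - b * c = 1 \<longrightarrow>
       (\<forall>z\<in>upper_half_plane.
         f ((of_int a * z + of_int b) / (of_int c * z + of_int d)) =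
           (of_int c * z + of_int d) ^ w * f z)) \<and>
     (\<exists>c. c 0 = 0 \<and> has_q_expansion f c) \<and>
     (\<forall>z. z \<notin> upper_half_plane \<longrightarrow> f z = 0)}"

text \<open>A \<open>q\<close>-expansion is unique, since it is a power series on the punctured unit disc.\<close>

definition q_coeff :: "(complex \<Rightarrow> complex) \<Rightarrow> nat \<Rightarrow> complex" where
  "q_coeff f = (THE c. has_q_expansion f c)"

definition hecke_T2 :: "nat \<Rightarrow> (complex \<Rightarrow> complex) \<Rightarrow> complex \<Rightarrow> complex" where
  "hecke_T2 w f = (\<lambda>z. if z \<in> upper_half_plane
     then \<Sum>n. (q_coeff f (2 * n) + (if even n then 2 ^ (w - 1) * q_coeff f (n div 2) else 0))
                * exp (2 * of_real pi * \<i> * z) ^ n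
     else 0)"

definition trace_T2 :: "nat \<Rightarrow> complex" where
  "trace_T2 w = cfun.trace_on (cusp_forms w) (hecke_T2 w)"

end

theory Submission
  imports Defs "HOL-Number_Theory.Cong"
begin

text \<open>The forms of level one are the polynomials in \<open>g\<^sub>2\<close> and \<open>g\<^sub>3\<close>. To see this, bound the order of a
  form at the cusp through the maximum principle for \<open>f / q\<^sup>n\<close> on a fundamental domain, and note that
  \<open>\<Delta>\<close> has no zeros, because the values \<open>e\<close> of the Weierstrass function at the three half-periods are
  distinct. Up to a factor, \<open>T\<^sub>2\<close> sums a form over the three lattices containing a given one with index
  two, for which \<open>g\<^sub>2\<close> and \<open>g\<^sub>3\<close> become \<open>60 e\<^sup>2 - 4 g\<^sub>2\<close> and \<open>88 e\<^sup>3 - 8 g\<^sub>2 e\<close>. So the diagonal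
  coefficients of \<open>T\<^sub>2\<close> on the monomials \<open>g\<^sub>2\<^sup>a g\<^sub>3\<^sup>b\<close> are, up to powers of two, coefficients of
  \<open>X\<^sup>a\<close> in rational functions, and their sum satisfies a recurrence. With \<open>j = k - 1\<close> and the Lucas sequence
  \<open>U\<close> of \<open>x\<^sup>2 - x + 2\<close>, the trace on cusp forms of weight \<open>2 k\<close> is \<open>- 1 - U (2 j + 1) - \<epsilon> 2\<^sup>j\<close>, where
  \<open>\<epsilon> = 1, 0, 0, - 1\<close> for \<open>j = 0, 1, 2, 3\<close> modulo 4.

  For \<open>j \<ge> 8\<close> this has period 96 modulo \<open>49408 = 256 \<cdot> 193\<close> and takes 96 distinct values on a period. If
  \<open>j\<close> and \<open>j + d\<close> are congruent modulo 96 and give the same trace, the 7-adic valuation of \<open>d\<close> yields a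
  contradiction, since \<open>7\<^sup>n\<close> divides \<open>U d\<close> only if it divides \<open>d\<close>.\<close>

subsection \<open>Lattice sums\<close>

text \<open>The closed form reflects the roots of one polynomial. Apart from boundary terms, the
  double generating series of the diagonal coefficients, x marking \<open>g2\<close> and y marking
  \<open>g3\<close>, has denominator 4 - 11 x - 11 y + 4 x y. At x = t^2, y = t^3, with the powers
  of two restored, this becomes the characteristic polynomial (X - 4) (X - 1) (X + 2) (X^2 + 3 X +
  4). The roots 4 and 1 carry the Eisenstein eigenvalue, which the passage to cusp forms removes.
  The roots of the quadratic factor are the squares of those of x^2 - x + 2, whence the odd indices
  of U. The root -2 and the forcing term give \<epsilon> 2^j. A modulus separates only residue
  classes of j. The prime 7 settles the rest because it ramifies: x^2 - x + 2 has discriminant -7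
  and a double root modulo 7, so U n is n times a unit there. For d divisible by 3, 2^d - 1 has one
  more factor 7 than d, which leaves a single term of least valuation. The modulus combines 193,
  where 2 has order 96, with 256, which kills 2^j from j = 8 on.\<close>

lemma summable_on_int_powr: "(\<lambda>m::int. (max \<bar>of_int m\<bar> 1) powr (-3/2) :: real) summable_on UNIV"
proof -
  define \<alpha> where "\<alpha> = (\<lambda>m::int. (max \<bar>of_int m\<bar> 1) powr (-3/2) :: real)"
  have s: "summable (\<lambda>n::nat. real (n + 1) powr (-3/2))"
    by (subst summable_iff_shift) (simp add: summable_real_powr_iff)
  have "\<alpha> (int (n + 1)) = real (n + 1) powr (-3/2)" "\<alpha> (- int (n + 1)) = real (n + 1) powr (-3/2)" for n
    by (simp_all add: \<alpha>_def max_def add.commute)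
  then have s2: "summable (\<lambda>n. \<alpha> (int (n + 1)))" "summable (\<lambda>n. \<alpha> (- int (n + 1)))"
    using s by simp_all
  then have "summable (\<lambda>n. norm (\<alpha> (int n)))" "summable (\<lambda>n. norm (\<alpha> (- int n)))"
    using summable_iff_shift[of "\<lambda>n. \<alpha> (int n)" 1] summable_iff_shift[of "\<lambda>n. \<alpha> (- int n)" 1]
    by (simp_all add: \<alpha>_def)
  then have "(\<lambda>n. \<alpha> (int n)) summable_on UNIV" "(\<lambda>n. \<alpha> (- int n)) summable_on UNIV"
    by (auto intro: norm_summable_imp_summable_on)
  then have "\<alpha> summable_on range int" "\<alpha> summable_on range (\<lambda>n. - int n)"
    using summable_on_reindex[of int UNIV \<alpha>] summable_on_reindex[of "\<lambda>n. - int n" UNIV \<alpha>]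
    by (simp_all add: inj_on_def o_def)
  then have "\<alpha> summable_on range int \<union> (range (\<lambda>n. - int n) - range int)"
    using summable_on_subset_banach[of \<alpha> "range (\<lambda>n. - int n)" "range (\<lambda>n. - int n) - range int"]
    by (intro summable_on_Un_disjoint) auto
  moreover have "range int \<union> (range (\<lambda>n. - int n) - range int) = UNIV"
  proof -
    have "m \<in> range int \<union> range (\<lambda>n. - int n)" for m :: int
      by (cases m rule: int_cases2) auto
    then show ?thesis by blast
  qed
  ultimately show ?thesis by (simp add: \<alpha>_def)
qed

definition lattice_norm :: "int \<times> int \<Rightarrow> real" where
  "lattice_norm p = \<bar>of_int (fst p)\<bar> + \<bar>of_int (snd p)\<bar>"

definition lattice_pt :: "complex \<Rightarrow> int \<times> int \<Rightarrow> complex" where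
  "lattice_pt z p = of_int (fst p) + of_int (snd p) * z"

lemma lattice_norm_nonneg: "lattice_norm p \<ge> 0"
  by (simp add: lattice_norm_def)

lemma lattice_norm_eq_0: "lattice_norm p = 0 \<longleftrightarrow> p = (0, 0)"
  by (cases p) (auto simp: lattice_norm_def)

lemma lattice_norm_ge_1: "p \<noteq> (0, 0) \<Longrightarrow> lattice_norm p \<ge> 1"
proof -
  assume "p \<noteq> (0, 0)"
  then have "\<bar>fst p\<bar> + \<bar>snd p\<bar> \<ge> 1" by (cases p) auto
  then have "of_int (\<bar>fst p\<bar> + \<bar>snd p\<bar>) \<ge> (1::real)" by (simp only: of_int_1_le_iff)
  then show ?thesis by (simp add: lattice_norm_def)
qed

text \<open>Both coordinates are at most the norm N, so (|m| |n|)^(3/2) <= N^3 and the double series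
  is dominated by the square of a convergent single one. Hence the exponent 3/2 in
  \<open>summable_on_int_powr\<close>; the maximum with 1 keeps the bound valid on the axes.\<close>

lemma lattice_norm_summable: "(\<lambda>p. 1 / lattice_norm p ^ 3) summable_on UNIV"
proof -
  define \<alpha> where "\<alpha> = (\<lambda>m::int. (max \<bar>of_int m\<bar> 1) powr (-3/2) :: real)"
  have \<alpha>: "\<alpha> summable_on UNIV" unfolding \<alpha>_def by (rule summable_on_int_powr)
  have pos: "\<alpha> m \<ge> 0" for m by (simp add: \<alpha>_def)
  have "(\<lambda>p. norm (\<alpha> (fst p) * \<alpha> (snd p))) summable_on (UNIV \<times> UNIV)"
  proof (rule iffD2[OF Infinite_Sum.abs_summable_on_Sigma_iff], intro conjI ballI)
    show "(\<lambda>y. norm (\<alpha> (fst (x, y)) * \<alpha> (snd (x, y)))) summable_on UNIV" for x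
      using \<alpha> pos by (simp add: abs_mult abs_of_nonneg summable_on_cmult_right)
    show "(\<lambda>x. norm (infsum (\<lambda>y. norm (\<alpha> (fst (x, y)) * \<alpha> (snd (x, y)))) UNIV)) summable_on UNIV"
      using \<alpha> pos by (simp add: abs_mult abs_of_nonneg infsum_cmult_right' infsum_nonneg summable_on_cmult_left)
  qed
  then have *: "(\<lambda>p. norm (\<alpha> (fst p) * \<alpha> (snd p))) summable_on UNIV" by simp
  have "norm (1 / lattice_norm p ^ 3) \<le> norm (\<alpha> (fst p) * \<alpha> (snd p))" for p
  proof (cases "p = (0, 0)")
    case True
    then show ?thesis by (simp add: lattice_norm_def)
  next
    case False
    define a b where "a = max \<bar>of_int (fst p)\<bar> (1::real)" and "b = max \<bar>of_int (snd p)\<bar> (1::real)"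
    have ab: "a \<ge> 1" "b \<ge> 1" by (auto simp: a_def b_def)
    define N where "N = lattice_norm p"
    have N: "N \<ge> a" "N \<ge> b"
      using lattice_norm_ge_1[OF False] by (auto simp: N_def a_def b_def lattice_norm_def)
    have "a * b \<le> N * N" using N ab by (intro mult_mono) auto
    have "(a * b) powr (3/2) \<le> (N * N) powr (3/2)"
      using ab \<open>a * b \<le> N * N\<close> by (intro powr_mono2) auto
    also have "(N * N) powr (3/2) = N ^ 3"
    proof -
      have "N > 0" using N ab by linarith
      then have "N * N = N powr 2" by (simp add: power2_eq_square)
      then have "(N * N) powr (3/2) = N powr 3" by (simp add: powr_powr)
      then show ?thesis using \<open>N > 0\<close> by simp
    qed
    finally have "1 / N ^ 3 \<le> 1 / (a * b) powr (3/2)"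
      using ab N by (intro divide_left_mono mult_pos_pos zero_less_power) auto
    also have "\<dots> = \<alpha> (fst p) * \<alpha> (snd p)"
      using ab by (simp add: \<alpha>_def a_def[symmetric] b_def[symmetric] powr_mult powr_minus inverse_eq_divide)
    finally show ?thesis using pos N ab by (simp add: N_def abs_of_nonneg lattice_norm_nonneg)
  qed
  from Infinite_Sum.abs_summable_on_comparison_test[OF * this]
  have "(\<lambda>p. norm (1 / lattice_norm p ^ 3)) summable_on UNIV" .
  then show ?thesis by (simp add: abs_of_nonneg lattice_norm_nonneg)
qed

text \<open>The imaginary part of a lattice point controls its second index, and then the real part
  controls the first. The constant depends only on \<open>d\<close> and \<open>R\<close>, so the
  estimate is uniform in \<open>z\<close>, as holomorphy in \<open>z\<close> and boundedness at the
  cusp require.\<close>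

lemma lattice_pt_lower:
  assumes "Im z \<ge> d" "d > 0" "\<bar>Re z\<bar> \<le> R"
  shows "norm (lattice_pt z p) \<ge> d / (d + R + 1) * lattice_norm p"
proof -
  obtain m n where p: "p = (m, n)" by (cases p)
  define w where "w = lattice_pt z p"
  have "Im w = of_int n * Im z" "Re w = of_int m + of_int n * Re z"
    by (simp_all add: w_def lattice_pt_def p)
  have "\<bar>of_int n\<bar> * d \<le> \<bar>of_int n\<bar> * Im z" using assms by (intro mult_left_mono) auto
  also have "\<dots> = \<bar>Im w\<bar>" using assms \<open>Im w = _\<close> by (simp add: abs_mult)
  also have "\<dots> \<le> norm w" by (rule abs_Im_le_cmod)
  finally have n: "\<bar>of_int n\<bar> * d \<le> norm w" .
  have "\<bar>of_int m\<bar> \<le> \<bar>Re w\<bar> + \<bar>of_int n * Re z\<bar>" using \<open>Re w = _\<close> by linarith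
  also have "\<dots> \<le> norm w + \<bar>of_int n\<bar> * R"
    using abs_Re_le_cmod[of w] assms mult_left_mono[of "\<bar>Re z\<bar>" R "\<bar>of_int n\<bar>"] by (simp add: abs_mult)
  finally have m: "\<bar>of_int m\<bar> \<le> norm w + \<bar>of_int n\<bar> * R" .
  have R: "R \<ge> 0" using assms(3) by linarith
  have "d * lattice_norm p = d * \<bar>of_int m\<bar> + \<bar>of_int n\<bar> * d"
    by (simp add: lattice_norm_def p algebra_simps)
  also have "\<dots> \<le> d * (norm w + \<bar>of_int n\<bar> * R) + norm w"
    using m n assms by (intro add_mono mult_left_mono) auto
  also have "\<dots> = (d + 1) * norm w + R * (\<bar>of_int n\<bar> * d)" by (simp add: algebra_simps)
  also have "\<dots> \<le> (d + 1) * norm w + R * norm w"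
    using n R by (intro add_mono order_refl mult_left_mono) auto
  finally have "d * lattice_norm p \<le> (d + R + 1) * norm w" by (simp add: algebra_simps)
  then show ?thesis using assms R by (simp add: w_def field_simps)
qed

lemma lattice_pt_lower':
  assumes "Im z > 0"
  obtains c where "c > 0" "\<And>p. norm (lattice_pt z p) \<ge> c * lattice_norm p"
  using lattice_pt_lower[of "Im z" z "\<bar>Re z\<bar>"] assms
  by (intro that[of "Im z / (Im z + \<bar>Re z\<bar> + 1)"]) (auto intro!: divide_pos_pos add_pos_nonneg)

lemma lattice_pt_eq_0_iff:
  assumes "Im z > 0" shows "lattice_pt z p = 0 \<longleftrightarrow> p = (0, 0)"
proof
  assume *: "lattice_pt z p = 0"
  obtain c where c: "c > 0" "\<And>p. norm (lattice_pt z p) \<ge> c * lattice_norm p"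
    using lattice_pt_lower' assms by blast
  have "c * lattice_norm p \<le> 0" using c(2)[of p] * by simp
  then have "lattice_norm p = 0" using c(1) lattice_norm_nonneg[of p] by (simp add: mult_le_0_iff)
  then show "p = (0, 0)" by (simp add: lattice_norm_eq_0)
qed (simp add: lattice_pt_def)

lemma lattice_pt_add: "lattice_pt z (p + q) = lattice_pt z p + lattice_pt z q"
  by (simp add: lattice_pt_def algebra_simps)

lemma lattice_pt_minus: "lattice_pt z (- p) = - lattice_pt z p"
  by (simp add: lattice_pt_def)

lemma lattice_pt_diff: "lattice_pt z (p - q) = lattice_pt z p - lattice_pt z q"
  by (simp add: lattice_pt_def algebra_simps)

lemma finite_lattice_norm_le: "finite {p. lattice_norm p \<le> B}"
proof (rule finite_subset)
  show "{p. lattice_norm p \<le> B} \<subseteq> {-\<lceil>B\<rceil>..\<lceil>B\<rceil>} \<times> {-\<lceil>B\<rceil>..\<lceil>B\<rceil>}"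
  proof
    fix p assume "p \<in> {p. lattice_norm p \<le> B}"
    then have "\<bar>of_int (fst p)\<bar> \<le> B" "\<bar>of_int (snd p)\<bar> \<le> B" by (auto simp: lattice_norm_def)
    then show "p \<in> {-\<lceil>B\<rceil>..\<lceil>B\<rceil>} \<times> {-\<lceil>B\<rceil>..\<lceil>B\<rceil>}"
      by (cases p) (simp add: abs_le_iff, linarith)
  qed
qed simp

text \<open>The Weierstrass M-test with finitely many exceptions: terms with a pole nearby escape
  the uniform bound \<open>M\<close>, but each of them is bounded on the compact ball.\<close>

lemma holomorphic_on_infsum:
  fixes f :: "'i \<Rightarrow> complex \<Rightarrow> complex"
  assumes "open S" "\<And>p. f p holomorphic_on S"
    and "\<And>x. x \<in> S \<Longrightarrow> \<exists>r>0. \<exists>F M. cball x r \<subseteq> S \<and> finite F \<and> M summable_on UNIV \<and>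
            (\<forall>p. p \<notin> F \<longrightarrow> (\<forall>y\<in>cball x r. norm (f p y) \<le> M p))"
  shows "(\<lambda>y. \<Sum>\<^sub>\<infinity>p. f p y) holomorphic_on S"
proof (rule analytic_imp_holomorphic, unfold analytic_on_def, intro ballI)
  fix x assume "x \<in> S"
  then obtain r F M where r: "r > 0" "cball x r \<subseteq> S" "finite F" "M summable_on UNIV"
    "\<And>p y. p \<notin> F \<Longrightarrow> y \<in> cball x r \<Longrightarrow> norm (f p y) \<le> M p" using assms(3)[of x] by blast
  have "\<exists>B. \<forall>y\<in>cball x r. norm (f p y) \<le> B" for p
  proof -
    have "continuous_on (cball x r) (f p)"
      using assms(2)[of p] r(2) holomorphic_on_imp_continuous_on holomorphic_on_subset by blast
    then have "bounded (f p ` cball x r)" by (intro compact_imp_bounded compact_continuous_image) auto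
    then show ?thesis by (auto simp: bounded_iff)
  qed
  then obtain B where B: "\<And>p y. y \<in> cball x r \<Longrightarrow> norm (f p y) \<le> B p" by metis
  define M' where "M' = (\<lambda>p. if p \<in> F then B p else M p)"
  have "M' summable_on F" using r(3) by simp
  moreover have "M' summable_on - F"
  proof -
    have "M summable_on - F" using r(4) summable_on_subset_banach by blast
    then show ?thesis by (rule summable_on_cong[THEN iffD1, rotated]) (simp add: M'_def)
  qed
  ultimately have M': "M' summable_on UNIV"
    using summable_on_Un_disjoint[of M' F "-F"] by (simp add: Compl_partition)
  have "norm (f p y) \<le> M' p" if "y \<in> cball x r" for p y
    using that r(5) B by (simp add: M'_def)
  then have ul: "uniform_limit (cball x r) (\<lambda>X y. \<Sum>p\<in>X. f p y) (\<lambda>y. \<Sum>\<^sub>\<infinity>p. f p y) (finite_subsets_at_top UNIV)"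
    using M' by (intro Weierstrass_m_test_general) auto
  have ev: "\<forall>\<^sub>F X in finite_subsets_at_top UNIV. continuous_on (cball x r) (\<lambda>y. \<Sum>p\<in>X. f p y) \<and>
      (\<lambda>y. \<Sum>p\<in>X. f p y) holomorphic_on ball x r"
  proof (rule always_eventually, rule allI)
    fix X
    have "(\<lambda>y. \<Sum>p\<in>X. f p y) holomorphic_on S" using assms(2) by (intro holomorphic_on_sum) auto
    then show "continuous_on (cball x r) (\<lambda>y. \<Sum>p\<in>X. f p y) \<and> (\<lambda>y. \<Sum>p\<in>X. f p y) holomorphic_on ball x r"
      using r(2) by (meson ball_subset_cball holomorphic_on_imp_continuous_on holomorphic_on_subset subset_trans)
  qed
  have "(\<lambda>y. \<Sum>\<^sub>\<infinity>p. f p y) holomorphic_on ball x r"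
    by (rule holomorphic_uniform_limit[OF ev ul finite_subsets_at_top_neq_bot])
  then show "\<exists>e>0. (\<lambda>y. \<Sum>\<^sub>\<infinity>p. f p y) holomorphic_on ball x e" using r(1) by blast
qed

lemma abs_summable_finite_exceptions:
  fixes f :: "'i \<Rightarrow> complex"
  assumes "finite F" "M summable_on UNIV" "\<And>p. p \<notin> F \<Longrightarrow> norm (f p) \<le> M p"
  shows "(\<lambda>p. norm (f p)) summable_on UNIV"
proof -
  have "(\<lambda>p. norm (f p)) summable_on F" using assms(1) by simp
  moreover have "M summable_on - F" using assms(2) summable_on_subset_banach by blast
  then have "(\<lambda>p. norm (f p)) summable_on - F"
    by (rule summable_on_comparison_test) (use assms(3) in auto)
  ultimately show ?thesis
    using summable_on_Un_disjoint[of "\<lambda>p. norm (f p)" F "-F"] by (simp add: Compl_partition)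
qed

lemma has_sum_delta: "((\<lambda>p. if p = a then c else 0) has_sum (c::complex)) UNIV"
  by (rule has_sum_finite_neutralI[where B = "{a}"]) auto

text \<open>Since \<open>x / 0 = 0\<close>, the sums below need not exclude the lattice point \<open>0\<close>: it contributes \<open>0\<close> to
  \<open>eis_sum\<close> and \<open>1 / u\<^sup>2\<close> to the Weierstrass function \<open>wp\<close>.\<close>

definition eis_sum :: "nat \<Rightarrow> complex \<Rightarrow> complex" where
  "eis_sum k z = (\<Sum>\<^sub>\<infinity>p. 1 / lattice_pt z p ^ k)"

definition pole_sum :: "nat \<Rightarrow> complex \<Rightarrow> complex \<Rightarrow> complex" where
  "pole_sum k z u = (\<Sum>\<^sub>\<infinity>p. 1 / (u - lattice_pt z p) ^ k)"

definition wp :: "complex \<Rightarrow> complex \<Rightarrow> complex" where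
  "wp z u = (\<Sum>\<^sub>\<infinity>p. 1 / (u - lattice_pt z p)\<^sup>2 - 1 / lattice_pt z p ^ 2)"

definition lattice :: "complex \<Rightarrow> complex set" where
  "lattice z = range (lattice_pt z)"

text \<open>For a large lattice point a shift by \<open>u\<close> within radius \<open>B\<close>
  costs at most half of the norm. The finitely many remaining points, and the origin, are collected
  in \<open>F\<close>.\<close>

lemma shifted_lattice_lower:
  assumes "Im z > 0"
  obtains c F where "c > 0" "finite F" "(0, 0) \<in> F"
    "\<And>p (u::complex). p \<notin> F \<Longrightarrow> norm u \<le> B \<Longrightarrow> norm (lattice_pt z p) \<ge> 2 * norm u"
    "\<And>p u. p \<notin> F \<Longrightarrow> norm u \<le> B \<Longrightarrow> norm (u - lattice_pt z p) \<ge> c * lattice_norm p"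
    "\<And>p. norm (lattice_pt z p) \<ge> c * lattice_norm p"
proof -
  obtain c where c: "c > 0" "\<And>p. norm (lattice_pt z p) \<ge> c * lattice_norm p"
    using lattice_pt_lower' assms by blast
  define F where "F = insert (0, 0) {p. lattice_norm p \<le> 2 * B / c}"
  show thesis
  proof (rule that[of "c / 2" F])
    show "finite F" by (simp add: F_def finite_lattice_norm_le)
    show *: "norm (lattice_pt z p) \<ge> 2 * norm u" if "p \<notin> F" "norm u \<le> B" for p and u :: complex
    proof -
      have "2 * B / c < lattice_norm p" using that(1) by (auto simp: F_def)
      then have "2 * B < c * lattice_norm p" using c(1) by (simp add: field_simps)
      then show ?thesis using c(2)[of p] that(2) by linarith
    qed
    show "norm (u - lattice_pt z p) \<ge> c / 2 * lattice_norm p" if "p \<notin> F" "norm u \<le> B" for p u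
    proof -
      have "norm (lattice_pt z p) - norm u \<le> norm (u - lattice_pt z p)"
        by (metis norm_minus_commute norm_triangle_ineq2)
      then show ?thesis using *[OF that] c(2)[of p] by linarith
    qed
    show "c / 2 * lattice_norm p \<le> norm (lattice_pt z p)" for p
    proof -
      have "0 \<le> c * lattice_norm p" using c(1) lattice_norm_nonneg[of p] by simp
      then show ?thesis using c(2)[of p] by simp
    qed
  qed (use c in \<open>auto simp: F_def\<close>)
qed

text \<open>Nonzero lattice points have \<open>lattice_norm\<close> at least 1, so every exponent
  from 3 on is dominated by the one convergent series of inverse cubes.\<close>

lemma inverse_power_bound:
  fixes v :: complex
  assumes "c > 0" "norm v \<ge> c * lattice_norm p" "p \<noteq> (0, 0)" "k \<ge> 3"
  shows "norm (1 / v ^ k) \<le> 1 / c ^ k * (1 / lattice_norm p ^ 3)"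
proof -
  have N: "lattice_norm p \<ge> 1" using lattice_norm_ge_1[OF assms(3)] .
  have "0 < c * lattice_norm p" using N assms(1) by simp
  have "c ^ k * lattice_norm p ^ 3 \<le> c ^ k * lattice_norm p ^ k"
    using N assms by (intro mult_left_mono power_increasing) auto
  also have "\<dots> \<le> norm v ^ k"
    unfolding power_mult_distrib[symmetric] using assms N by (intro power_mono) auto
  finally have "1 / norm v ^ k \<le> 1 / (c ^ k * lattice_norm p ^ 3)"
    using N assms(1) less_le_trans[OF \<open>0 < c * lattice_norm p\<close> assms(2)]
    by (intro divide_left_mono mult_pos_pos zero_less_power) auto
  then show ?thesis by (simp add: norm_divide norm_power)
qed

lemma pole_sum_abs_summable:
  assumes "Im z > 0" "k \<ge> 3"
  shows "(\<lambda>p. norm (1 / (u - lattice_pt z p) ^ k)) summable_on UNIV"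
proof -
  obtain c F where c: "c > 0" "finite F" "(0, 0) \<in> F"
    "\<And>p v. p \<notin> F \<Longrightarrow> norm v \<le> norm u \<Longrightarrow> norm (v - lattice_pt z p) \<ge> c * lattice_norm p"
    using shifted_lattice_lower[OF assms(1), of "norm u"] by metis
  show ?thesis
  proof (rule abs_summable_finite_exceptions[OF c(2), of "\<lambda>p. 1 / c ^ k * (1 / lattice_norm p ^ 3)"])
    show "(\<lambda>p. 1 / c ^ k * (1 / lattice_norm p ^ 3)) summable_on UNIV"
      by (intro summable_on_cmult_right lattice_norm_summable)
    show "norm (1 / (u - lattice_pt z p) ^ k) \<le> 1 / c ^ k * (1 / lattice_norm p ^ 3)" if "p \<notin> F" for p
      using that c by (intro inverse_power_bound assms) auto
  qed
qed

lemma pole_sum_has_sum: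
  assumes "Im z > 0" "k \<ge> 3"
  shows "((\<lambda>p. 1 / (u - lattice_pt z p) ^ k) has_sum pole_sum k z u) UNIV"
  unfolding pole_sum_def by (rule has_sum_infsum[OF abs_summable_summable[OF pole_sum_abs_summable[OF assms]]])

lemma uminus_bij: "bij (uminus :: int \<times> int \<Rightarrow> int \<times> int)"
  by (rule bij_uminus)

lemma eis_has_sum:
  assumes "Im z > 0" "k \<ge> 3"
  shows "((\<lambda>p. 1 / lattice_pt z p ^ k) has_sum eis_sum k z) UNIV"
proof -
  have "(\<lambda>p. 1 / (0 - lattice_pt z (- p)) ^ k) summable_on UNIV"
    by (rule iffD2[OF summable_on_reindex_bij_betw[OF uminus_bij] abs_summable_summable[OF pole_sum_abs_summable[OF assms, of 0]]])
  then show ?thesis unfolding eis_sum_def by (intro has_sum_infsum) (simp add: lattice_pt_minus)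
qed

lemma eis_sum_odd:
  assumes "Im z > 0" "k \<ge> 3" "odd k" shows "eis_sum k z = 0"
proof -
  have "eis_sum k z = (\<Sum>\<^sub>\<infinity>p. 1 / lattice_pt z (- p) ^ k)"
    unfolding eis_sum_def by (rule infsum_reindex_bij_betw[OF uminus_bij, symmetric])
  also have "\<dots> = (\<Sum>\<^sub>\<infinity>p. - (1 / lattice_pt z p ^ k))"
    using assms(3) by (simp add: lattice_pt_minus)
  also have "\<dots> = - eis_sum k z" by (simp add: infsum_uminus eis_sum_def)
  finally show ?thesis by simp
qed

text \<open>Either term alone decays like 1 / |w|^2, which diverges over a lattice; the subtraction
  gains one order of decay. The factor 10 is 5/2, from |2 w - u| <= 5/2 |w|, times 4, from |u - w|
  >= |w| / 2.\<close>

lemma wp_term_bound: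
  fixes u w :: complex
  assumes "norm w \<ge> 2 * norm u" "w \<noteq> 0"
  shows "norm (1 / (u - w)\<^sup>2 - 1 / w\<^sup>2) \<le> 10 * norm u * norm (1 / w ^ 3)"
proof -
  have "norm w - norm u \<le> norm (u - w)" by (metis norm_minus_commute norm_triangle_ineq2)
  then have uw: "norm w / 2 \<le> norm (u - w)" using assms by simp
  have w: "norm w > 0" using assms by simp
  have "u - w \<noteq> 0" using uw w by auto
  then have "1 / (u - w)\<^sup>2 - 1 / w\<^sup>2 = u * (2 * w - u) / ((u - w)\<^sup>2 * w\<^sup>2)"
    using assms(2) by (simp add: divide_simps) (simp add: algebra_simps power2_eq_square)
  then have "norm (1 / (u - w)\<^sup>2 - 1 / w\<^sup>2) = norm u * norm (2 * w - u) / (norm (u - w) ^ 2 * norm w ^ 2)"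
    by (simp add: norm_mult norm_divide norm_power)
  also have "\<dots> \<le> norm u * (5 / 2 * norm w) / ((norm w / 2) ^ 2 * norm w ^ 2)"
  proof (intro frac_le mult_left_mono mult_right_mono power_mono mult_pos_pos)
    have "norm (2 * w - u) \<le> norm (2 * w) + norm u" by (rule norm_triangle_ineq4)
    then show "norm (2 * w - u) \<le> 5 / 2 * norm w" using assms by (simp add: norm_mult)
  qed (use uw w in auto)
  also have "\<dots> = 10 * norm u * (1 / norm w ^ 3)"
    using w by (simp add: field_simps eval_nat_numeral)
  finally show ?thesis by (simp add: norm_divide norm_power)
qed

lemma wp_abs_summable:
  assumes "Im z > 0"
  shows "(\<lambda>p. norm (1 / (u - lattice_pt z p)\<^sup>2 - 1 / lattice_pt z p ^ 2)) summable_on UNIV"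
proof -
  obtain c F where c: "c > 0" "finite F" "(0, 0) \<in> F"
    "\<And>p v. p \<notin> F \<Longrightarrow> norm v \<le> norm u \<Longrightarrow> norm (lattice_pt z p) \<ge> 2 * norm (v::complex)"
    "\<And>p v. p \<notin> F \<Longrightarrow> norm v \<le> norm u \<Longrightarrow> norm (v - lattice_pt z p) \<ge> c * lattice_norm p"
    "\<And>p. norm (lattice_pt z p) \<ge> c * lattice_norm p"
    by (rule shifted_lattice_lower[OF assms(1), of "norm u"]) (rule that)
  have e: "(\<lambda>p. norm (1 / lattice_pt z p ^ 3)) summable_on UNIV"
    using pole_sum_abs_summable[OF assms, of 3 0] by (simp add: norm_divide norm_power)
  show ?thesis
    by (rule abs_summable_finite_exceptions[OF c(2) summable_on_cmult_right[OF e, of "10 * norm u"]])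
      (use c in \<open>auto intro!: wp_term_bound simp: lattice_pt_eq_0_iff[OF assms]\<close>)
qed

lemma wp_has_sum:
  assumes "Im z > 0"
  shows "((\<lambda>p. 1 / (u - lattice_pt z p)\<^sup>2 - 1 / lattice_pt z p ^ 2) has_sum wp z u) UNIV"
  unfolding wp_def by (rule has_sum_infsum[OF abs_summable_summable[OF wp_abs_summable[OF assms]]])

lemma bij_add_lattice: "bij (\<lambda>p. p + q :: int \<times> int)"
  by (rule bij_betw_byWitness[of _ "\<lambda>p. p - q"]) auto

lemma pole_sum_periodic: "pole_sum k z (u + lattice_pt z q) = pole_sum k z u"
proof -
  have "pole_sum k z (u + lattice_pt z q) = (\<Sum>\<^sub>\<infinity>p. 1 / (u + lattice_pt z q - lattice_pt z (p + q)) ^ k)"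
    unfolding pole_sum_def by (rule infsum_reindex_bij_betw[OF bij_add_lattice, symmetric])
  then show ?thesis by (simp add: lattice_pt_add pole_sum_def)
qed

lemma pole_sum_uminus: "pole_sum k z (- u) = (- 1) ^ k * pole_sum k z u"
proof -
  have "pole_sum k z (- u) = (\<Sum>\<^sub>\<infinity>p. 1 / (- u - lattice_pt z (- p)) ^ k)"
    unfolding pole_sum_def by (rule infsum_reindex_bij_betw[OF uminus_bij, symmetric])
  also have "\<dots> = (\<Sum>\<^sub>\<infinity>p. (- 1) ^ k * (1 / (u - lattice_pt z p) ^ k))"
  proof (rule infsum_cong)
    fix p
    have "- u - lattice_pt z (- p) = (- 1) * (u - lattice_pt z p)" by (simp add: lattice_pt_minus)
    then have "(- u - lattice_pt z (- p)) ^ k = (- 1) ^ k * (u - lattice_pt z p) ^ k"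
      by (simp only: power_mult_distrib)
    then show "1 / (- u - lattice_pt z (- p)) ^ k = (- 1) ^ k * (1 / (u - lattice_pt z p) ^ k)"
      by (cases "even k") auto
  qed
  also have "\<dots> = (- 1) ^ k * (\<Sum>\<^sub>\<infinity>p. 1 / (u - lattice_pt z p) ^ k)"
    by (rule infsum_cmult_right')
  finally show ?thesis by (simp only: pole_sum_def)
qed

text \<open>The common remainder estimate for all expansions below: \<open>h\<close> is a Taylor
  remainder of order \<open>n\<close> in t = u / l, and summation over the points \<open>l p\<close>
  preserves that order, with j + n >= 3 giving convergence. A point \<open>l p = 0\<close>
  contributes 0 because of 1 / 0 = 0.\<close>

lemma small_sum:
  fixes l :: "'i \<Rightarrow> complex"
  assumes sum: "(\<lambda>p. 1 / norm (l p) ^ 3) summable_on UNIV"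
    and h: "\<And>t. norm t \<le> 1 / 2 \<Longrightarrow> norm (h t) \<le> K * norm t ^ n"
    and jn: "j \<ge> 1" "j + n \<ge> 3"
  obtains r C where "r > 0" "C \<ge> 0" "\<And>p. l p \<noteq> 0 \<Longrightarrow> norm (l p) \<ge> 2 * r"
    "\<And>u. norm u \<le> r \<Longrightarrow> (\<lambda>p. 1 / l p ^ j * h (u / l p)) summable_on UNIV"
    "\<And>u. norm u \<le> r \<Longrightarrow> norm (\<Sum>\<^sub>\<infinity>p. 1 / l p ^ j * h (u / l p)) \<le> C * norm u ^ n"
proof -
  define T where "T = (\<Sum>\<^sub>\<infinity>p. 1 / norm (l p) ^ 3)"
  have T0: "T \<ge> 0" unfolding T_def by (intro infsum_nonneg) auto
  \<comment> \<open>No single term exceeds the total \<open>T\<close>, whereas a nonzero point of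
    norm below d <= 1 would have 1 / |l|^3 >= 1 / |l| > T + 1. So the nonzero points stay away from
    0.\<close>
  define d where "d = 1 / (T + 1)"
  have d: "d > 0" "d \<le> 1" using T0 by (auto simp: d_def divide_simps)
  have K: "K \<ge> 0"
  proof -
    have "0 \<le> norm (h (1/2))" by simp
    also have "\<dots> \<le> K * norm (1/2 :: complex) ^ n" by (rule h) simp
    finally have "0 \<le> K * (1 / 2) ^ n" by (simp add: norm_divide)
    then show ?thesis by (metis half_gt_zero_iff mult_less_0_iff not_le zero_less_one zero_less_power)
  qed
  have lower: "norm (l p) \<ge> d" if "l p \<noteq> 0" for p
  proof (rule ccontr)
    assume "\<not> norm (l p) \<ge> d"
    then have lt: "norm (l p) < d" by simp
    have "1 / norm (l p) ^ 3 \<le> T"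
      unfolding T_def using finite_sum_le_infsum[OF sum, of "{p}"] by simp
    moreover have "norm (l p) ^ 3 \<le> norm (l p) ^ 1" using lt d by (intro power_decreasing) auto
    then have "1 / norm (l p) \<le> 1 / norm (l p) ^ 3" using that by (intro divide_left_mono) auto
    moreover have "1 / d < 1 / norm (l p)" using lt that d by (intro divide_strict_left_mono mult_pos_pos) auto
    then have "T + 1 < 1 / norm (l p)" by (simp add: d_def)
    ultimately show False by linarith
  qed
  have bound: "norm (1 / l p ^ j * h (u / l p)) \<le> K * norm u ^ n / d ^ (j + n - 3) * (1 / norm (l p) ^ 3)"
    if u: "norm u \<le> d / 2" for u p
  proof (cases "l p = 0")
    case True
    then show ?thesis using jn K d by simp
  next
    case False
    have l: "norm (l p) \<ge> d" "norm (l p) > 0" using lower[OF False] False by auto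
    have "norm (u / l p) \<le> 1 / 2" using u l by (simp add: norm_divide divide_simps)
    then have "norm (h (u / l p)) \<le> K * norm (u / l p) ^ n" by (rule h)
    then have "norm (1 / l p ^ j * h (u / l p)) \<le> 1 / norm (l p) ^ j * (K * norm (u / l p) ^ n)"
      unfolding norm_mult by (intro mult_mono) (auto simp: norm_divide norm_power)
    also have "\<dots> = K * norm u ^ n * (1 / norm (l p) ^ (j + n))"
      by (simp add: norm_divide power_divide power_add)
    also have "norm (l p) ^ (j + n) = norm (l p) ^ (j + n - 3) * norm (l p) ^ 3"
      using jn by (simp add: power_add[symmetric])
    also have "K * norm u ^ n * (1 / (norm (l p) ^ (j + n - 3) * norm (l p) ^ 3)) \<le>
        K * norm u ^ n * (1 / (d ^ (j + n - 3) * norm (l p) ^ 3))"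
      using l d K by (intro mult_left_mono divide_left_mono mult_right_mono power_mono mult_pos_pos) auto
    finally show ?thesis by simp
  qed
  have s: "(\<lambda>p. norm (1 / l p ^ j * h (u / l p))) summable_on UNIV" if "norm u \<le> d / 2" for u
    by (rule summable_on_comparison_test[OF summable_on_cmult_right[OF sum] bound[OF that]]) auto
  show thesis
  proof (rule that[of "d / 2" "K / d ^ (j + n - 3) * T"])
    show "(\<lambda>p. 1 / l p ^ j * h (u / l p)) summable_on UNIV" if "norm u \<le> d / 2" for u
      using abs_summable_summable[OF s[OF that]] .
    show "norm (\<Sum>\<^sub>\<infinity>p. 1 / l p ^ j * h (u / l p)) \<le> K / d ^ (j + n - 3) * T * norm u ^ n"
      if "norm u \<le> d / 2" for u
    proof -
      have "norm (\<Sum>\<^sub>\<infinity>p. 1 / l p ^ j * h (u / l p)) \<le> (\<Sum>\<^sub>\<infinity>p. norm (1 / l p ^ j * h (u / l p)))"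
        by (rule norm_infsum_bound[OF s[OF that]])
      also have "\<dots> \<le> (\<Sum>\<^sub>\<infinity>p. K * norm u ^ n / d ^ (j + n - 3) * (1 / norm (l p) ^ 3))"
        by (intro infsum_mono s that summable_on_cmult_right sum bound)
      also have "\<dots> = K * norm u ^ n / d ^ (j + n - 3) * T"
        unfolding T_def by (rule infsum_cmult_right')
      finally show ?thesis by (simp add: mult.commute mult.left_commute)
    qed
  qed (use d K T0 lower in auto)
qed

subsection \<open>The Weierstrass function\<close>

lemma has_sum_diff':
  fixes f g :: "'i \<Rightarrow> complex"
  assumes "(f has_sum a) A" "(g has_sum b) A"
  shows "((\<lambda>x. f x - g x) has_sum (a - b)) A"
  using has_sum_add[OF assms(1), of "\<lambda>x. - g x" "- b"] assms(2) by (simp add: has_sum_uminus)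

text \<open>Each row is a summable sequence shifted by one minus the sequence itself, so it sums to
  0. Summability over the plane is demanded of the differences \<open>f\<close> only, since
  \<open>b\<close> may be summable just along rows.\<close>

lemma row_sum_telescope:
  fixes f :: "'a \<times> int \<Rightarrow> complex"
  assumes "f summable_on UNIV" "\<And>m. (\<lambda>n. b m n) summable_on UNIV" "\<And>m n. f (m, n) = b m (n - 1) - b m n"
  shows "infsum f UNIV = 0"
proof -
  have "infsum f (UNIV \<times> UNIV) = infsum (\<lambda>m. infsum (\<lambda>n. f (m, n)) UNIV) UNIV"
    by (rule infsum_Sigma_banach[symmetric]) (use assms(1) in simp)
  moreover have "infsum (\<lambda>n. f (m, n)) UNIV = 0" for m
  proof -
    have bij: "bij (\<lambda>n::int. n - 1)" by (rule bij_betw_byWitness[of _ "\<lambda>n. n + 1"]) auto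
    have h: "((\<lambda>n. b m n) has_sum infsum (b m) UNIV) UNIV" using assms(2) by (rule has_sum_infsum)
    then have "((\<lambda>n. b m (n - 1)) has_sum infsum (b m) UNIV) UNIV"
      using has_sum_reindex_bij_betw[OF bij, of "b m"] by simp
    from has_sum_diff'[OF this h] have "((\<lambda>n. f (m, n)) has_sum 0) UNIV" by (simp add: assms(3))
    then show ?thesis by (rule infsumI)
  qed
  ultimately show ?thesis by simp
qed

lemma arith_prog_summable:
  fixes v t :: complex
  assumes "t \<noteq> 0"
  shows "(\<lambda>n::int. 1 / (v - of_int n * t)\<^sup>2) summable_on UNIV"
proof (rule abs_summable_summable, rule abs_summable_finite_exceptions)
  define B where "B = 2 * norm v / norm t"
  show "finite ({- \<lceil>B\<rceil>..\<lceil>B\<rceil>} \<union> {0})" by simp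
  show "(\<lambda>n::int. 4 / norm t ^ 2 * (max \<bar>of_int n\<bar> 1) powr (-3/2) :: real) summable_on UNIV"
    by (intro summable_on_cmult_right summable_on_int_powr)
  fix n :: int assume n: "n \<notin> {- \<lceil>B\<rceil>..\<lceil>B\<rceil>} \<union> {0}"
  then have "\<bar>n\<bar> > \<lceil>B\<rceil>" by auto
  then have "\<bar>of_int n\<bar> > B" by linarith
  then have nt: "\<bar>of_int n\<bar> * norm t > 2 * norm v" using assms by (simp add: B_def field_simps)
  have n1: "\<bar>of_int n\<bar> \<ge> (1::real)"
  proof -
    have "\<bar>n\<bar> \<ge> 1" using n by auto
    then show ?thesis by linarith
  qed
  have "norm (of_int n * t) - norm v \<le> norm (v - of_int n * t)"
    by (metis norm_minus_commute norm_triangle_ineq2)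
  then have le: "\<bar>of_int n\<bar> * norm t / 2 \<le> norm (v - of_int n * t)" using nt by (simp add: norm_mult)
  have p: "\<bar>of_int n\<bar> * norm t / 2 > 0" using n1 assms by simp
  have "norm (1 / (v - of_int n * t)\<^sup>2) = 1 / norm (v - of_int n * t) ^ 2" by (simp add: norm_divide norm_power)
  also have "\<dots> \<le> 1 / (\<bar>of_int n\<bar> * norm t / 2) ^ 2"
    using le p less_le_trans[OF p le] by (intro divide_left_mono power_mono mult_pos_pos zero_less_power) auto
  also have "\<dots> = 4 / norm t ^ 2 * (1 / \<bar>of_int n\<bar> ^ 2)" by (simp add: power_mult_distrib power_divide)
  also have "\<dots> \<le> 4 / norm t ^ 2 * (max \<bar>of_int n\<bar> 1) powr (-3/2)"
  proof (rule mult_left_mono)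
    have "1 / \<bar>of_int n :: real\<bar> ^ 2 = \<bar>of_int n\<bar> powr (- 2)"
      using n1 by (simp add: powr_minus inverse_eq_divide)
    also have "\<bar>of_int n :: real\<bar> powr (- 2) \<le> \<bar>of_int n\<bar> powr (-3/2)" using n1 by (intro powr_mono) auto
    also have "\<bar>of_int n :: real\<bar> = max \<bar>of_int n\<bar> 1" using n1 by simp
    finally show "1 / \<bar>of_int n :: real\<bar> ^ 2 \<le> (max \<bar>of_int n\<bar> 1) powr (-3/2)" using n1 by simp
  qed simp
  finally show "norm (1 / (v - of_int n * t)\<^sup>2) \<le> 4 / norm t ^ 2 * (max \<bar>of_int n\<bar> 1) powr (-3/2)" .
qed

text \<open>The terms 1 / (u - l)^2 are not summable over the lattice by themselves, so a plain
  reindexing is not legitimate. The difference of the shifted and the unshifted series is summable,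
  and it telescopes in the direction of the period. For the period 1 the coordinates are swapped
  first.\<close>

lemma wp_periodic_aux:
  assumes "Im z > 0"
  shows "wp z (u + z) = wp z u" "wp z (u + 1) = wp z u"
proof -
  have z: "z \<noteq> 0" using assms by auto
  define a where "a = (\<lambda>p. 1 / (u - lattice_pt z p)\<^sup>2)"
  have d: "((\<lambda>p. a (p - q) - a p) has_sum (wp z (u + lattice_pt z q) - wp z u)) UNIV" for q
    using has_sum_diff'[OF wp_has_sum[OF assms, of "u + lattice_pt z q"] wp_has_sum[OF assms, of u]]
    by (simp add: a_def lattice_pt_diff algebra_simps)
  have "infsum (\<lambda>p. a (p - (0, 1)) - a p) UNIV = 0"
  proof (rule row_sum_telescope[where b = "\<lambda>m n. a (m, n)"])
    show "(\<lambda>p. a (p - (0, 1)) - a p) summable_on UNIV" using d summable_on_def by blast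
    show "(\<lambda>n. a (m, n)) summable_on UNIV" for m
      using arith_prog_summable[OF z, of "u - of_int m"] by (simp add: a_def lattice_pt_def diff_diff_eq)
  qed simp
  then have "wp z (u + lattice_pt z (0, 1)) - wp z u = 0" using infsumI[OF d[of "(0, 1)"]] by simp
  then show "wp z (u + z) = wp z u" by (simp add: lattice_pt_def)
  have swap: "bij (prod.swap :: int \<times> int \<Rightarrow> _)" by (rule bij_swap)
  have "infsum (\<lambda>p. a (prod.swap p - (1, 0)) - a (prod.swap p)) UNIV = 0"
  proof (rule row_sum_telescope[where b = "\<lambda>n m. a (m, n)"])
    show "(\<lambda>p. a (prod.swap p - (1, 0)) - a (prod.swap p)) summable_on UNIV"
      using d[of "(1, 0)"] summable_on_def summable_on_reindex_bij_betw[OF swap, of "\<lambda>p. a (p - (1, 0)) - a p"] by blast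
    show "(\<lambda>m. a (m, n)) summable_on UNIV" for n
      using arith_prog_summable[of 1 "u - of_int n * z"]
      by (simp add: a_def lattice_pt_def diff_diff_eq add.commute)
  qed simp
  also have "infsum (\<lambda>p. a (prod.swap p - (1, 0)) - a (prod.swap p)) UNIV = infsum (\<lambda>p. a (p - (1, 0)) - a p) UNIV"
    by (rule infsum_reindex_bij_betw[OF swap, of "\<lambda>p. a (p - (1, 0)) - a p"])
  finally have "wp z (u + lattice_pt z (1, 0)) - wp z u = 0" using infsumI[OF d[of "(1, 0)"]] by simp
  then show "wp z (u + 1) = wp z u" by (simp add: lattice_pt_def)
qed

lemma periodic_of_int:
  fixes f :: "complex \<Rightarrow> 'a"
  assumes "\<And>u. f (u + t) = f u"
  shows "f (u + of_int n * t) = f u"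
proof (induction n rule: int_induct[of _ 0])
  case (step1 i) then show ?case using assms[of "u + of_int i * t"] by (simp add: algebra_simps)
next
  case (step2 i) then show ?case using assms[of "u + of_int (i - 1) * t"] by (simp add: algebra_simps)
qed simp

lemma wp_periodic: "Im z > 0 \<Longrightarrow> wp z (u + lattice_pt z q) = wp z u"
  using periodic_of_int[of "wp z" z "u + of_int (fst q)" "snd q"] periodic_of_int[of "wp z" 1 u "fst q"]
  by (simp add: wp_periodic_aux lattice_pt_def add.assoc)

text \<open>Liouville's theorem: the limits at \<open>S\<close> remove the singularities, and
  periodicity bounds the resulting entire function by its values on one parallelogram.
  \<open>S\<close> is general because it will be the lattice in one application and the union of the
  lattice with a half-period translate in another.\<close>

lemma doubly_periodic_const:
  fixes f :: "complex \<Rightarrow> complex"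
  assumes z: "Im z > 0" and e: "e > 0" "\<And>x y. x \<in> S \<Longrightarrow> y \<in> S \<Longrightarrow> dist y x < e \<Longrightarrow> y = x"
    and hol: "f holomorphic_on - S"
    and lim: "\<And>s. s \<in> S \<Longrightarrow> \<exists>l. (f \<longlongrightarrow> l) (at s)"
    and per: "\<And>u q. u \<notin> S \<Longrightarrow> f (u + lattice_pt z q) = f u"
    and perS: "\<And>u q. u + lattice_pt z q \<in> S \<longleftrightarrow> u \<in> S"
    and s: "s \<in> S" "(f \<longlongrightarrow> l) (at s)" and u: "u \<notin> S"
  shows "f u = l"
proof -
  define g where "g = (\<lambda>u. if u \<in> S then Lim (at u) f else f u)"
  have gS: "(f \<longlongrightarrow> g x) (at x)" if "x \<in> S" for x
  proof -
    obtain l where "(f \<longlongrightarrow> l) (at x)" using lim \<open>x \<in> S\<close> by blast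
    then show ?thesis using that by (simp add: g_def tendsto_Lim)
  qed
  have cl: "closed (S - {x})" for x by (rule discrete_imp_closed[OF e(1)]) (use e(2) in auto)
  have clS: "closed S" by (rule discrete_imp_closed[OF e(1)]) (use e(2) in auto)
  have hg: "g holomorphic_on UNIV"
  proof (rule analytic_imp_holomorphic, unfold analytic_on_def, intro ballI)
    fix x
    show "\<exists>e>0. g holomorphic_on ball x e"
    proof (cases "x \<in> S")
      case True
      define A where "A = - (S - {x})"
      have A: "open A" "x \<in> A" unfolding A_def by (rule open_Compl[OF cl]) simp
      have eq: "- S = A - {x}" using True by (auto simp: A_def)
      have "(\<lambda>y. if y = x then g x else f y) holomorphic_on A"
        using removable_singularity[OF hol[unfolded eq] A(1) gS[OF True]] .
      then have "g holomorphic_on A"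
        by (rule holomorphic_transform) (use True in \<open>auto simp: g_def A_def\<close>)
      then show ?thesis using A openE holomorphic_on_subset by metis
    next
      case False
      have "g holomorphic_on - S" by (rule holomorphic_transform[OF hol]) (auto simp: g_def)
      then show ?thesis using False clS openE holomorphic_on_subset by (metis ComplI open_Compl)
    qed
  qed
  have "continuous_on (cball 0 (1 + norm z)) g"
    using hg holomorphic_on_imp_continuous_on continuous_on_subset by blast
  then have "bounded (g ` cball 0 (1 + norm z))" by (intro compact_imp_bounded compact_continuous_image) auto
  then obtain B where "\<forall>x\<in>cball 0 (1 + norm z). norm (g x) \<le> B" by (auto simp: bounded_iff)
  then have B: "norm (g x) \<le> B" if "norm x \<le> 1 + norm z" for x using that by simp
  have bf: "norm (f x) \<le> B" if "x \<notin> S" for x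
  proof -
    \<comment> \<open>\<open>a\<close> and \<open>b\<close> are the real coordinates of
      \<open>x\<close> in the basis 1, \<open>z\<close>. Removing their integer parts moves
      \<open>x\<close> into the fundamental parallelogram, which lies in the ball of radius 1 +
      |z|.\<close>
    define b where "b = Im x / Im z"
    define a where "a = Re x - b * Re z"
    define q where "q = (- \<lfloor>a\<rfloor>, - \<lfloor>b\<rfloor>)"
    define x0 where "x0 = x + lattice_pt z q"
    have x: "x = of_real a + of_real b * z" using z by (simp add: complex_eq_iff a_def b_def)
    have x0: "x0 = of_real (frac a) + of_real (frac b) * z"
      unfolding x0_def x q_def lattice_pt_def by (simp add: frac_def algebra_simps)
    have "norm x0 \<le> norm (of_real (frac a) :: complex) + norm (of_real (frac b) * z)"
      unfolding x0 by (rule norm_triangle_ineq)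
    also have "\<dots> \<le> 1 + 1 * norm z"
      unfolding norm_mult norm_of_real
      by (intro add_mono mult_right_mono) (auto simp: frac_lt_1 less_imp_le)
    finally have "norm (g x0) \<le> B" by (intro B) simp
    moreover have "x0 \<notin> S" using perS[of x q] that by (simp add: x0_def)
    ultimately show ?thesis using per[OF that, of q] by (simp add: g_def x0_def)
  qed
  have bg: "norm (g x) \<le> B" for x
  proof (cases "x \<in> S")
    case True
    have "eventually (\<lambda>y. y \<in> - (S - {x})) (nhds x)"
      by (rule eventually_nhds_in_open[OF open_Compl[OF cl]]) simp
    then have "eventually (\<lambda>y. norm (f y) \<le> B) (at x)"
      unfolding eventually_at_filter by eventually_elim (use bf in auto)
    then show ?thesis using gS[OF True] by (intro Lim_norm_ubound[of "at x"]) auto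
  qed (use bf in \<open>simp add: g_def\<close>)
  have "g constant_on UNIV"
    by (rule Liouville_theorem[OF hg]) (auto simp: bounded_iff intro!: exI[of _ B] bg)
  then have "g u = g s" by (auto simp: constant_on_def)
  moreover have "g s = l" using gS[OF s(1)] s(2) tendsto_unique[of "at s"] by auto
  ultimately show ?thesis using u by (simp add: g_def)
qed

lemma lattice_separated:
  assumes "Im z > 0"
  obtains e where "e > 0" "\<And>p. p \<noteq> (0, 0) \<Longrightarrow> norm (lattice_pt z p) \<ge> e"
    "\<And>x y. x \<in> lattice z \<Longrightarrow> y \<in> lattice z \<Longrightarrow> dist y x < e \<Longrightarrow> y = x"
proof -
  obtain c where c: "c > 0" "\<And>p. norm (lattice_pt z p) \<ge> c * lattice_norm p"
    using lattice_pt_lower' assms by blast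
  have *: "norm (lattice_pt z p) \<ge> c" if "p \<noteq> (0, 0)" for p
  proof -
    have "c * 1 \<le> c * lattice_norm p" using c(1) lattice_norm_ge_1[OF that] by (intro mult_left_mono) auto
    then show ?thesis using c(2)[of p] by simp
  qed
  show thesis
  proof (rule that[OF c(1) *])
    fix x y assume "x \<in> lattice z" "y \<in> lattice z" "dist y x < c"
    then obtain p q where pq: "x = lattice_pt z p" "y = lattice_pt z q" by (auto simp: lattice_def)
    have "norm (lattice_pt z (q - p)) < c" using \<open>dist y x < c\<close> by (simp add: pq dist_norm lattice_pt_diff)
    then have "q - p = (0, 0)" using *[of "q - p"] by force
    then have "q = p" by (cases p; cases q) auto
    then show "y = x" by (simp add: pq)
  qed
qed

lemma closed_lattice: "Im z > 0 \<Longrightarrow> closed (lattice z)"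
proof -
  assume "Im z > 0"
  then obtain e where "e > 0" "\<And>x y. x \<in> lattice z \<Longrightarrow> y \<in> lattice z \<Longrightarrow> dist y x < e \<Longrightarrow> y = x"
    by (rule lattice_separated[of z]) (rule that)
  then show ?thesis by (intro discrete_imp_closed) auto
qed

lemma lattice_periodic: "u + lattice_pt z q \<in> lattice z \<longleftrightarrow> u \<in> lattice z"
proof
  assume "u + lattice_pt z q \<in> lattice z"
  then obtain p where "u + lattice_pt z q = lattice_pt z p" by (auto simp: lattice_def)
  then have "u = lattice_pt z (p - q)" by (simp add: lattice_pt_diff algebra_simps)
  then show "u \<in> lattice z" by (simp add: lattice_def)
next
  assume "u \<in> lattice z"
  then show "u + lattice_pt z q \<in> lattice z" by (auto simp: lattice_def lattice_pt_add[symmetric])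
qed

lemma periodic_tendsto:
  fixes f :: "complex \<Rightarrow> complex"
  assumes "(f \<longlongrightarrow> l) (at 0)" "\<And>u. f (u + w) = f u"
  shows "(f \<longlongrightarrow> l) (at w)"
proof -
  have "((\<lambda>u. f (u + w)) \<longlongrightarrow> l) (at 0)" using assms by simp
  then show ?thesis using LIM_offset_zero_iff[of w f l] by (simp add: add.commute)
qed

lemma wp_holomorphic:
  assumes "Im z > 0" shows "wp z holomorphic_on - lattice z"
  unfolding wp_def[abs_def]
proof (rule holomorphic_on_infsum)
  show op: "open (- lattice z)" using closed_lattice[OF assms] by (simp add: open_Compl)
  show "(\<lambda>u. 1 / (u - lattice_pt z p)\<^sup>2 - 1 / lattice_pt z p ^ 2) holomorphic_on - lattice z" for p
    by (intro holomorphic_intros) (auto simp: lattice_def)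
  fix x assume "x \<in> - lattice z"
  then obtain r where r: "r > 0" "cball x r \<subseteq> - lattice z" using op open_contains_cball by blast
  obtain c F where c: "c > 0" "finite F" "(0, 0) \<in> F"
    "\<And>p v. p \<notin> F \<Longrightarrow> norm v \<le> norm x + r \<Longrightarrow> norm (lattice_pt z p) \<ge> 2 * norm (v::complex)"
    "\<And>p v. p \<notin> F \<Longrightarrow> norm v \<le> norm x + r \<Longrightarrow> norm (v - lattice_pt z p) \<ge> c * lattice_norm p"
    "\<And>p. norm (lattice_pt z p) \<ge> c * lattice_norm p"
    by (rule shifted_lattice_lower[OF assms, of "norm x + r"]) (rule that)
  have e: "(\<lambda>p. norm (1 / lattice_pt z p ^ 3)) summable_on UNIV"
    using pole_sum_abs_summable[OF assms, of 3 0] by (simp add: norm_divide norm_power)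
  have "norm (1 / (v - lattice_pt z p)\<^sup>2 - 1 / lattice_pt z p ^ 2) \<le> 10 * (norm x + r) * norm (1 / lattice_pt z p ^ 3)"
    if "p \<notin> F" "v \<in> cball x r" for p v
  proof -
    have "norm v \<le> norm x + norm (v - x)" by (metis norm_triangle_sub)
    then have v: "norm v \<le> norm x + r" using that(2) by (simp add: dist_norm norm_minus_commute)
    have "norm (1 / (v - lattice_pt z p)\<^sup>2 - 1 / lattice_pt z p ^ 2) \<le> 10 * norm v * norm (1 / lattice_pt z p ^ 3)"
      using that(1) c v by (intro wp_term_bound) (auto simp: lattice_pt_eq_0_iff[OF assms])
    also have "\<dots> \<le> 10 * (norm x + r) * norm (1 / lattice_pt z p ^ 3)"
      using v by (intro mult_right_mono mult_left_mono) auto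
    finally show ?thesis .
  qed
  then show "\<exists>r>0. \<exists>F M. cball x r \<subseteq> - lattice z \<and> finite F \<and> M summable_on UNIV \<and>
      (\<forall>p. p \<notin> F \<longrightarrow> (\<forall>y\<in>cball x r. norm (1 / (y - lattice_pt z p)\<^sup>2 - 1 / lattice_pt z p ^ 2) \<le> M p))"
    using r c(2) summable_on_cmult_right[OF e, of "10 * (norm x + r)"]
    by (intro exI[of _ r] exI[of _ F] exI[of _ "\<lambda>p. 10 * (norm x + r) * norm (1 / lattice_pt z p ^ 3)"] conjI) auto
qed

lemma pole_sum_holomorphic:
  assumes "Im z > 0" "k \<ge> 3" shows "pole_sum k z holomorphic_on - lattice z"
  unfolding pole_sum_def[abs_def]
proof (rule holomorphic_on_infsum)
  show op: "open (- lattice z)" using closed_lattice[OF assms(1)] by (simp add: open_Compl)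
  show "(\<lambda>u. 1 / (u - lattice_pt z p) ^ k) holomorphic_on - lattice z" for p
    by (intro holomorphic_intros) (auto simp: lattice_def)
  fix x assume "x \<in> - lattice z"
  then obtain r where r: "r > 0" "cball x r \<subseteq> - lattice z" using op open_contains_cball by blast
  obtain c F where c: "c > 0" "finite F" "(0, 0) \<in> F"
    "\<And>p v. p \<notin> F \<Longrightarrow> norm v \<le> norm x + r \<Longrightarrow> norm (lattice_pt z p) \<ge> 2 * norm (v::complex)"
    "\<And>p v. p \<notin> F \<Longrightarrow> norm v \<le> norm x + r \<Longrightarrow> norm (v - lattice_pt z p) \<ge> c * lattice_norm p"
    "\<And>p. norm (lattice_pt z p) \<ge> c * lattice_norm p"
    by (rule shifted_lattice_lower[OF assms(1), of "norm x + r"]) (rule that)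
  have "norm (1 / (v - lattice_pt z p) ^ k) \<le> 1 / c ^ k * (1 / lattice_norm p ^ 3)"
    if "p \<notin> F" "v \<in> cball x r" for p v
  proof -
    have "norm v \<le> norm x + norm (v - x)" by (metis norm_triangle_sub)
    then have v: "norm v \<le> norm x + r" using that(2) by (simp add: dist_norm norm_minus_commute)
    then show ?thesis using that(1) c assms(2) by (intro inverse_power_bound) auto
  qed
  then show "\<exists>r>0. \<exists>F M. cball x r \<subseteq> - lattice z \<and> finite F \<and> M summable_on UNIV \<and>
      (\<forall>p. p \<notin> F \<longrightarrow> (\<forall>y\<in>cball x r. norm (1 / (y - lattice_pt z p) ^ k) \<le> M p))"
    using r c(2) summable_on_cmult_right[OF lattice_norm_summable, of "1 / c ^ k"]
    by (intro exI[of _ r] exI[of _ F] exI[of _ "\<lambda>p. 1 / c ^ k * (1 / lattice_norm p ^ 3)"] conjI) auto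
qed

section \<open>Laurent expansions and differential equations\<close>

lemma has_sum_eqI: "(f has_sum a) A \<Longrightarrow> (\<And>x. f x = g x) \<Longrightarrow> a = b \<Longrightarrow> (g has_sum b) A"
  by (metis has_sum_cong)

text \<open>The remainder has order n + 1, so one factor of u survives the division by u^n. The
  identity for \<open>S\<close> is demanded only within half of the distance to the nonzero points,
  where t = u / l satisfies |t| <= 1/2.\<close>

lemma small_sum_tendsto:
  fixes l :: "'i \<Rightarrow> complex"
  assumes sum: "(\<lambda>p. 1 / norm (l p) ^ 3) summable_on UNIV"
    and h: "\<And>t. norm t \<le> 1 / 2 \<Longrightarrow> norm (h t) \<le> K * norm t ^ Suc n"
    and jn: "j \<ge> 1" "j + Suc n \<ge> 3"
    and S: "\<And>u r. r > 0 \<Longrightarrow> u \<noteq> 0 \<Longrightarrow> norm u \<le> r \<Longrightarrow> (\<And>p. l p \<noteq> 0 \<Longrightarrow> norm (l p) \<ge> 2 * r) \<Longrightarrow>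
               ((\<lambda>p. 1 / l p ^ j * h (u / l p)) has_sum S u) UNIV"
  shows "((\<lambda>u. S u / u ^ n) \<longlongrightarrow> 0) (at 0)"
proof -
  obtain r C where r: "r > 0" "C \<ge> 0" "\<And>p. l p \<noteq> 0 \<Longrightarrow> norm (l p) \<ge> 2 * r"
    "\<And>u. norm u \<le> r \<Longrightarrow> (\<lambda>p. 1 / l p ^ j * h (u / l p)) summable_on UNIV"
    "\<And>u. norm u \<le> r \<Longrightarrow> norm (\<Sum>\<^sub>\<infinity>p. 1 / l p ^ j * h (u / l p)) \<le> C * norm u ^ Suc n"
    by (rule small_sum[OF sum h jn]) (assumption, rule that)
  have "norm (S u / u ^ n) \<le> C * norm u" if "u \<noteq> 0" "norm u \<le> r" for u
  proof -
    have "norm (S u) \<le> C * norm u ^ Suc n"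
      using r(5)[OF that(2)] infsumI[OF S[OF r(1) that r(3)]] by simp
    then show ?thesis using that by (simp add: norm_divide norm_power divide_simps mult.assoc)
  qed
  then have "eventually (\<lambda>u. norm (S u / u ^ n) \<le> C * norm u) (at 0)"
    unfolding eventually_at using r(1) by (intro exI[of _ r]) (auto simp: dist_norm)
  moreover have "((\<lambda>u. C * norm u) \<longlongrightarrow> 0) (at (0::complex))"
    by (auto intro!: tendsto_eq_intros)
  ultimately show ?thesis by (rule Lim_null_comparison)
qed

lemma lattice_inverse_cube_summable:
  assumes "Im z > 0" shows "(\<lambda>p. 1 / norm (lattice_pt z p - w) ^ 3) summable_on UNIV"
  using pole_sum_abs_summable[OF assms, of 3 w] by (simp add: norm_divide norm_power norm_minus_commute)

lemma quotient_power_bound: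
  fixes t :: complex
  assumes "norm t \<le> 1 / 2" "norm q \<le> C" "h = t ^ n * q / (1 - t) ^ k"
  shows "norm h \<le> C * 2 ^ k * norm t ^ n"
proof -
  have "1 - norm t \<le> norm (1 - t)" by (metis norm_one norm_triangle_ineq2)
  then have t: "1 / 2 \<le> norm (1 - t)" using assms(1) by simp
  have C: "C \<ge> 0" using assms(2) norm_ge_zero order_trans by blast
  have "norm h = norm t ^ n * norm q / norm (1 - t) ^ k"
    by (simp add: assms(3) norm_divide norm_power norm_mult)
  also have "\<dots> \<le> norm t ^ n * C / (1 / 2) ^ k"
    using t assms C by (intro frac_le mult_left_mono power_mono) auto
  finally show ?thesis by (simp add: field_simps)
qed

text \<open>The geometric series in t = u / l are summed over the lattice, and the Eisenstein sums
  of odd exponent vanish by symmetry. The expansions go just far enough to determine the constant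
  terms of the polynomial relations among these functions.\<close>

lemma expansion_at_0:
  assumes z: "Im z > 0"
  shows wp_at_0: "((\<lambda>u. (wp z u - 1 / u\<^sup>2 - 3 * eis_sum 4 z * u\<^sup>2 - 5 * eis_sum 6 z * u ^ 4) / u ^ 4) \<longlongrightarrow> 0) (at 0)" (is ?A)
    and pole_sum3_at_0: "((\<lambda>u. (pole_sum 3 z u - 1 / u ^ 3 + 3 * eis_sum 4 z * u + 10 * eis_sum 6 z * u ^ 3) / u ^ 3) \<longlongrightarrow> 0) (at 0)" (is ?B)
    and pole_sum4_at_0: "((\<lambda>u. pole_sum 4 z u - 1 / u ^ 4) \<longlongrightarrow> eis_sum 4 z) (at 0)" (is ?C)
    and pole_sum6_at_0: "((\<lambda>u. pole_sum 6 z u - 1 / u ^ 6) \<longlongrightarrow> eis_sum 6 z) (at 0)" (is ?D)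
proof -
  note lat0 = lattice_pt_eq_0_iff[OF z]
  have sum: "(\<lambda>p. 1 / norm (lattice_pt z p) ^ 3) summable_on UNIV"
    using lattice_inverse_cube_summable[OF z, of 0] by simp
  have E: "((\<lambda>p. c * (1 / lattice_pt z p ^ k)) has_sum c * eis_sum k z) UNIV" if "k \<ge> 3" for c k
    by (rule has_sum_cmult_right[OF eis_has_sum[OF z that]])
  have odd: "eis_sum 3 z = 0" "eis_sum 5 z = 0" using eis_sum_odd[OF z] by auto
  have ne: "lattice_pt z p \<noteq> 0 \<and> u - lattice_pt z p \<noteq> 0 \<and> 1 - u / lattice_pt z p \<noteq> 0 \<and>
      u - lattice_pt z p = - lattice_pt z p * (1 - u / lattice_pt z p)"
    if "r > 0" "norm u \<le> r" "\<And>p. lattice_pt z p \<noteq> 0 \<Longrightarrow> norm (lattice_pt z p) \<ge> 2 * r" "p \<noteq> (0, 0)" for r u p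
  proof -
    have l: "lattice_pt z p \<noteq> 0" using that(4) by (simp add: lat0)
    have "u \<noteq> lattice_pt z p" using that(3)[OF l] that(1,2) by auto
    then show ?thesis using l by (simp add: field_simps)
  qed
  \<comment> \<open>\<open>h\<close> is the tail of the series of 1 / (1 - t)^2 after t^4, that is
    t^5 (6 - 5 t) / (1 - t)^2, and 9 bounds |6 - 5 t|.\<close>
  show ?A
  proof (rule small_sum_tendsto[OF sum, where h = "\<lambda>t. 1 / (1 - t)\<^sup>2 - (1 + 2 * t + 3 * t\<^sup>2 + 4 * t ^ 3 + 5 * t ^ 4)" and j = 2 and K = "9 * 2 ^ 2"])
    fix t :: complex assume t: "norm t \<le> 1 / 2"
    have "norm (6 - 5 * t) \<le> norm (6::complex) + norm (5 * t)" by (rule norm_triangle_ineq4)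
    then have "norm (6 - 5 * t) \<le> 9" using t by (simp add: norm_mult)
    moreover have "1 / (1 - t)\<^sup>2 - (1 + 2 * t + 3 * t\<^sup>2 + 4 * t ^ 3 + 5 * t ^ 4) = t ^ Suc 4 * (6 - 5 * t) / (1 - t)\<^sup>2"
    proof -
      have "1 - t \<noteq> 0" using t by auto
      then show ?thesis by (simp add: divide_simps) (simp add: algebra_simps eval_nat_numeral)
    qed
    ultimately show "norm (1 / (1 - t)\<^sup>2 - (1 + 2 * t + 3 * t\<^sup>2 + 4 * t ^ 3 + 5 * t ^ 4)) \<le> 9 * 2 ^ 2 * norm t ^ Suc 4"
      by (rule quotient_power_bound[OF t])
  next
    fix u :: complex and r :: real
    assume r: "r > 0" "u \<noteq> 0" "norm u \<le> r" "\<And>p. lattice_pt z p \<noteq> 0 \<Longrightarrow> norm (lattice_pt z p) \<ge> 2 * r"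
    \<comment> \<open>The lattice point 0 contributes exactly the pole 1 / u^2, which is split off
      as a delta term; the series in u / l concerns the other points.\<close>
    have "((\<lambda>p. (1 / (u - lattice_pt z p)\<^sup>2 - 1 / lattice_pt z p ^ 2) - (if p = (0, 0) then 1 / u\<^sup>2 else 0)
        - 2 * u * (1 / lattice_pt z p ^ 3) - 3 * u\<^sup>2 * (1 / lattice_pt z p ^ 4) - 4 * u ^ 3 * (1 / lattice_pt z p ^ 5)
        - 5 * u ^ 4 * (1 / lattice_pt z p ^ 6)) has_sum
       wp z u - 1 / u\<^sup>2 - 2 * u * eis_sum 3 z - 3 * u\<^sup>2 * eis_sum 4 z - 4 * u ^ 3 * eis_sum 5 z - 5 * u ^ 4 * eis_sum 6 z) UNIV"
      by (intro has_sum_diff' wp_has_sum z has_sum_delta E) auto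
    then show "((\<lambda>p. 1 / lattice_pt z p ^ 2 * (1 / (1 - u / lattice_pt z p)\<^sup>2 - (1 + 2 * (u / lattice_pt z p) +
        3 * (u / lattice_pt z p)\<^sup>2 + 4 * (u / lattice_pt z p) ^ 3 + 5 * (u / lattice_pt z p) ^ 4))) has_sum
        (wp z u - 1 / u\<^sup>2 - 3 * eis_sum 4 z * u\<^sup>2 - 5 * eis_sum 6 z * u ^ 4)) UNIV"
    proof (rule has_sum_eqI)
      fix p
      show "1 / (u - lattice_pt z p)\<^sup>2 - 1 / lattice_pt z p ^ 2 - (if p = (0, 0) then 1 / u\<^sup>2 else 0)
        - 2 * u * (1 / lattice_pt z p ^ 3) - 3 * u\<^sup>2 * (1 / lattice_pt z p ^ 4) - 4 * u ^ 3 * (1 / lattice_pt z p ^ 5)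
        - 5 * u ^ 4 * (1 / lattice_pt z p ^ 6) = 1 / lattice_pt z p ^ 2 * (1 / (1 - u / lattice_pt z p)\<^sup>2 - (1 + 2 * (u / lattice_pt z p) +
        3 * (u / lattice_pt z p)\<^sup>2 + 4 * (u / lattice_pt z p) ^ 3 + 5 * (u / lattice_pt z p) ^ 4))"
      proof (cases "p = (0, 0)")
        case True then show ?thesis by (simp add: lattice_pt_def)
      next
        case False
        define w v where "w = lattice_pt z p" and "v = 1 / (1 - u / w)\<^sup>2"
        have w: "w \<noteq> 0" "u - w = - w * (1 - u / w)" using ne[OF r(1,3,4) False] by (auto simp: w_def)
        have "1 / (u - w)\<^sup>2 = 1 / w\<^sup>2 * v" unfolding w(2) v_def by (simp add: power_mult_distrib)
        moreover have "1 / w\<^sup>2 * v - 1 / w\<^sup>2 - 2 * u * (1 / w ^ 3) - 3 * u\<^sup>2 * (1 / w ^ 4) - 4 * u ^ 3 * (1 / w ^ 5) - 5 * u ^ 4 * (1 / w ^ 6)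
          = 1 / w\<^sup>2 * (v - (1 + 2 * (u / w) + 3 * (u / w)\<^sup>2 + 4 * (u / w) ^ 3 + 5 * (u / w) ^ 4))"
          using w(1) by (simp add: field_simps eval_nat_numeral)
        ultimately show ?thesis using False by (simp add: w_def[symmetric] v_def[symmetric])
      qed
    qed (simp add: odd mult_ac)
  qed simp_all
  \<comment> \<open>Here \<open>h\<close> is minus the tail of the series of 1 / (1 - t)^3 after
    t^3; the sign comes from (u - l)^3 = - l^3 (1 - t)^3.\<close>
  show ?B
  proof (rule small_sum_tendsto[OF sum, where h = "\<lambda>t. (1 + 3 * t + 6 * t\<^sup>2 + 10 * t ^ 3) - 1 / (1 - t) ^ 3" and j = 3 and K = "35 * 2 ^ 3"])
    fix t :: complex assume t: "norm t \<le> 1 / 2"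
    have "norm (- 15 + 24 * t - 10 * t\<^sup>2) \<le> norm (- 15 + 24 * t) + norm (10 * t\<^sup>2)" by (rule norm_triangle_ineq4)
    also have "\<dots> \<le> norm (- 15 :: complex) + norm (24 * t) + norm (10 * t\<^sup>2)" by (intro add_right_mono norm_triangle_ineq)
    also have "\<dots> \<le> 15 + 12 + 10 * (1/2)^2"
      using t by (auto simp: norm_mult norm_power intro!: add_mono power_mono)
    finally have "norm (- 15 + 24 * t - 10 * t\<^sup>2) \<le> 35" by (simp add: power2_eq_square)
    moreover have "(1 + 3 * t + 6 * t\<^sup>2 + 10 * t ^ 3) - 1 / (1 - t) ^ 3 = t ^ Suc 3 * (- 15 + 24 * t - 10 * t\<^sup>2) / (1 - t) ^ 3"
    proof -
      have "1 - t \<noteq> 0" using t by auto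
      then show ?thesis by (simp add: divide_simps) (simp add: algebra_simps eval_nat_numeral)
    qed
    ultimately show "norm ((1 + 3 * t + 6 * t\<^sup>2 + 10 * t ^ 3) - 1 / (1 - t) ^ 3) \<le> 35 * 2 ^ 3 * norm t ^ Suc 3"
      by (rule quotient_power_bound[OF t])
  next
    fix u :: complex and r :: real
    assume r: "r > 0" "u \<noteq> 0" "norm u \<le> r" "\<And>p. lattice_pt z p \<noteq> 0 \<Longrightarrow> norm (lattice_pt z p) \<ge> 2 * r"
    have "((\<lambda>p. 1 / (u - lattice_pt z p) ^ 3 - (if p = (0, 0) then 1 / u ^ 3 else 0)
        - (- 1) * (1 / lattice_pt z p ^ 3) - (- 3 * u) * (1 / lattice_pt z p ^ 4) - (- 6 * u\<^sup>2) * (1 / lattice_pt z p ^ 5)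
        - (- 10 * u ^ 3) * (1 / lattice_pt z p ^ 6)) has_sum
       pole_sum 3 z u - 1 / u ^ 3 - (- 1) * eis_sum 3 z - (- 3 * u) * eis_sum 4 z - (- 6 * u\<^sup>2) * eis_sum 5 z - (- 10 * u ^ 3) * eis_sum 6 z) UNIV"
      by (intro has_sum_diff' pole_sum_has_sum z has_sum_delta E) auto
    then show "((\<lambda>p. 1 / lattice_pt z p ^ 3 * ((1 + 3 * (u / lattice_pt z p) + 6 * (u / lattice_pt z p)\<^sup>2 + 10 * (u / lattice_pt z p) ^ 3)
        - 1 / (1 - u / lattice_pt z p) ^ 3)) has_sum
        (pole_sum 3 z u - 1 / u ^ 3 + 3 * eis_sum 4 z * u + 10 * eis_sum 6 z * u ^ 3)) UNIV"
    proof (rule has_sum_eqI)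
      fix p
      show "1 / (u - lattice_pt z p) ^ 3 - (if p = (0, 0) then 1 / u ^ 3 else 0)
        - (- 1) * (1 / lattice_pt z p ^ 3) - (- 3 * u) * (1 / lattice_pt z p ^ 4) - (- 6 * u\<^sup>2) * (1 / lattice_pt z p ^ 5)
        - (- 10 * u ^ 3) * (1 / lattice_pt z p ^ 6) = 1 / lattice_pt z p ^ 3 * ((1 + 3 * (u / lattice_pt z p) + 6 * (u / lattice_pt z p)\<^sup>2 + 10 * (u / lattice_pt z p) ^ 3)
        - 1 / (1 - u / lattice_pt z p) ^ 3)"
      proof (cases "p = (0, 0)")
        case True then show ?thesis by (simp add: lattice_pt_def)
      next
        case False
        define w v where "w = lattice_pt z p" and "v = 1 / (1 - u / w) ^ 3"
        have w: "w \<noteq> 0" "u - w = - w * (1 - u / w)" using ne[OF r(1,3,4) False] by (auto simp: w_def)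
        have "1 / (u - w) ^ 3 = - 1 / w ^ 3 * v" unfolding w(2) v_def by (simp add: power_mult_distrib)
        moreover have "- 1 / w ^ 3 * v - (- 1) * (1 / w ^ 3) - (- 3 * u) * (1 / w ^ 4) - (- 6 * u\<^sup>2) * (1 / w ^ 5) - (- 10 * u ^ 3) * (1 / w ^ 6)
          = 1 / w ^ 3 * ((1 + 3 * (u / w) + 6 * (u / w)\<^sup>2 + 10 * (u / w) ^ 3) - v)"
          using w(1) by (simp add: field_simps eval_nat_numeral)
        ultimately show ?thesis using False by (simp add: w_def[symmetric] v_def[symmetric])
      qed
    qed (simp add: odd mult_ac)
  qed simp_all
  have CD: "((\<lambda>u. pole_sum k z u - 1 / u ^ k) \<longlongrightarrow> eis_sum k z) (at 0)" if k: "k \<ge> 3" "even k" for k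
  proof -
    have "((\<lambda>u. (pole_sum k z u - 1 / u ^ k - eis_sum k z) / u ^ 0) \<longlongrightarrow> 0) (at 0)"
    proof (rule small_sum_tendsto[OF sum, where h = "\<lambda>t. 1 / (1 - t) ^ k - 1" and j = k and K = "(\<Sum>i<k. (3/2) ^ i) * 2 ^ k"])
      fix t :: complex assume t: "norm t \<le> 1 / 2"
      have "norm (1 - t) \<le> 3 / 2" using norm_triangle_ineq4[of 1 t] t by simp
      then have "norm (\<Sum>i<k. (1 - t) ^ i) \<le> (\<Sum>i<k. (3/2) ^ i)"
        by (intro sum_norm_le) (simp add: norm_power power_mono)
      moreover have "1 / (1 - t) ^ k - 1 = t ^ Suc 0 * (\<Sum>i<k. (1 - t) ^ i) / (1 - t) ^ k"
      proof -
        have "1 - t \<noteq> 0" using t by auto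
        moreover have "1 - (1 - t) ^ k = t * (\<Sum>i<k. (1 - t) ^ i)" using one_diff_power_eq[of "1 - t" k] by simp
        ultimately show ?thesis by (simp add: divide_simps)
      qed
      ultimately show "norm (1 / (1 - t) ^ k - 1) \<le> (\<Sum>i<k. (3/2) ^ i) * 2 ^ k * norm t ^ Suc 0"
        by (rule quotient_power_bound[OF t])
    next
      fix u :: complex and r :: real
      assume r: "r > 0" "u \<noteq> 0" "norm u \<le> r" "\<And>p. lattice_pt z p \<noteq> 0 \<Longrightarrow> norm (lattice_pt z p) \<ge> 2 * r"
      have "((\<lambda>p. 1 / (u - lattice_pt z p) ^ k - (if p = (0, 0) then 1 / u ^ k else 0) - 1 * (1 / lattice_pt z p ^ k)) has_sum
         pole_sum k z u - 1 / u ^ k - 1 * eis_sum k z) UNIV"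
        using k by (intro has_sum_diff' pole_sum_has_sum z has_sum_delta E) auto
      then show "((\<lambda>p. 1 / lattice_pt z p ^ k * (1 / (1 - u / lattice_pt z p) ^ k - 1)) has_sum
          (pole_sum k z u - 1 / u ^ k - eis_sum k z)) UNIV"
      proof (rule has_sum_eqI)
        fix p
        show "1 / (u - lattice_pt z p) ^ k - (if p = (0, 0) then 1 / u ^ k else 0) - 1 * (1 / lattice_pt z p ^ k) =
          1 / lattice_pt z p ^ k * (1 / (1 - u / lattice_pt z p) ^ k - 1)"
        proof (cases "p = (0, 0)")
          case True then show ?thesis using k by (simp add: lattice_pt_def)
        next
          case False
          define w where "w = lattice_pt z p"
          have w: "w \<noteq> 0" "u - w = - w * (1 - u / w)" using ne[OF r(1,3,4) False] by (auto simp: w_def)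
          have "1 / (u - w) ^ k = 1 / w ^ k * (1 / (1 - u / w) ^ k)"
            unfolding w(2) using k(2) by (simp add: power_mult_distrib)
          then show ?thesis using False by (simp add: w_def[symmetric] algebra_simps)
        qed
      qed (simp)
    qed (use k in simp_all)
    then have "((\<lambda>u. pole_sum k z u - 1 / u ^ k - eis_sum k z) \<longlongrightarrow> 0) (at 0)" by simp
    then show ?thesis by (rule LIM_zero_cancel)
  qed
  show ?C ?D using CD[of 4] CD[of 6] by auto
qed

text \<open>Up to the factors -1/2, 1/6 and 1/120, \<open>pole_sum 3\<close>,
  \<open>pole_sum 4\<close> and \<open>pole_sum 6\<close> are the first, second and fourth
  derivatives of \<open>wp\<close>, so these are the Weierstrass equation and its consequences. In
  each of them the poles at 0 cancel and the difference of the two sides tends to 0 there; being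
  doubly periodic, it vanishes identically.\<close>

lemma wp_differential_equations:
  assumes z: "Im z > 0" and u: "u \<notin> lattice z"
  shows pole_sum4_eq: "pole_sum 4 z u = wp z u ^ 2 - 5 * eis_sum 4 z"
    and pole_sum6_eq: "pole_sum 6 z u = wp z u ^ 3 - 9 * eis_sum 4 z * wp z u - 14 * eis_sum 6 z"
    and pole_sum3_sq: "pole_sum 3 z u ^ 2 = wp z u ^ 3 - 15 * eis_sum 4 z * wp z u - 35 * eis_sum 6 z"
proof -
  define G H where "G = eis_sum 4 z" and "H = eis_sum 6 z"
  define e where "e = (\<lambda>u. (wp z u - 1 / u\<^sup>2 - 3 * G * u\<^sup>2 - 5 * H * u ^ 4) / u ^ 4)"
  define c where "c = (\<lambda>u. (pole_sum 3 z u - 1 / u ^ 3 + 3 * G * u + 10 * H * u ^ 3) / u ^ 3)"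
  define a where "a = (\<lambda>u. pole_sum 4 z u - 1 / u ^ 4)"
  define b where "b = (\<lambda>u. pole_sum 6 z u - 1 / u ^ 6)"
  have lims: "(e \<longlongrightarrow> 0) (at 0)" "(c \<longlongrightarrow> 0) (at 0)" "(a \<longlongrightarrow> G) (at 0)" "(b \<longlongrightarrow> H) (at 0)"
    using expansion_at_0[OF z] by (simp_all add: e_def c_def a_def b_def G_def H_def)
  \<comment> \<open>\<open>D\<close> is the regular part of \<open>wp\<close>, \<open>R\<close> that
    of \<open>pole_sum 3\<close>, and \<open>D2\<close> is \<open>D\<close> divided by u^2. Products
    of a pole with a regular part get equations of their own, so that all powers of 1 / u cancel
    before a limit is taken.\<close>
  define D where "D = (\<lambda>u. 3 * G * u\<^sup>2 + 5 * H * u ^ 4 + u ^ 4 * e u)"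
  define D2 where "D2 = (\<lambda>u. 3 * G + 5 * H * u\<^sup>2 + u\<^sup>2 * e u)"
  define R where "R = (\<lambda>u. u ^ 3 * c u - 3 * G * u - 10 * H * u ^ 3)"
  have limD: "(D \<longlongrightarrow> 0) (at 0)" "(D2 \<longlongrightarrow> 3 * G) (at 0)" "(R \<longlongrightarrow> 0) (at 0)"
    unfolding D_def D2_def R_def by (rule tendsto_eq_intros lims refl | simp)+
  have W: "wp z u = (1 / u)\<^sup>2 + D u" "(1 / u)\<^sup>2 * D u = D2 u"
    "(1 / u) ^ 4 * D u = 3 * G * (1 / u)\<^sup>2 + 5 * H + e u" if "u \<noteq> 0" for u
  proof -
    show "wp z u = (1 / u)\<^sup>2 + D u" using that by (simp add: e_def D_def field_simps)
    show "(1 / u)\<^sup>2 * D u = D2 u" "(1 / u) ^ 4 * D u = 3 * G * (1 / u)\<^sup>2 + 5 * H + e u"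
      using that by (simp_all add: D_def D2_def field_simps power2_eq_square power4_eq_xxxx)
  qed
  have P3: "pole_sum 3 z u = (1 / u) ^ 3 + R u" "(1 / u) ^ 3 * R u = c u - 3 * G * (1 / u)\<^sup>2 - 10 * H" if "u \<noteq> 0" for u
  proof -
    show "pole_sum 3 z u = (1 / u) ^ 3 + R u" using that by (simp add: c_def R_def field_simps)
    show "(1 / u) ^ 3 * R u = c u - 3 * G * (1 / u)\<^sup>2 - 10 * H"
      using that by (simp add: R_def field_simps power2_eq_square power3_eq_cube)
  qed
  have cube: "(x\<^sup>2 + d) ^ 3 = x ^ 6 + 3 * (x ^ 4 * d) + 3 * ((x\<^sup>2 * d) * d) + d ^ 3"
    and square: "(x\<^sup>2 + d)\<^sup>2 = x ^ 4 + 2 * (x\<^sup>2 * d) + d\<^sup>2"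
    and square': "(x ^ 3 + d)\<^sup>2 = x ^ 6 + 2 * (x ^ 3 * d) + d\<^sup>2" for x d :: complex
    by (simp_all add: eval_nat_numeral algebra_simps)
  have P4: "pole_sum 4 z u = a u + (1 / u) ^ 4" and P6: "pole_sum 6 z u = b u + (1 / u) ^ 6" for u
    by (simp_all add: a_def b_def power_one_over)
  have main: "f u = 0"
    if f: "f holomorphic_on - lattice z" "\<And>u q. f (u + lattice_pt z q) = f u" "(f \<longlongrightarrow> 0) (at 0)" for f
  proof -
    obtain d where d: "d > 0" "\<And>p. p \<noteq> (0, 0) \<Longrightarrow> norm (lattice_pt z p) \<ge> d"
      "\<And>x y. x \<in> lattice z \<Longrightarrow> y \<in> lattice z \<Longrightarrow> dist y x < d \<Longrightarrow> y = x"
      by (rule lattice_separated[OF z]) (rule that)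
    have l0: "0 \<in> lattice z" by (auto simp: lattice_def lattice_pt_def intro!: image_eqI[of _ _ "(0, 0)"])
    show ?thesis
    proof (rule doubly_periodic_const[OF z d(1,3) f(1) _ f(2) lattice_periodic l0 f(3) u])
      fix s assume "s \<in> lattice z"
      then obtain q where "s = lattice_pt z q" by (auto simp: lattice_def)
      then show "\<exists>l. (f \<longlongrightarrow> l) (at s)" using periodic_tendsto[OF f(3)] f(2) by blast
    qed
  qed
  have hol: "wp z holomorphic_on - lattice z" "\<And>k. k \<ge> 3 \<Longrightarrow> pole_sum k z holomorphic_on - lattice z"
    using wp_holomorphic[OF z] pole_sum_holomorphic[OF z] by auto
  have "pole_sum 4 z u - wp z u ^ 2 + 5 * G = 0"
  proof (rule main)
    show "(\<lambda>u. pole_sum 4 z u - wp z u ^ 2 + 5 * G) holomorphic_on - lattice z"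
      by (intro holomorphic_intros hol) auto
    have "((\<lambda>u. a u - 2 * D2 u - (D u)\<^sup>2 + 5 * G) \<longlongrightarrow> 0) (at 0)"
      by (rule tendsto_eq_intros lims limD refl | simp)+
    moreover have "eventually (\<lambda>u. a u - 2 * D2 u - (D u)\<^sup>2 + 5 * G = pole_sum 4 z u - wp z u ^ 2 + 5 * G) (at 0)"
      unfolding eventually_at_filter
    proof (intro always_eventually allI impI)
      fix u :: complex assume "u \<noteq> 0"
      note W = W[OF this] and P3 = P3[OF this]
      show "a u - 2 * D2 u - (D u)\<^sup>2 + 5 * G = pole_sum 4 z u - wp z u ^ 2 + 5 * G"
        unfolding P4 W(1) square W(2) by (simp add: algebra_simps)
    qed
    ultimately show "((\<lambda>u. pole_sum 4 z u - wp z u ^ 2 + 5 * G) \<longlongrightarrow> 0) (at 0)"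
      by (rule Lim_transform_eventually)
  qed (simp add: pole_sum_periodic wp_periodic z)
  then show "pole_sum 4 z u = wp z u ^ 2 - 5 * eis_sum 4 z" by (simp add: G_def algebra_simps)
  have "pole_sum 6 z u - wp z u ^ 3 + 9 * G * wp z u + 14 * H = 0"
  proof (rule main)
    show "(\<lambda>u. pole_sum 6 z u - wp z u ^ 3 + 9 * G * wp z u + 14 * H) holomorphic_on - lattice z"
      by (intro holomorphic_intros hol) auto
    have "((\<lambda>u. b u - 3 * (5 * H + e u) - 3 * (D2 u * D u) - D u ^ 3 + 9 * G * D u + 14 * H) \<longlongrightarrow> 0) (at 0)"
      by (rule tendsto_eq_intros lims limD refl | simp)+
    moreover have "eventually (\<lambda>u. b u - 3 * (5 * H + e u) - 3 * (D2 u * D u) - D u ^ 3 + 9 * G * D u + 14 * H = pole_sum 6 z u - wp z u ^ 3 + 9 * G * wp z u + 14 * H) (at 0)"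
      unfolding eventually_at_filter
    proof (intro always_eventually allI impI)
      fix u :: complex assume "u \<noteq> 0"
      note W = W[OF this] and P3 = P3[OF this]
      show "b u - 3 * (5 * H + e u) - 3 * (D2 u * D u) - D u ^ 3 + 9 * G * D u + 14 * H = pole_sum 6 z u - wp z u ^ 3 + 9 * G * wp z u + 14 * H"
        unfolding P6 W(1) cube W(2) W(3) by (simp add: algebra_simps)
    qed
    ultimately show "((\<lambda>u. pole_sum 6 z u - wp z u ^ 3 + 9 * G * wp z u + 14 * H) \<longlongrightarrow> 0) (at 0)"
      by (rule Lim_transform_eventually)
  qed (simp add: pole_sum_periodic wp_periodic z)
  then show "pole_sum 6 z u = wp z u ^ 3 - 9 * eis_sum 4 z * wp z u - 14 * eis_sum 6 z"
    by (simp add: G_def H_def algebra_simps)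
  have "pole_sum 3 z u ^ 2 - wp z u ^ 3 + 15 * G * wp z u + 35 * H = 0"
  proof (rule main)
    show "(\<lambda>u. pole_sum 3 z u ^ 2 - wp z u ^ 3 + 15 * G * wp z u + 35 * H) holomorphic_on - lattice z"
      by (intro holomorphic_intros hol) auto
    have "((\<lambda>u. 2 * (c u - 10 * H) + (R u)\<^sup>2 - 3 * (5 * H + e u) - 3 * (D2 u * D u) - D u ^ 3 + 15 * G * D u + 35 * H) \<longlongrightarrow> 0) (at 0)"
      by (rule tendsto_eq_intros lims limD refl | simp)+
    moreover have "eventually (\<lambda>u. 2 * (c u - 10 * H) + (R u)\<^sup>2 - 3 * (5 * H + e u) - 3 * (D2 u * D u) - D u ^ 3 + 15 * G * D u + 35 * H = pole_sum 3 z u ^ 2 - wp z u ^ 3 + 15 * G * wp z u + 35 * H) (at 0)"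
      unfolding eventually_at_filter
    proof (intro always_eventually allI impI)
      fix u :: complex assume "u \<noteq> 0"
      note W = W[OF this] and P3 = P3[OF this]
      show "2 * (c u - 10 * H) + (R u)\<^sup>2 - 3 * (5 * H + e u) - 3 * (D2 u * D u) - D u ^ 3 + 15 * G * D u + 35 * H = pole_sum 3 z u ^ 2 - wp z u ^ 3 + 15 * G * wp z u + 35 * H"
        unfolding P3(1) W(1) cube square' W(2) W(3) P3(2) by (simp add: algebra_simps)
    qed
    ultimately show "((\<lambda>u. pole_sum 3 z u ^ 2 - wp z u ^ 3 + 15 * G * wp z u + 35 * H) \<longlongrightarrow> 0) (at 0)"
      by (rule Lim_transform_eventually)
  qed (simp add: pole_sum_periodic wp_periodic z)
  then show "pole_sum 3 z u ^ 2 = wp z u ^ 3 - 15 * eis_sum 4 z * wp z u - 35 * eis_sum 6 z"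
    by (simp add: G_def H_def algebra_simps)
qed

section \<open>Values at the half-periods\<close>

lemma pole_sum3_half_period:
  assumes "2 * w = lattice_pt z q" shows "pole_sum 3 z w = 0"
proof -
  have "pole_sum 3 z w = pole_sum 3 z (- w + lattice_pt z q)" by (simp add: assms[symmetric])
  also have "\<dots> = pole_sum 3 z (- w)" by (rule pole_sum_periodic)
  also have "\<dots> = - pole_sum 3 z w" by (simp add: pole_sum_uminus)
  finally show ?thesis by simp
qed

text \<open>The linear coefficient is -2 times \<open>pole_sum 3 z w\<close>, which vanishes at a
  half-period. The resulting double zero of \<open>wp z (u + w) - wp z w\<close> will absorb the
  double pole of \<open>wp z u\<close>.\<close>

lemma wp_at_half_period:
  assumes z: "Im z > 0" and w: "2 * w = lattice_pt z q" "w \<notin> lattice z"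
  shows "((\<lambda>u. (wp z (u + w) - wp z w) / u\<^sup>2) \<longlongrightarrow> 3 * pole_sum 4 z w) (at 0)"
proof -
  define l where "l = (\<lambda>p. lattice_pt z p - w)"
  have l0: "l p \<noteq> 0" for p using w(2) by (auto simp: l_def lattice_def)
  have "((\<lambda>u. (wp z (u + w) - wp z w - 3 * u\<^sup>2 * pole_sum 4 z w) / u\<^sup>2) \<longlongrightarrow> 0) (at 0)"
  proof (rule small_sum_tendsto[where l = l and h = "\<lambda>t. 1 / (1 - t)\<^sup>2 - (1 + 2 * t + 3 * t\<^sup>2)" and j = 2 and K = "6 * 2 ^ 2"])
    show "(\<lambda>p. 1 / norm (l p) ^ 3) summable_on UNIV"
      unfolding l_def by (rule lattice_inverse_cube_summable[OF z])
    fix t :: complex assume t: "norm t \<le> 1 / 2"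
    have "norm (4 - 3 * t) \<le> norm (4::complex) + norm (3 * t)" by (rule norm_triangle_ineq4)
    then have "norm (4 - 3 * t) \<le> 6" using t by (simp add: norm_mult)
    moreover have "1 / (1 - t)\<^sup>2 - (1 + 2 * t + 3 * t\<^sup>2) = t ^ Suc 2 * (4 - 3 * t) / (1 - t)\<^sup>2"
    proof -
      have "1 - t \<noteq> 0" using t by auto
      then show ?thesis by (simp add: divide_simps) (simp add: algebra_simps eval_nat_numeral)
    qed
    ultimately show "norm (1 / (1 - t)\<^sup>2 - (1 + 2 * t + 3 * t\<^sup>2)) \<le> 6 * 2 ^ 2 * norm t ^ Suc 2"
      by (rule quotient_power_bound[OF t])
  next
    fix u :: complex and r :: real
    assume r: "r > 0" "u \<noteq> 0" "norm u \<le> r" "\<And>p. l p \<noteq> 0 \<Longrightarrow> norm (l p) \<ge> 2 * r"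
    have "((\<lambda>p. (1 / (u + w - lattice_pt z p)\<^sup>2 - 1 / lattice_pt z p ^ 2) - (1 / (w - lattice_pt z p)\<^sup>2 - 1 / lattice_pt z p ^ 2)
        - (- 2 * u) * (1 / (w - lattice_pt z p) ^ 3) - 3 * u\<^sup>2 * (1 / (w - lattice_pt z p) ^ 4)) has_sum
       wp z (u + w) - wp z w - (- 2 * u) * pole_sum 3 z w - 3 * u\<^sup>2 * pole_sum 4 z w) UNIV"
      by (intro has_sum_diff' has_sum_cmult_right wp_has_sum pole_sum_has_sum z) auto
    then show "((\<lambda>p. 1 / l p ^ 2 * (1 / (1 - u / l p)\<^sup>2 - (1 + 2 * (u / l p) + 3 * (u / l p)\<^sup>2))) has_sum
       (wp z (u + w) - wp z w - 3 * u\<^sup>2 * pole_sum 4 z w)) UNIV"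
    proof (rule has_sum_eqI)
      fix p
      define m v where "m = l p" and "v = 1 / (1 - u / m)\<^sup>2"
      have m: "m \<noteq> 0" using l0 by (simp add: m_def)
      have L: "lattice_pt z p = m + w" by (simp add: m_def l_def)
      have "- m * (1 - u / m) = u - m" using m by (simp add: field_simps)
      then have "u + w - lattice_pt z p = - m * (1 - u / m)" by (simp add: L)
      then have 1: "1 / (u + w - lattice_pt z p)\<^sup>2 = 1 / m\<^sup>2 * v" by (simp add: v_def power_mult_distrib)
      have 2: "w - lattice_pt z p = - m" by (simp add: m_def l_def)
      have g: "a - y - (b - y) - c - d = a - b - c - d" for a b c d y :: complex by simp
      show "1 / (u + w - lattice_pt z p)\<^sup>2 - 1 / lattice_pt z p ^ 2 - (1 / (w - lattice_pt z p)\<^sup>2 - 1 / lattice_pt z p ^ 2)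
        - (- 2 * u) * (1 / (w - lattice_pt z p) ^ 3) - 3 * u\<^sup>2 * (1 / (w - lattice_pt z p) ^ 4) =
        1 / l p ^ 2 * (1 / (1 - u / l p)\<^sup>2 - (1 + 2 * (u / l p) + 3 * (u / l p)\<^sup>2))"
        unfolding 1 2 g unfolding m_def[symmetric] v_def[symmetric] using m by (simp add: field_simps eval_nat_numeral)
    qed (simp add: pole_sum3_half_period[OF w(1)])
  qed simp_all
  then have "((\<lambda>u. (wp z (u + w) - wp z w - 3 * u\<^sup>2 * pole_sum 4 z w) / u\<^sup>2 + 3 * pole_sum 4 z w) \<longlongrightarrow> 0 + 3 * pole_sum 4 z w) (at 0)"
    by (intro tendsto_intros)
  moreover have "eventually (\<lambda>u. (wp z (u + w) - wp z w - 3 * u\<^sup>2 * pole_sum 4 z w) / u\<^sup>2 + 3 * pole_sum 4 z w =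
     (wp z (u + w) - wp z w) / u\<^sup>2) (at 0)"
    unfolding eventually_at_filter by (intro always_eventually allI impI) (simp add: field_simps)
  ultimately show ?thesis by (simp add: Lim_transform_eventually)
qed

lemma wp_blowup:
  assumes z: "Im z > 0" shows "((\<lambda>u. u\<^sup>2 * (wp z u - e)) \<longlongrightarrow> 1) (at 0)"
proof -
  define E where "E = (\<lambda>u. (wp z u - 1 / u\<^sup>2 - 3 * eis_sum 4 z * u\<^sup>2 - 5 * eis_sum 6 z * u ^ 4) / u ^ 4)"
  have E: "(E \<longlongrightarrow> 0) (at 0)" unfolding E_def by (rule wp_at_0[OF z])
  have "((\<lambda>u. 1 + u\<^sup>2 * (3 * eis_sum 4 z * u\<^sup>2 + 5 * eis_sum 6 z * u ^ 4 + u ^ 4 * E u - e)) \<longlongrightarrow> 1) (at 0)"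
    by (rule tendsto_eq_intros E refl | simp)+
  moreover have "eventually (\<lambda>u. 1 + u\<^sup>2 * (3 * eis_sum 4 z * u\<^sup>2 + 5 * eis_sum 6 z * u ^ 4 + u ^ 4 * E u - e) = u\<^sup>2 * (wp z u - e)) (at 0)"
    unfolding eventually_at_filter E_def by (intro always_eventually allI impI) (simp add: field_simps eval_nat_numeral)
  ultimately show ?thesis by (rule Lim_transform_eventually)
qed

text \<open>In \<open>K\<close> the double pole of one factor at 0 meets the double zero of the
  other, and likewise at -w; so \<open>K\<close> is doubly periodic with removable singularities,
  hence constant. A point \<open>w'\<close> with the same value \<open>e\<close> makes that constant
  0. Then \<open>wp z\<close> equals \<open>e\<close> near \<open>w\<close>, and by continuation
  everywhere, against its pole.\<close>

lemma wp_half_periods_distinct: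
  assumes z: "Im z > 0" and w: "2 * w = lattice_pt z q" "w \<notin> lattice z"
    and w': "w' \<notin> lattice z" "w' + w \<notin> lattice z"
  shows "wp z w \<noteq> wp z w'"
proof
  assume eq: "wp z w = wp z w'"
  define e where "e = wp z w"
  define K where "K = (\<lambda>u. (wp z (u + w) - e) * (wp z u - e))"
  define S where "S = lattice z \<union> {u. u + w \<in> lattice z}"
  have w_neg: "u - w \<in> lattice z \<longleftrightarrow> u + w \<in> lattice z" "wp z (u - w) = wp z (u + w)" for u
  proof -
    have e: "u - w + lattice_pt z q = u + w" by (simp add: w(1)[symmetric])
    show "u - w \<in> lattice z \<longleftrightarrow> u + w \<in> lattice z" "wp z (u - w) = wp z (u + w)"
      using lattice_periodic[of "u - w" z q] wp_periodic[OF z, of "u - w" q] unfolding e by metis+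
  qed
  obtain d where d: "d > 0" "\<And>p. p \<noteq> (0, 0) \<Longrightarrow> norm (lattice_pt z p) \<ge> d"
    "\<And>x y. x \<in> lattice z \<Longrightarrow> y \<in> lattice z \<Longrightarrow> dist y x < d \<Longrightarrow> y = x"
    by (rule lattice_separated[OF z]) (rule that)
  have l0: "0 \<in> lattice z" by (auto simp: lattice_def lattice_pt_def intro!: image_eqI[of _ _ "(0, 0)"])
  \<comment> \<open>Doubling maps \<open>S\<close> into the lattice, so the points of
    \<open>S\<close> have at least half of the spacing of the lattice.\<close>
  have S2: "2 * x \<in> lattice z" if "x \<in> S" for x
  proof -
    have dbl: "y + y \<in> lattice z" if "y \<in> lattice z" for y
    proof -
      from that obtain p where "y = lattice_pt z p" unfolding lattice_def by blast
      then show ?thesis using lattice_periodic[of y z p] that by simp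
    qed
    from \<open>x \<in> S\<close> consider "x \<in> lattice z" | "x + w \<in> lattice z" by (auto simp: S_def)
    then show ?thesis
    proof cases
      case 1 then show ?thesis using dbl[of x] by (simp flip: mult_2)
    next
      case 2
      moreover have "2 * x + lattice_pt z q = (x + w) + (x + w)" by (simp add: w(1)[symmetric])
      ultimately have "2 * x + lattice_pt z q \<in> lattice z" using dbl[of "x + w"] by simp
      then show ?thesis by (simp add: lattice_periodic)
    qed
  qed
  have sep: "y = x" if "x \<in> S" "y \<in> S" "dist y x < d / 2" for x y
  proof -
    have "dist (2 * y) (2 * x) = norm (2 * (y - x))" by (simp add: dist_norm algebra_simps)
    also have "\<dots> < d" using that(3) by (simp only: dist_norm norm_mult) simp
    finally have "dist (2 * y) (2 * x) < d" .
    then show ?thesis using d(3)[OF S2 S2, of x y] that by simp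
  qed
  have K0: "(K \<longlongrightarrow> 3 * pole_sum 4 z w) (at 0)"
  proof -
    have "((\<lambda>u. (wp z (u + w) - wp z w) / u\<^sup>2 * (u\<^sup>2 * (wp z u - e))) \<longlongrightarrow> 3 * pole_sum 4 z w * 1) (at 0)"
      by (intro tendsto_mult wp_at_half_period[OF z w] wp_blowup[OF z])
    moreover have "eventually (\<lambda>u. (wp z (u + w) - wp z w) / u\<^sup>2 * (u\<^sup>2 * (wp z u - e)) = K u) (at 0)"
      unfolding eventually_at_filter by (intro always_eventually allI impI) (simp add: K_def e_def)
    ultimately show ?thesis by (simp add: Lim_transform_eventually)
  qed
  have Kper: "K (u + lattice_pt z p) = K u" for u p
    using wp_periodic[OF z, of "u + w" p] wp_periodic[OF z, of u p] by (simp add: K_def algebra_simps)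
  \<comment> \<open>As 2 w is a period, translation by \<open>w\<close> exchanges the two factors;
    the limit at 0 therefore gives the limits at all points of \<open>S\<close>.\<close>
  have Kw: "K (u + w) = K u" for u
  proof -
    have "u + w + w = u + lattice_pt z q" by (simp add: w(1)[symmetric])
    then have "wp z (u + w + w) = wp z u" using wp_periodic[OF z, of u q] by metis
    then show ?thesis unfolding K_def by (simp only: mult.commute)
  qed
  have hol: "wp z holomorphic_on - lattice z" by (rule wp_holomorphic[OF z])
  have hol': "(\<lambda>u. wp z (u + w)) holomorphic_on - S"
  proof -
    have "(wp z \<circ> (\<lambda>u. u + w)) holomorphic_on - S"
      by (rule holomorphic_on_compose_gen[OF _ hol]) (auto simp: S_def intro!: holomorphic_intros)
    then show ?thesis by (simp add: o_def)
  qed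
  have "K u = 3 * pole_sum 4 z w" if u: "u \<notin> S" for u
  proof (rule doubly_periodic_const[where e = "d / 2", OF z _ sep _ _ Kper _ _ K0 u])
    show "K holomorphic_on - S"
      unfolding K_def by (intro holomorphic_intros hol' holomorphic_on_subset[OF hol]) (auto simp: S_def)
    show "u + lattice_pt z q \<in> S \<longleftrightarrow> u \<in> S" for u q
      using lattice_periodic[of u z q] lattice_periodic[of "u + w" z q] by (simp add: S_def algebra_simps)
    show "0 \<in> S" using l0 by (simp add: S_def)
    fix s assume "s \<in> S"
    then consider p where "s = lattice_pt z p" | p where "s + w = lattice_pt z p" by (auto simp: S_def lattice_def)
    then have "K (u + s) = K u" for u
    proof cases
      case 1 then show ?thesis by (simp add: Kper)
    next
      case 2
      have "K (u + s) = K (u + s + w)" by (simp add: Kw)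
      also have "\<dots> = K (u + lattice_pt z p)" by (simp add: 2[symmetric] add.assoc)
      finally show ?thesis by (simp add: Kper)
    qed
    then show "\<exists>l. (K \<longlongrightarrow> l) (at s)" using periodic_tendsto[OF K0] by blast
  qed (use d in auto)
  moreover have "w' \<notin> S" using w' by (simp add: S_def)
  moreover have "K w' = 0" using eq by (simp add: K_def e_def)
  ultimately have Kz: "K u = 0" if "u \<notin> S" for u using that by metis
  \<comment> \<open>Near 0 the pole keeps \<open>wp z u - e\<close> away from 0, so that
    \<open>K\<close> can vanish there only through its other factor.\<close>
  have "eventually (\<lambda>u. u\<^sup>2 * (wp z u - e) \<noteq> 0) (at 0)"
    using tendsto_imp_eventually_ne[OF wp_blowup[OF z, of e], of 0] by simp
  moreover have "closed (S - {0})" by (rule discrete_imp_closed[of "d / 2"]) (use sep d in auto)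
  then have "eventually (\<lambda>u. u \<in> - (S - {0})) (nhds 0)"
    by (intro eventually_nhds_in_open open_Compl) auto
  then have "eventually (\<lambda>u. u \<notin> S) (at 0)" unfolding eventually_at_filter by eventually_elim auto
  ultimately have "eventually (\<lambda>u. wp z (u + w) = e) (at 0)"
  proof eventually_elim
    case (elim u)
    then show ?case using Kz[of u] by (auto simp: K_def)
  qed
  then have "eventually (\<lambda>u. wp z (u + w) = e) (nhds 0)"
    unfolding eventually_at_filter by eventually_elim (auto simp: e_def)
  then obtain V where V: "open V" "0 \<in> V" "\<And>u. u \<in> V \<Longrightarrow> wp z (u + w) = e" by (auto simp: eventually_nhds)
  define V' where "V' = (\<lambda>u. w + u) ` V \<inter> - lattice z"
  have "open V'" unfolding V'_def using V(1) closed_lattice[OF z] by (intro open_Int open_translation open_Compl)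
  moreover have "w \<in> V'" using V(2) w(2) by (auto simp: V'_def intro!: image_eqI[of _ _ 0])
  moreover have "wp z x = e" if "x \<in> V'" for x using that V(3) by (auto simp: V'_def add.commute)
  moreover have "connected (- lattice z)"
  proof -
    have "connected (UNIV - lattice z)"
      by (rule connected_open_diff_countable) (auto simp: lattice_def)
    then show ?thesis by (simp add: Compl_eq_Diff_UNIV)
  qed
  ultimately have c: "wp z x = e" if "x \<notin> lattice z" for x
    using that analytic_continuation_open[of V' "- lattice z" "wp z" "\<lambda>_. e" x] hol closed_lattice[OF z]
    by (auto simp: V'_def open_Compl)
  have "eventually (\<lambda>u. u \<notin> S) (at 0)" by fact
  then have "eventually (\<lambda>u. u\<^sup>2 * (wp z u - e) = 0) (at 0)"
    by eventually_elim (auto simp: S_def c)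
  then have "((\<lambda>u. u\<^sup>2 * (wp z u - e)) \<longlongrightarrow> 0) (at 0)" by (rule tendsto_eventually)
  then show False using wp_blowup[OF z, of e] tendsto_unique[of "at (0::complex)"] by fastforce
qed

subsection \<open>Lattices containing a given one with index two\<close>

text \<open>The larger lattice is the union of the given one and its translate by -w. The injections
  \<open>j0\<close> and \<open>j1\<close> split the index set accordingly, and evenness of k turns
  (l - w)^k into (w - l)^k.\<close>

lemma superlattice_sum:
  assumes z: "Im z > 0" and k: "k \<ge> 3" "even k"
    and j: "inj j0" "inj j1" "range j0 \<inter> range j1 = {}" "range j0 \<union> range j1 = UNIV"
    and L: "\<And>p. L (j0 p) = lattice_pt z p" "\<And>p. L (j1 p) = lattice_pt z p - w"
  shows "(\<Sum>\<^sub>\<infinity>p. 1 / L p ^ k) = eis_sum k z + pole_sum k z w"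
proof -
  have "((\<lambda>p. 1 / L p ^ k) has_sum eis_sum k z) (range j0)"
    using has_sum_reindex[OF j(1), of "\<lambda>p. 1 / L p ^ k"] eis_has_sum[OF z k(1)] by (simp add: o_def L)
  moreover have "((\<lambda>p. 1 / L p ^ k) has_sum pole_sum k z w) (range j1)"
  proof -
    have "(lattice_pt z p - w) ^ k = (w - lattice_pt z p) ^ k" for p
      using k(2) by (metis minus_diff_eq power_minus_even)
    then show ?thesis
      using has_sum_reindex[OF j(2), of "\<lambda>p. 1 / L p ^ k"] pole_sum_has_sum[OF z k(1), of w] by (simp add: o_def L)
  qed
  ultimately have "((\<lambda>p. 1 / L p ^ k) has_sum (eis_sum k z + pole_sum k z w)) (range j0 \<union> range j1)"
    using j(3) by (rule has_sum_Un_disjoint)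
  then show ?thesis using j(4) by (intro infsumI) simp
qed

text \<open>The three lattices adjoin the half-periods 1/2, z/2 and (z + 1)/2. Adjoining 1/2 yields
  one half of the lattice of 2 z, whence the factor 2^k.\<close>

lemma eis_sum_superlattices:
  assumes z: "Im z > 0" and k: "k \<ge> 3" "even k"
  shows "2 ^ k * eis_sum k (2 * z) = eis_sum k z + pole_sum k z (1 / 2)"
    and "eis_sum k (z / 2) = eis_sum k z + pole_sum k z (z / 2)"
    and "eis_sum k ((z + 1) / 2) = eis_sum k z + pole_sum k z ((z + 1) / 2)"
proof -
  have par: "\<exists>n. b = 2 * n \<or> b = 2 * n - 1" for b :: int by presburger
  have "2 ^ k * eis_sum k (2 * z) = (\<Sum>\<^sub>\<infinity>p. 2 ^ k * (1 / lattice_pt (2 * z) p ^ k))"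
    unfolding eis_sum_def by (rule infsum_cmult_right'[symmetric])
  also have "\<dots> = (\<Sum>\<^sub>\<infinity>p. 1 / (lattice_pt (2 * z) p / 2) ^ k)" by (simp add: power_divide)
  also have "\<dots> = eis_sum k z + pole_sum k z (1 / 2)"
  proof (rule superlattice_sum[OF z k, where ?j0.0 = "\<lambda>p. (2 * fst p, snd p)" and ?j1.0 = "\<lambda>p. (2 * fst p - 1, snd p)"])
    show "range (\<lambda>p::int \<times> int. (2 * fst p, snd p)) \<inter> range (\<lambda>p. (2 * fst p - 1, snd p)) = {}"
      by auto presburger
    have "(a, b) \<in> range (\<lambda>p::int \<times> int. (2 * fst p, snd p)) \<union> range (\<lambda>p. (2 * fst p - 1, snd p))" for a b
      using par[of a] by (force simp: image_iff)
    then show "range (\<lambda>p::int \<times> int. (2 * fst p, snd p)) \<union> range (\<lambda>p. (2 * fst p - 1, snd p)) = UNIV"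
      by auto
  qed (auto simp: inj_def lattice_pt_def field_simps)
  finally show "2 ^ k * eis_sum k (2 * z) = eis_sum k z + pole_sum k z (1 / 2)" .
  show "eis_sum k (z / 2) = eis_sum k z + pole_sum k z (z / 2)"
    unfolding eis_sum_def[of _ "z / 2"]
  proof (rule superlattice_sum[OF z k, where ?j0.0 = "\<lambda>p. (fst p, 2 * snd p)" and ?j1.0 = "\<lambda>p. (fst p, 2 * snd p - 1)"])
    show "range (\<lambda>p::int \<times> int. (fst p, 2 * snd p)) \<inter> range (\<lambda>p. (fst p, 2 * snd p - 1)) = {}"
      by auto presburger
    have "(a, b) \<in> range (\<lambda>p::int \<times> int. (fst p, 2 * snd p)) \<union> range (\<lambda>p. (fst p, 2 * snd p - 1))" for a b
      using par[of b] by (force simp: image_iff)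
    then show "range (\<lambda>p::int \<times> int. (fst p, 2 * snd p)) \<union> range (\<lambda>p. (fst p, 2 * snd p - 1)) = UNIV"
      by auto
  qed (auto simp: inj_def lattice_pt_def field_simps)
  show "eis_sum k ((z + 1) / 2) = eis_sum k z + pole_sum k z ((z + 1) / 2)"
    unfolding eis_sum_def[of _ "(z + 1) / 2"]
  proof (rule superlattice_sum[OF z k, where ?j0.0 = "\<lambda>p. (fst p - snd p, 2 * snd p)" and ?j1.0 = "\<lambda>p. (fst p - snd p, 2 * snd p - 1)"])
    show "range (\<lambda>p::int \<times> int. (fst p - snd p, 2 * snd p)) \<inter> range (\<lambda>p. (fst p - snd p, 2 * snd p - 1)) = {}"
      by auto presburger
    have "(a, b) \<in> range (\<lambda>p::int \<times> int. (fst p - snd p, 2 * snd p)) \<union> range (\<lambda>p. (fst p - snd p, 2 * snd p - 1))" for a b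
    proof -
      obtain n where "b = 2 * n \<or> b = 2 * n - 1" using par by blast
      then show ?thesis by (auto simp: image_iff intro: exI[of _ "a + n"] exI[of _ n])
    qed
    then show "range (\<lambda>p::int \<times> int. (fst p - snd p, 2 * snd p)) \<union> range (\<lambda>p. (fst p - snd p, 2 * snd p - 1)) = UNIV"
      by auto
  qed (auto simp: inj_def lattice_pt_def field_simps)
qed

definition g2 :: "complex \<Rightarrow> complex" where "g2 z = 60 * eis_sum 4 z"
definition g3 :: "complex \<Rightarrow> complex" where "g3 z = 140 * eis_sum 6 z"

lemma half_notin_lattice:
  assumes z: "Im z > 0" and w: "2 * w = lattice_pt z q" and q: "odd (fst q) \<or> odd (snd q)"
  shows "w \<notin> lattice z"
proof
  assume "w \<in> lattice z"
  then obtain p where "w = lattice_pt z p" by (auto simp: lattice_def)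
  then have "lattice_pt z (p + p - q) = 0" using w by (simp add: lattice_pt_diff lattice_pt_add)
  then have "p + p - q = (0, 0)" using lattice_pt_eq_0_iff[OF z] by blast
  then have "fst q = 2 * fst p" "snd q = 2 * snd p" by (cases p; cases q; simp)+
  then show False using q by simp
qed

lemma half_periods:
  assumes z: "Im z > 0"
  shows "2 * (1 / 2) = lattice_pt z (1, 0)" "2 * (z / 2) = lattice_pt z (0, 1)" "2 * ((z + 1) / 2) = lattice_pt z (1, 1)"
    "1 / 2 \<notin> lattice z" "z / 2 \<notin> lattice z" "(z + 1) / 2 \<notin> lattice z"
proof -
  show *: "2 * (1 / 2) = lattice_pt z (1, 0)" "2 * (z / 2) = lattice_pt z (0, 1)" "2 * ((z + 1) / 2) = lattice_pt z (1, 1)"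
    by (simp_all add: lattice_pt_def add.commute)
  show "1 / 2 \<notin> lattice z" "z / 2 \<notin> lattice z" "(z + 1) / 2 \<notin> lattice z"
    using half_notin_lattice[OF z *(1)] half_notin_lattice[OF z *(2)] half_notin_lattice[OF z *(3)] by auto
qed

text \<open>At a half-period \<open>pole_sum 3\<close> vanishes, so \<open>e\<close> is a root of 4
  x^3 - g2 x - g3. In the last equation this cubic eliminates \<open>g3\<close>: the invariants of
  the larger lattice then involve only \<open>e\<close> and \<open>g2\<close>, which later allows
  one polynomial in the ratio g2 / e^2 to describe the operator.\<close>

lemma half_period_values:
  assumes z: "Im z > 0" and w: "2 * w = lattice_pt z q" "w \<notin> lattice z"
  defines "e \<equiv> wp z w"
  shows "4 * e ^ 3 = g2 z * e + g3 z"
    and "60 * (eis_sum 4 z + pole_sum 4 z w) = 60 * e\<^sup>2 - 4 * g2 z"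
    and "140 * (eis_sum 6 z + pole_sum 6 z w) = 88 * e ^ 3 - 8 * g2 z * e"
proof -
  have "0 = e ^ 3 - 15 * eis_sum 4 z * e - 35 * eis_sum 6 z"
    using pole_sum3_sq[OF z w(2)] pole_sum3_half_period[OF w(1)] by (simp add: e_def)
  then have c: "e ^ 3 = 15 * eis_sum 4 z * e + 35 * eis_sum 6 z" by (simp add: algebra_simps)
  show "4 * e ^ 3 = g2 z * e + g3 z" unfolding c by (simp add: g2_def g3_def)
  show "60 * (eis_sum 4 z + pole_sum 4 z w) = 60 * e\<^sup>2 - 4 * g2 z"
    using pole_sum4_eq[OF z w(2)] by (simp add: e_def g2_def)
  have "140 * (eis_sum 6 z + pole_sum 6 z w) = 140 * (e ^ 3 - 9 * eis_sum 4 z * e - 13 * eis_sum 6 z)"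
    using pole_sum6_eq[OF z w(2)] by (simp add: e_def)
  also have "\<dots> = 88 * e ^ 3 - 8 * g2 z * e"
    unfolding c by (simp add: g2_def algebra_simps)
  finally show "140 * (eis_sum 6 z + pole_sum 6 z w) = 88 * e ^ 3 - 8 * g2 z * e" .
qed

definition half_wp :: "nat \<Rightarrow> complex \<Rightarrow> complex" where
  "half_wp i z = wp z (if i = 0 then 1 / 2 else if i = 1 then z / 2 else (z + 1) / 2)"

text \<open>The half-period values are three distinct roots of one cubic, so Vieta's formulas give
  its coefficients, and the discriminant is 16 times the squared product of the differences of the
  roots.\<close>

lemma half_wp_props:
  assumes z: "Im z > 0"
  defines "e \<equiv> \<lambda>i. half_wp i z"
  shows "e 0 + e 1 + e 2 = 0" "g2 z = - 4 * (e 0 * e 1 + e 0 * e 2 + e 1 * e 2)" "g3 z = 4 * e 0 * e 1 * e 2"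
    and "g2 z ^ 3 - 27 * g3 z ^ 2 \<noteq> 0"
proof -
  note h = half_periods[OF z]
  have c: "4 * e i ^ 3 = g2 z * e i + g3 z" for i
    using half_period_values(1)[OF z h(1,4)] half_period_values(1)[OF z h(2,5)] half_period_values(1)[OF z h(3,6)]
    by (simp add: e_def half_wp_def)
  have d01: "e 0 \<noteq> e 1"
    using wp_half_periods_distinct[OF z h(1,4,5)] h(6) by (simp add: e_def half_wp_def add_divide_distrib)
  have s: "(z + 1) / 2 + 1 / 2 = z / 2 + lattice_pt z (1, 0)" "(z + 1) / 2 + z / 2 = 1 / 2 + lattice_pt z (0, 1)"
    by (simp_all add: lattice_pt_def field_simps)
  have d02: "e 0 \<noteq> e 2"
    using wp_half_periods_distinct[OF z h(1,4,6)] h(5) s(1) lattice_periodic[of "z / 2" z "(1, 0)"]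
    by (simp add: e_def half_wp_def)
  have d12: "e 1 \<noteq> e 2"
    using wp_half_periods_distinct[OF z h(2,5,6)] h(4) s(2) lattice_periodic[of "1 / 2" z "(0, 1)"]
    by (simp add: e_def half_wp_def)
  define x y t where "x = e 0" and "y = e 1" and "t = e 2"
  have n: "x \<noteq> y" "x \<noteq> t" "y \<noteq> t" using d01 d02 d12 by (auto simp: x_def y_def t_def)
  \<comment> \<open>Two instances of the cubic equation are subtracted, so that the difference of
    the roots factors out.\<close>
  have "(x - y) * (4 * (x\<^sup>2 + x * y + y\<^sup>2) - g2 z) = 0"
    using c[of 0] c[of 1] unfolding x_def[symmetric] y_def[symmetric] by algebra
  then have xy: "g2 z = 4 * (x\<^sup>2 + x * y + y\<^sup>2)" using n by simp
  have "(x - t) * (4 * (x\<^sup>2 + x * t + t\<^sup>2) - g2 z) = 0"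
    using c[of 0] c[of 2] unfolding x_def[symmetric] t_def[symmetric] by algebra
  then have xt: "g2 z = 4 * (x\<^sup>2 + x * t + t\<^sup>2)" using n by simp
  have "(y - t) * (x + y + t) = 0" using xy xt by algebra
  then have sum: "x + y + t = 0" using n by simp
  then have t: "t = - x - y" by (simp add: eq_neg_iff_add_eq_0 algebra_simps)
  show "e 0 + e 1 + e 2 = 0" using sum by (simp add: x_def y_def t_def)
  have g2: "g2 z = - 4 * (x * y + x * t + y * t)" unfolding xy t by (simp add: algebra_simps power2_eq_square)
  then show "g2 z = - 4 * (e 0 * e 1 + e 0 * e 2 + e 1 * e 2)" by (simp add: x_def y_def t_def)
  have "g3 z = 4 * x ^ 3 - g2 z * x" using c[of 0] by (simp add: x_def)
  then have g3: "g3 z = 4 * x * y * t" unfolding g2 t by (simp add: algebra_simps power2_eq_square power3_eq_cube)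
  then show "g3 z = 4 * e 0 * e 1 * e 2" by (simp add: x_def y_def t_def)
  have "g2 z ^ 3 - 27 * g3 z ^ 2 = 16 * ((x - y) * (x - t) * (y - t))\<^sup>2"
    unfolding g2 g3 t by (simp add: algebra_simps eval_nat_numeral)
  then show "g2 z ^ 3 - 27 * g3 z ^ 2 \<noteq> 0" using n by simp
qed

lemma g2_g3_superlattices:
  assumes z: "Im z > 0"
  shows "2 ^ 4 * g2 (2 * z) = 60 * half_wp 0 z ^ 2 - 4 * g2 z"
    "2 ^ 6 * g3 (2 * z) = 88 * half_wp 0 z ^ 3 - 8 * g2 z * half_wp 0 z"
    "g2 (z / 2) = 60 * half_wp 1 z ^ 2 - 4 * g2 z"
    "g3 (z / 2) = 88 * half_wp 1 z ^ 3 - 8 * g2 z * half_wp 1 z"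
    "g2 ((z + 1) / 2) = 60 * half_wp 2 z ^ 2 - 4 * g2 z"
    "g3 ((z + 1) / 2) = 88 * half_wp 2 z ^ 3 - 8 * g2 z * half_wp 2 z"
proof -
  note h = half_periods[OF z]
  note s4 = eis_sum_superlattices[OF z, of 4, simplified] and s6 = eis_sum_superlattices[OF z, of 6, simplified]
  have "2 ^ 4 * g2 (2 * z) = 60 * (2 ^ 4 * eis_sum 4 (2 * z))" "2 ^ 6 * g3 (2 * z) = 140 * (2 ^ 6 * eis_sum 6 (2 * z))"
    by (simp_all add: g2_def g3_def)
  then have d: "2 ^ 4 * g2 (2 * z) = 60 * (eis_sum 4 z + pole_sum 4 z (1 / 2))"
    "2 ^ 6 * g3 (2 * z) = 140 * (eis_sum 6 z + pole_sum 6 z (1 / 2))"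
    by (simp_all only: eis_sum_superlattices[OF z, of 4, simplified] eis_sum_superlattices[OF z, of 6, simplified] eis_sum_superlattices(1)[OF z, of 4] eis_sum_superlattices(1)[OF z, of 6] even_numeral numeral_le_iff semiring_norm)
  show "2 ^ 4 * g2 (2 * z) = 60 * half_wp 0 z ^ 2 - 4 * g2 z" "2 ^ 6 * g3 (2 * z) = 88 * half_wp 0 z ^ 3 - 8 * g2 z * half_wp 0 z"
    unfolding d half_period_values(2,3)[OF z h(1,4)] by (simp_all add: half_wp_def)
  show "g2 (z / 2) = 60 * half_wp 1 z ^ 2 - 4 * g2 z" "g3 (z / 2) = 88 * half_wp 1 z ^ 3 - 8 * g2 z * half_wp 1 z"
    using half_period_values(2,3)[OF z h(2,5)] s4(2) s6(2) by (simp_all add: half_wp_def g2_def[of "z / 2"] g3_def[of "z / 2"])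
  show "g2 ((z + 1) / 2) = 60 * half_wp 2 z ^ 2 - 4 * g2 z" "g3 ((z + 1) / 2) = 88 * half_wp 2 z ^ 3 - 8 * g2 z * half_wp 2 z"
    using half_period_values(2,3)[OF z h(3,6)] s4(3) s6(3) by (simp_all add: half_wp_def g2_def[of "(z + 1) / 2"] g3_def[of "(z + 1) / 2"])
qed

section \<open>Eisenstein series as functions of the lattice parameter\<close>

lemma eis_sum_modular:
  fixes a b c d :: int
  assumes z: "Im z > 0" and det: "a * d - b * c = 1"
  shows "eis_sum k ((of_int a * z + of_int b) / (of_int c * z + of_int d)) = (of_int c * z + of_int d) ^ k * eis_sum k z"
proof -
  define v where "v = of_int c * z + of_int d"
  have "v \<noteq> 0"
  proof
    assume "v = 0"
    then have "lattice_pt z (d, c) = 0" by (simp add: v_def lattice_pt_def add.commute)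
    then have "d = 0" "c = 0" using lattice_pt_eq_0_iff[OF z, of "(d, c)"] by auto
    then show False using det by simp
  qed
  \<comment> \<open>Over the common denominator \<open>v\<close>, the lattice point m + n (a z + b)
    / (c z + d) has the numerator with indices \<open>h (m, n)\<close> in the lattice of
    \<open>z\<close>; determinant 1 makes \<open>h\<close> invertible.\<close>
  define h :: "int \<times> int \<Rightarrow> int \<times> int" where "h = (\<lambda>p. (fst p * d + snd p * b, fst p * c + snd p * a))"
  have bij: "bij h"
  proof (rule bij_betw_byWitness[where f' = "\<lambda>p. (fst p * a - snd p * b, snd p * d - fst p * c)"])
    have e: "m * d * a = m + m * b * c" for m using det by (metis add.commute diff_add_cancel distrib_left mult.assoc mult.commute mult.right_neutral)
    show "\<forall>p\<in>UNIV. (fst (h p) * a - snd (h p) * b, snd (h p) * d - fst (h p) * c) = p"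
      using e by (auto simp: h_def algebra_simps)
    show "\<forall>p\<in>UNIV. h (fst p * a - snd p * b, snd p * d - fst p * c) = p"
      using e by (auto simp: h_def algebra_simps)
  qed auto
  have "lattice_pt ((of_int a * z + of_int b) / v) p = lattice_pt z (h p) / v" for p
    using \<open>v \<noteq> 0\<close> by (simp add: lattice_pt_def h_def field_simps) (simp add: v_def algebra_simps)
  then have "eis_sum k ((of_int a * z + of_int b) / v) = (\<Sum>\<^sub>\<infinity>p. v ^ k * (1 / lattice_pt z (h p) ^ k))"
    by (simp add: eis_sum_def power_divide)
  also have "\<dots> = (\<Sum>\<^sub>\<infinity>p. v ^ k * (1 / lattice_pt z p ^ k))"
    by (rule infsum_reindex_bij_betw[OF bij, of "\<lambda>p. v ^ k * (1 / lattice_pt z p ^ k)"])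
  also have "\<dots> = v ^ k * eis_sum k z"
    unfolding eis_sum_def by (rule infsum_cmult_right')
  finally show ?thesis by (simp add: v_def)
qed

lemma eis_sum_term_bound:
  assumes "Im z \<ge> d" "d > 0" "\<bar>Re z\<bar> \<le> R" "p \<noteq> (0, 0)" "k \<ge> 3"
  shows "norm (1 / lattice_pt z p ^ k) \<le> 1 / (d / (d + R + 1)) ^ k * (1 / lattice_norm p ^ 3)"
  using lattice_pt_lower[OF assms(1-3), of p] assms
  by (intro inverse_power_bound) (auto intro!: divide_pos_pos)

lemma eis_sum_holomorphic:
  assumes k: "k \<ge> 3" shows "eis_sum k holomorphic_on {z. Im z > 0}"
  unfolding eis_sum_def[abs_def]
proof (rule holomorphic_on_infsum)
  show "open {z. Im z > 0}" by (rule open_halfspace_Im_gt)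
  show "(\<lambda>z. 1 / lattice_pt z p ^ k) holomorphic_on {z. Im z > 0}" for p
  proof (cases "p = (0, 0)")
    case True
    then have "lattice_pt z p = 0" for z by (simp add: lattice_pt_def)
    then show ?thesis by simp
  next
    case False
    then have "lattice_pt z p \<noteq> 0" if "Im z > 0" for z using lattice_pt_eq_0_iff[OF that] by simp
    then show ?thesis unfolding lattice_pt_def by (intro holomorphic_intros) auto
  qed
  fix x assume x: "x \<in> {z. Im z > 0}"
  define r where "r = Im x / 2"
  have r: "r > 0" using x by (simp add: r_def)
  have y: "Im y \<ge> r" "\<bar>Re y\<bar> \<le> \<bar>Re x\<bar> + r" if "y \<in> cball x r" for y
    using that abs_Im_le_cmod[of "y - x"] abs_Re_le_cmod[of "y - x"] by (auto simp: dist_norm norm_minus_commute r_def)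
  define M where "M = (\<lambda>p. 1 / (r / (r + (\<bar>Re x\<bar> + r) + 1)) ^ k * (1 / lattice_norm p ^ 3))"
  have "\<forall>p. p \<notin> {(0, 0)} \<longrightarrow> (\<forall>y\<in>cball x r. norm (1 / lattice_pt y p ^ k) \<le> M p)"
    unfolding M_def using y r k by (intro allI impI ballI eis_sum_term_bound) auto
  moreover have "M summable_on UNIV" unfolding M_def by (intro summable_on_cmult_right lattice_norm_summable)
  moreover have "cball x r \<subseteq> {z. Im z > 0}" using y(1) r by force
  ultimately show "\<exists>r>0. \<exists>F M. cball x r \<subseteq> {z. Im z > 0} \<and> finite F \<and> M summable_on UNIV \<and>
      (\<forall>p. p \<notin> F \<longrightarrow> (\<forall>y\<in>cball x r. norm (1 / lattice_pt y p ^ k) \<le> M p))"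
    using r by (intro exI[of _ r] exI[of _ "{(0, 0)}"] exI[of _ M] conjI) (assumption | simp only: finite.intros)+
qed

lemma eis_sum_bounded:
  assumes k: "k \<ge> 3"
  obtains B where "\<And>z. Im z \<ge> 1 \<Longrightarrow> \<bar>Re z\<bar> \<le> 1 \<Longrightarrow> norm (eis_sum k z) \<le> B"
proof (rule that)
  \<comment> \<open>1 / 3 is the constant d / (d + R + 1) of the lattice estimate at d = R =
    1.\<close>
  define M where "M = (\<lambda>p. 1 / (1 / 3) ^ k * (1 / lattice_norm p ^ 3))"
  have M: "M summable_on UNIV" unfolding M_def by (intro summable_on_cmult_right lattice_norm_summable)
  fix z assume z: "Im z \<ge> 1" "\<bar>Re z\<bar> \<le> 1"
  have b: "norm (1 / lattice_pt z p ^ k) \<le> M p" for p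
  proof (cases "p = (0, 0)")
    case True
    then show ?thesis using k by (simp add: lattice_pt_def M_def lattice_norm_def power_0_left)
  next
    case False
    then show ?thesis using eis_sum_term_bound[OF z(1) _ z(2) False k] by (simp add: M_def)
  qed
  show "norm (eis_sum k z) \<le> (\<Sum>\<^sub>\<infinity>p. M p)"
    unfolding eis_sum_def by (rule norm_infsum_le[OF has_sum_infsum[OF _] has_sum_infsum[OF M] b])
      (rule abs_summable_summable[OF summable_on_comparison_test[OF M b]], simp)
qed

subsection \<open>Expansions at the cusp\<close>

definition nome :: "complex \<Rightarrow> complex" where
  "nome z = exp (2 * of_real pi * \<i> * z)"

lemma norm_nome: "norm (nome z) = exp (- 2 * pi * Im z)"
  by (simp add: nome_def norm_exp_eq_Re)

lemma nome_nonzero [simp]: "nome z \<noteq> 0"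
  by (simp add: nome_def)

lemma norm_nome_less_1: "Im z > 0 \<Longrightarrow> norm (nome z) < 1"
  by (simp add: norm_nome)

text \<open>Only a right inverse of \<open>nome\<close>: the principal logarithm jumps across the
  negative axis, by a period of the functions to which it is applied.\<close>

definition nome_inv :: "complex \<Rightarrow> complex" where
  "nome_inv w = Ln w / (2 * of_real pi * \<i>)"

lemma nome_nome_inv: "w \<noteq> 0 \<Longrightarrow> nome (nome_inv w) = w"
  by (simp add: nome_def nome_inv_def)

lemma Im_nome_inv: "w \<noteq> 0 \<Longrightarrow> Im (nome_inv w) = - ln (norm w) / (2 * pi)"
proof -
  assume "w \<noteq> 0"
  then have "exp (- 2 * pi * Im (nome_inv w)) = norm w" by (metis norm_nome nome_nome_inv)
  then have "- 2 * pi * Im (nome_inv w) = ln (norm w)" by (metis ln_exp)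
  then show ?thesis by (simp add: field_simps)
qed

lemma Im_nome_inv_pos: "w \<noteq> 0 \<Longrightarrow> norm w < 1 \<Longrightarrow> Im (nome_inv w) > 0"
  by (simp add: Im_nome_inv divide_neg_pos ln_less_zero)

lemma nome_eqD: "nome z = nome z' \<Longrightarrow> \<exists>n::int. z = z' + of_int n"
proof -
  assume "nome z = nome z'"
  then obtain n :: int where "2 * of_real pi * \<i> * z = 2 * of_real pi * \<i> * z' + (of_int (2 * n) * pi) * \<i>"
    unfolding nome_def exp_eq by blast
  then have "2 * of_real pi * \<i> * (z - z' - of_int n) = 0" by (simp add: algebra_simps)
  then have "z = z' + of_int n" by (simp add: diff_eq_eq add.commute)
  then show ?thesis by blast
qed

text \<open>A function of period 1 descends along \<open>nome\<close> to the punctured disc;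
  boundedness near the cusp makes the singularity at 0 removable, and the Taylor series there is the
  expansion.\<close>

lemma q_expansion_exists:
  assumes hol: "f holomorphic_on upper_half_plane"
    and per: "\<And>z. z \<in> upper_half_plane \<Longrightarrow> f (z + 1) = f z"
    and bd: "\<And>z. Im z \<ge> Y \<Longrightarrow> norm (f z) \<le> B"
  shows "\<exists>c. has_q_expansion f c"
proof -
  have per': "f (z + of_int n) = f z" if "z \<in> upper_half_plane" for z and n :: int
  proof (induction n rule: int_induct[of _ 0])
    case (step1 i)
    then show ?case using per[of "z + of_int i"] that by (simp add: upper_half_plane_def add.assoc)
  next
    case (step2 i)
    then show ?case using per[of "z + of_int (i - 1)"] that by (simp add: upper_half_plane_def add.assoc)
  qed simp
  define F where "F = (\<lambda>w. f (nome_inv w))"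
  have F: "F (nome z) = f z" if "z \<in> upper_half_plane" for z
  proof -
    have "nome (nome_inv (nome z)) = nome z" by (rule nome_nome_inv) simp
    then obtain n :: int where "nome_inv (nome z) = z + of_int n" using nome_eqD by blast
    then show ?thesis using per'[OF that] by (simp add: F_def)
  qed
  have holF: "F holomorphic_on ball 0 1 - {0}"
  proof (rule analytic_imp_holomorphic, unfold analytic_on_def, intro ballI)
    fix w0 :: complex assume w0: "w0 \<in> ball 0 1 - {0}"
    define r where "r = min (norm w0) (1 - norm w0)"
    have r: "r > 0" using w0 by (auto simp: r_def)
    \<comment> \<open>A branch of the logarithm holomorphic near \<open>w0\<close> wherever
      \<open>w0\<close> lies, since w / w0 stays in the right half-plane. It differs from
      \<open>nome_inv\<close> by an integer, which the period of \<open>f\<close> absorbs.\<close>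
    define g where "g = (\<lambda>w. (Ln (w / w0) + Ln w0) / (2 * of_real pi * \<i>))"
    have pos: "Re (w / w0) > 0" and wn: "w \<noteq> 0" "norm w < 1" if "w \<in> ball w0 r" for w
    proof -
      have d: "norm (w - w0) < norm w0" "norm (w - w0) < 1 - norm w0" using that by (auto simp: r_def dist_norm norm_minus_commute)
      have "w / w0 - 1 = (w - w0) / w0" using w0 by (simp add: diff_divide_distrib)
      then have "norm (w / w0 - 1) < 1" using d(1) w0 by (simp add: norm_divide)
      then have "\<bar>Re (w / w0 - 1)\<bar> < 1" using abs_Re_le_cmod[of "w / w0 - 1"] by linarith
      then show "Re (w / w0) > 0" by (simp del: Re_divide)
      show "w \<noteq> 0" using d(1) by auto
      show "norm w < 1" using d(2) norm_triangle_sub[of w w0] by linarith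
    qed
    have np: "w / w0 \<notin> \<real>\<^sub>\<le>\<^sub>0" if "w \<in> ball w0 r" for w
      using pos[OF that] by (auto simp: complex_nonpos_Reals_iff simp del: Re_divide)
    have nom: "nome (g w) = w" if "w \<in> ball w0 r" for w
      using wn[OF that] w0 by (simp add: g_def nome_def exp_add)
    have gH: "g w \<in> upper_half_plane" if "w \<in> ball w0 r" for w
    proof -
      have "norm (nome (g w)) < 1" using nom[OF that] wn[OF that] by simp
      then show ?thesis by (simp add: norm_nome upper_half_plane_def zero_less_mult_iff)
    qed
    have "g holomorphic_on ball w0 r" unfolding g_def using np w0 by (intro holomorphic_intros) auto
    then have "(f \<circ> g) holomorphic_on ball w0 r" using gH by (intro holomorphic_on_compose_gen[OF _ hol]) auto
    moreover have "(f \<circ> g) w = F w" if "w \<in> ball w0 r" for w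
      using F[OF gH[OF that]] nom[OF that] by simp
    ultimately have "F holomorphic_on ball w0 r" by (rule holomorphic_transform)
    then show "\<exists>e>0. F holomorphic_on ball w0 e" using r by blast
  qed
  have "eventually (\<lambda>w. norm (F w) \<le> B) (at 0)"
    unfolding eventually_at
  proof (intro exI[of _ "exp (- 2 * pi * Y)"] conjI ballI impI)
    fix w :: complex assume w: "w \<noteq> 0 \<and> dist w 0 < exp (- 2 * pi * Y)"
    then have "ln (norm w) < ln (exp (- 2 * pi * Y))" by (subst ln_less_cancel_iff) auto
    then have "ln (norm w) < - 2 * pi * Y" by simp
    then have "Im (nome_inv w) \<ge> Y" using w by (simp add: Im_nome_inv field_simps)
    then show "norm (F w) \<le> B" unfolding F_def by (rule bd)
  qed simp
  then obtain G where G: "G holomorphic_on ball 0 1" "\<And>w. w \<in> ball 0 1 - {0} \<Longrightarrow> G w = F w"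
    using holomorphic_on_extend_bounded[OF holF] by auto
  have "has_q_expansion f (\<lambda>n. (deriv ^^ n) G 0 / fact n)"
    unfolding has_q_expansion_def
  proof
    fix z assume z: "z \<in> upper_half_plane"
    then have n: "nome z \<in> ball 0 1 - {0}" by (simp add: upper_half_plane_def norm_nome_less_1)
    have "(\<lambda>n. (deriv ^^ n) G 0 / fact n * (nome z - 0) ^ n) sums G (nome z)"
      by (rule holomorphic_power_series[OF G(1)]) (use n in auto)
    then show "(\<lambda>n. (deriv ^^ n) G 0 / fact n * exp (2 * of_real pi * \<i> * z) ^ n) sums f z"
      using G(2)[OF n] F[OF z] by (simp add: nome_def)
  qed
  then show ?thesis by blast
qed

definition q_series :: "(nat \<Rightarrow> complex) \<Rightarrow> complex \<Rightarrow> complex" where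
  "q_series c w = (\<Sum>n. c n * w ^ n)"

lemma q_series_sums:
  assumes "has_q_expansion f c" "norm w < 1"
  shows "(\<lambda>n. c n * w ^ n) sums q_series c w"
proof (cases "w = 0")
  case True
  then show ?thesis unfolding q_series_def using summable_sums[OF powser_inside] by simp
next
  case False
  then have "nome_inv w \<in> upper_half_plane" using Im_nome_inv_pos assms(2) by (simp add: upper_half_plane_def)
  then have "(\<lambda>n. c n * w ^ n) sums f (nome_inv w)"
    using assms(1) nome_nome_inv[OF False] by (auto simp: has_q_expansion_def nome_def)
  then show ?thesis unfolding q_series_def using sums_summable summable_sums by blast
qed

lemma q_series_nome:
  assumes "has_q_expansion f c" "z \<in> upper_half_plane"
  shows "f z = q_series c (nome z)"
  using assms by (auto simp: has_q_expansion_def nome_def q_series_def sums_unique)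

lemma q_series_shift:
  assumes "has_q_expansion f c" "norm w < 1" "\<And>i. i < n \<Longrightarrow> c i = 0"
  shows "(\<lambda>i. c (i + n) * w ^ i) sums q_series (\<lambda>i. c (i + n)) w"
    and "q_series c w = w ^ n * q_series (\<lambda>i. c (i + n)) w"
proof -
  have sm: "summable (\<lambda>i. c (i + n) * v ^ i)" if v: "norm v < 1" "v \<noteq> 0" for v
  proof -
    have "summable (\<lambda>i. c (i + n) * v ^ (i + n))"
      using sums_summable[OF q_series_sums[OF assms(1) v(1)]] by (rule summable_ignore_initial_segment)
    then have "summable (\<lambda>i. v ^ n * (c (i + n) * v ^ i))" by (simp add: power_add mult_ac)
    then show ?thesis using v(2) by (simp add: summable_cmult_iff)
  qed
  show s: "(\<lambda>i. c (i + n) * w ^ i) sums q_series (\<lambda>i. c (i + n)) w"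
    unfolding q_series_def
    by (rule summable_sums, cases "w = 0") (use sm assms(2) in auto)
  have "(\<lambda>i. w ^ n * (c (i + n) * w ^ i)) sums (w ^ n * q_series (\<lambda>i. c (i + n)) w)"
    using s by (rule sums_mult)
  then have "(\<lambda>i. c (i + n) * w ^ (i + n)) sums (w ^ n * q_series (\<lambda>i. c (i + n)) w)"
    by (simp add: power_add mult_ac)
  then have "(\<lambda>i. c i * w ^ i) sums (w ^ n * q_series (\<lambda>i. c (i + n)) w)"
  proof -
    assume *: "(\<lambda>i. c (i + n) * w ^ (i + n)) sums (w ^ n * q_series (\<lambda>i. c (i + n)) w)"
    have "(\<Sum>i<n. c i * w ^ i) = 0" using assms(3) by (intro sum.neutral) auto
    then show ?thesis using * sums_iff_shift'[of "\<lambda>i. c i * w ^ i" n] by simp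
  qed
  then show "q_series c w = w ^ n * q_series (\<lambda>i. c (i + n)) w"
    using q_series_sums[OF assms(1,2)] sums_unique2 by blast
qed

lemma q_series_holomorphic:
  assumes "has_q_expansion f c" "\<And>i. i < n \<Longrightarrow> c i = 0"
  shows "q_series (\<lambda>i. c (i + n)) holomorphic_on ball 0 1"
  by (rule power_series_holomorphic) (use q_series_shift(1)[OF assms(1) _ assms(2)] in simp)

lemma q_series_0: "q_series c 0 = c 0"
  unfolding q_series_def by (rule sums_unique[symmetric]) (rule powser_sums_zero)

text \<open>After division by w^n, legitimate once the earlier coefficients vanish, the value at 0
  is the next coefficient, and continuity makes it 0.\<close>

lemma q_expansion_zero:
  assumes "has_q_expansion f c" "\<And>z. z \<in> upper_half_plane \<Longrightarrow> f z = 0"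
  shows "c n = 0"
proof (induction n rule: less_induct)
  case (less n)
  define h where "h = q_series (\<lambda>i. c (i + n))"
  have h0: "h w = 0" if "w \<noteq> 0" "norm w < 1" for w
  proof -
    have "nome_inv w \<in> upper_half_plane" using Im_nome_inv_pos that by (simp add: upper_half_plane_def)
    then have "q_series c w = 0" using q_series_nome[OF assms(1)] assms(2) nome_nome_inv[OF that(1)] by metis
    then show ?thesis using q_series_shift(2)[OF assms(1) that(2) less] that by (simp add: h_def)
  qed
  have "isCont h 0"
    using q_series_holomorphic[OF assms(1) less] holomorphic_on_imp_continuous_on continuous_on_interior
    unfolding h_def by (metis centre_in_ball interior_ball zero_less_one)
  then have "(h \<longlongrightarrow> h 0) (at 0)" by (simp add: isCont_def)
  moreover have "(h \<longlongrightarrow> 0) (at 0)"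
  proof (rule tendsto_eventually)
    show "eventually (\<lambda>w. h w = 0) (at 0)"
      unfolding eventually_at by (rule exI[of _ 1]) (use h0 in \<open>auto simp: dist_norm\<close>)
  qed
  ultimately have "h 0 = 0" by (rule tendsto_unique[OF trivial_limit_at])
  then show "c n = 0" by (simp add: h_def q_series_0)
qed

lemma has_q_expansion_lincomb:
  assumes "has_q_expansion f c" "has_q_expansion g d"
  shows "has_q_expansion (\<lambda>z. a * f z + b * g z) (\<lambda>n. a * c n + b * d n)"
proof -
  have "(\<lambda>n. (a * c n + b * d n) * x ^ n) sums (a * s + b * t)"
    if "(\<lambda>n. c n * x ^ n) sums s" "(\<lambda>n. d n * x ^ n) sums t" for x s t :: complex
    using sums_add[OF sums_mult[OF that(1), of a] sums_mult[OF that(2), of b]] by (simp add: algebra_simps)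
  then show ?thesis using assms unfolding has_q_expansion_def by blast
qed

lemma has_q_expansion_unique:
  assumes "has_q_expansion f c" "has_q_expansion f d" shows "c = d"
proof
  fix n
  have "1 * c n + (- 1) * d n = 0"
    by (rule q_expansion_zero[OF has_q_expansion_lincomb[OF assms]]) simp
  then show "c n = d n" by simp
qed

lemma q_coeff_eq: "has_q_expansion f c \<Longrightarrow> q_coeff f = c"
  unfolding q_coeff_def using has_q_expansion_unique by blast

lemma has_q_expansion_q_coeff: "has_q_expansion f c \<Longrightarrow> has_q_expansion f (q_coeff f)"
  by (simp add: q_coeff_eq)

lemma q_expansion_bounded:
  assumes "has_q_expansion f c"
  obtains B where "\<And>z. Im z \<ge> 1 \<Longrightarrow> norm (f z) \<le> B"
proof -
  have "q_series c holomorphic_on ball 0 1" using q_series_holomorphic[OF assms, of 0] by simp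
  then have "continuous_on (cball 0 (exp (- 2 * pi))) (q_series c)"
  proof (rule holomorphic_on_imp_continuous_on[OF holomorphic_on_subset])
    show "cball 0 (exp (- 2 * pi)) \<subseteq> ball (0::complex) 1"
    proof
      fix x :: complex assume "x \<in> cball 0 (exp (- 2 * pi))"
      then have "norm x \<le> exp (- 2 * pi)" by simp
      also have "\<dots> < 1" by simp
      finally show "x \<in> ball 0 1" by simp
    qed
  qed
  then have "bounded (q_series c ` cball 0 (exp (- 2 * pi)))"
    by (intro compact_imp_bounded compact_continuous_image) auto
  then obtain B where B: "\<forall>w\<in>cball 0 (exp (- 2 * pi)). norm (q_series c w) \<le> B" by (auto simp: bounded_iff)
  show thesis
  proof (rule that)
    fix z assume "Im z \<ge> 1"
    then show "norm (f z) \<le> B" using B q_series_nome[OF assms, of z] by (simp add: upper_half_plane_def norm_nome)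
  qed
qed

subsection \<open>Modular forms of level one\<close>

text \<open>The space \<open>cusp_forms\<close> with the condition \<open>c 0 = 0\<close> dropped.
  The monomials in \<open>g2\<close> and \<open>g3\<close> live here, and the trace is first
  computed on this larger space.\<close>

definition modular_forms :: "nat \<Rightarrow> (complex \<Rightarrow> complex) set" where
  "modular_forms w = {f.
     f holomorphic_on upper_half_plane \<and>
     (\<forall>a b c d :: int. a * d - b * c = 1 \<longrightarrow>
       (\<forall>z\<in>upper_half_plane.
         f ((of_int a * z + of_int b) / (of_int c * z + of_int d)) =
           (of_int c * z + of_int d) ^ w * f z)) \<and>
     (\<exists>c. has_q_expansion f c) \<and>
     (\<forall>z. z \<notin> upper_half_plane \<longrightarrow> f z = 0)}"

lemma pi_ge_3: "pi \<ge> 3"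
  using sin_x_le_x[of "pi / 6"] by (simp add: sin_30)

lemma lattice_min:
  assumes z: "Im z > 0"
  obtains p where "p \<noteq> (0, 0)" "\<And>q. q \<noteq> (0, 0) \<Longrightarrow> norm (lattice_pt z p) \<le> norm (lattice_pt z q)"
proof -
  obtain c where c: "c > 0" "\<And>p. norm (lattice_pt z p) \<ge> c * lattice_norm p"
    using lattice_pt_lower' z by blast
  define A where "A = {p. lattice_norm p \<le> 1 / c} - {(0, 0)} \<union> {(1, 0)}"
  have "finite A" by (simp add: A_def finite_lattice_norm_le)
  moreover have "A \<noteq> {}" by (simp add: A_def)
  ultimately obtain p where p: "p \<in> A" "\<And>q. q \<in> A \<Longrightarrow> norm (lattice_pt z p) \<le> norm (lattice_pt z q)"
    using ex_min_if_finite[of "(\<lambda>p. norm (lattice_pt z p)) ` A"] by (force simp: not_less)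
  have "norm (lattice_pt z p) \<le> norm (lattice_pt z q)" if "q \<noteq> (0, 0)" for q
  proof (cases "q \<in> A")
    case False
    then have "lattice_norm q > 1 / c" using that by (auto simp: A_def)
    then have "1 < norm (lattice_pt z q)" using c(1) c(2)[of q] by (simp add: field_simps)
    moreover have "norm (lattice_pt z p) \<le> 1" using p(2)[of "(1, 0)"] by (simp add: A_def lattice_pt_def)
    ultimately show ?thesis by linarith
  qed (use p in auto)
  moreover have "p \<noteq> (0, 0)" using p(1) by (auto simp: A_def)
  ultimately show thesis using that by blast
qed

lemma Im_moebius:
  fixes a b c d :: int
  assumes z: "Im z > 0" and det: "a * d - b * c = 1"
  shows "Im ((of_int a * z + of_int b) / (of_int c * z + of_int d)) = Im z / (norm (of_int c * z + of_int d))\<^sup>2"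
    and "(of_int c * z + of_int d :: complex) \<noteq> 0"
proof -
  define v where "v = of_int c * z + of_int d"
  have det': "real_of_int a * real_of_int d - real_of_int b * real_of_int c = 1"
    using det by (metis of_int_1 of_int_diff of_int_mult)
  show "(of_int c * z + of_int d :: complex) \<noteq> 0"
  proof
    assume "of_int c * z + of_int d = (0::complex)"
    then have "lattice_pt z (d, c) = 0" by (simp add: lattice_pt_def add.commute)
    then have "d = 0" "c = 0" using lattice_pt_eq_0_iff[OF z, of "(d, c)"] by auto
    then show False using det by simp
  qed
  have "Im ((of_int a * z + of_int b) / v) = (Im (of_int a * z + of_int b) * Re v - Re (of_int a * z + of_int b) * Im v) / (norm v)\<^sup>2"
    by (simp only: Im_divide cmod_power2)
  also have "Im (of_int a * z + of_int b) * Re v - Re (of_int a * z + of_int b) * Im v = (real_of_int a * real_of_int d - real_of_int b * real_of_int c) * Im z"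
    by (simp add: v_def algebra_simps)
  finally show "Im ((of_int a * z + of_int b) / (of_int c * z + of_int d)) = Im z / (norm (of_int c * z + of_int d))\<^sup>2"
    unfolding det' by (simp add: v_def)
qed

text \<open>A shortest lattice vector c z + d serves as the denominator. It is primitive, so (c, d)
  completes to a matrix of determinant 1; a translation then adjusts the real part. The numerator is
  a lattice vector too, hence not shorter, so the image has norm at least 1, and with real part at
  most 1/2 its height is at least sqrt 3 / 2.\<close>

lemma fundamental_domain:
  assumes z: "Im z > 0"
  obtains a b c d :: int where "a * d - b * c = 1"
    "Im ((of_int a * z + of_int b) / (of_int c * z + of_int d)) \<ge> sqrt 3 / 2"
    "\<bar>Re ((of_int a * z + of_int b) / (of_int c * z + of_int d))\<bar> \<le> 1 / 2"
proof -
  obtain p where p: "p \<noteq> (0, 0)" "\<And>q. q \<noteq> (0, 0) \<Longrightarrow> norm (lattice_pt z p) \<le> norm (lattice_pt z q)"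
    using lattice_min[OF z] by blast
  obtain d c where dc: "p = (d, c)" by (cases p)
  define v where "v = of_int c * z + of_int d"
  have v: "norm v \<le> norm (of_int c' * z + of_int d')" if "c' \<noteq> 0 \<or> d' \<noteq> 0" for c' d' :: int
    using p(2)[of "(d', c')"] that by (auto simp: v_def dc lattice_pt_def add.commute)
  have "v \<noteq> 0" using p(1) lattice_pt_eq_0_iff[OF z, of p] by (auto simp: v_def dc lattice_pt_def add.commute)
  have "gcd c d = 1"
  proof -
    define g where "g = gcd c d"
    have g: "g > 0" using p(1) by (auto simp: dc g_def)
    obtain c' d' where cd: "c = g * c'" "d = g * d'" unfolding g_def by (meson dvd_def gcd_dvd1 gcd_dvd2)
    have "c' \<noteq> 0 \<or> d' \<noteq> 0" using p(1) cd dc by auto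
    then have le: "norm v \<le> norm (of_int c' * z + of_int d')" by (rule v)
    have vg: "v = of_int g * (of_int c' * z + of_int d')" by (simp add: v_def cd algebra_simps)
    then have "norm v = of_int g * norm (of_int c' * z + of_int d')" using g by (simp add: norm_mult)
    moreover have "norm (of_int c' * z + of_int d') > 0" using \<open>v \<noteq> 0\<close> vg by auto
    ultimately have "of_int g \<le> (1::real)" using le by (simp add: mult_le_cancel_right1)
    then have "g = 1" using g by simp
    then show ?thesis by (simp add: g_def)
  qed
  then obtain x y where xy: "x * c + y * d = 1" using bezout_int[of c d] by auto
  define z1 where "z1 = (of_int y * z + of_int (- x)) / v"
  define n where "n = - \<lfloor>Re z1 + 1 / 2\<rfloor>"
  define a b where "a = y + n * c" and "b = - x + n * d"
  have det: "a * d - b * c = 1" using xy by (simp add: a_def b_def algebra_simps)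
  define z2 where "z2 = (of_int a * z + of_int b) / v"
  have z2: "z2 = z1 + of_int n"
    using \<open>v \<noteq> 0\<close> by (simp add: z2_def z1_def a_def b_def field_simps) (simp add: v_def algebra_simps)
  have "Re z2 = Re z1 - of_int \<lfloor>Re z1 + 1 / 2\<rfloor>" by (simp add: z2 n_def)
  then have re: "\<bar>Re z2\<bar> \<le> 1 / 2" by linarith
  have "a \<noteq> 0 \<or> b \<noteq> 0" using det by auto
  then have "norm v \<le> norm (of_int a * z + of_int b)" by (rule v)
  then have "norm z2 \<ge> 1" using \<open>v \<noteq> 0\<close> by (simp add: z2_def norm_divide)
  have "Im z2 > 0" using Im_moebius[OF z det] z \<open>v \<noteq> 0\<close> by (simp add: z2_def v_def)
  have "1 \<le> (norm z2)\<^sup>2" using \<open>norm z2 \<ge> 1\<close> by simp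
  also have "\<dots> = (Re z2)\<^sup>2 + (Im z2)\<^sup>2" by (rule cmod_power2)
  also have "(Re z2)\<^sup>2 \<le> (1 / 2)\<^sup>2" using re abs_le_square_iff[of "Re z2" "1 / 2"] by simp
  finally have "3 / 4 \<le> (Im z2)\<^sup>2" by (simp add: power2_eq_square)
  then have "sqrt (3 / 4) \<le> Im z2" using \<open>Im z2 > 0\<close> by (intro real_le_lsqrt) auto
  then have "sqrt 3 / 2 \<le> Im z2" by (simp add: real_sqrt_divide)
  then show thesis using that[OF det] re by (simp add: z2_def v_def)
qed

text \<open>Let z0, of height y0, maximize the invariant |f|^2 y^w. The maximum principle for f /
  q^n on the disc bounded by the circle of a smaller height y gives 4 pi n (y0 - y) <= w ln (y0 /
  y), and y -> y0 gives 4 pi n y0 <= w. As y0 >= sqrt 3 / 2 and 2 pi sqrt 3 > 10, the constant is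
  10, slightly weaker than the optimal 12 but enough for the weights up to 12 to which it will be
  applied.\<close>

lemma order_bound:
  assumes f: "f \<in> modular_forms w" "has_q_expansion f c" and c: "\<And>i. i < n \<Longrightarrow> c i = 0" "n \<ge> 1"
    and nz: "z1 \<in> upper_half_plane" "f z1 \<noteq> 0"
  shows "10 * real n < real w"
proof -
  have hol: "f holomorphic_on upper_half_plane" using f by (simp add: modular_forms_def)
  define \<phi> where "\<phi> = (\<lambda>z. (norm (f z))\<^sup>2 * Im z ^ w)"
  have inv: "\<phi> ((of_int a * z + of_int b) / (of_int c * z + of_int d)) = \<phi> z"
    if z: "Im z > 0" and det: "a * d - b * c = 1" for a b c d :: int and z
  proof -
    define v where "v = of_int c * z + of_int d"
    have v: "v \<noteq> 0" using Im_moebius(2)[OF z det] by (simp add: v_def)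
    have "f ((of_int a * z + of_int b) / v) = v ^ w * f z"
      using f(1) z det unfolding v_def by (auto simp: modular_forms_def upper_half_plane_def)
    moreover have "Im ((of_int a * z + of_int b) / v) = Im z / (norm v)\<^sup>2"
      using Im_moebius(1)[OF z det] by (simp add: v_def)
    ultimately show ?thesis using v
      by (simp add: \<phi>_def v_def[symmetric] norm_mult norm_power power_mult_distrib power_divide flip: power_mult) (simp add: mult.commute)
  qed
  define h where "h = q_series (\<lambda>i. c (i + n))"
  have holh: "h holomorphic_on ball 0 1" unfolding h_def by (rule q_series_holomorphic[OF f(2) c(1)])
  have fh: "f z = nome z ^ n * h (nome z)" if "Im z > 0" for z
    using q_series_nome[OF f(2), of z] q_series_shift(2)[OF f(2) norm_nome_less_1[OF that] c(1)] that
    by (simp add: h_def upper_half_plane_def)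
  have s3: "sqrt 3 > (17 / 10 :: real)" by (rule real_less_rsqrt) (simp add: power2_eq_square)
  define A where "A = {z. sqrt 3 / 2 \<le> Im z \<and> \<bar>Re z\<bar> \<le> 1 / 2}"
  have Apos: "Im z > 0" if "z \<in> A" for z using that s3 by (auto simp: A_def)
  have red: "\<exists>z'\<in>A. \<phi> z' = \<phi> z" if z: "Im z > 0" for z
  proof -
    obtain a b c d :: int where "a * d - b * c = 1"
      "Im ((of_int a * z + of_int b) / (of_int c * z + of_int d)) \<ge> sqrt 3 / 2"
      "\<bar>Re ((of_int a * z + of_int b) / (of_int c * z + of_int d))\<bar> \<le> 1 / 2"
      by (rule fundamental_domain[OF z])
    then show ?thesis using inv[OF z]
      by (intro bexI[of _ "(of_int a * z + of_int b) / (of_int c * z + of_int d)"]) (simp_all add: A_def)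
  qed
  have "\<phi> z1 > 0" using nz by (simp add: \<phi>_def upper_half_plane_def)
  moreover have "Im z1 > 0" using nz(1) by (simp add: upper_half_plane_def)
  ultimately obtain z2 where z2: "z2 \<in> A" "\<phi> z2 > 0" using red[of z1] by auto
  obtain C where C: "\<And>z. Im z \<ge> 1 \<Longrightarrow> norm (h (nome z)) \<le> C"
  proof -
    have "continuous_on (cball 0 (exp (- 2 * pi))) h"
    proof (rule holomorphic_on_imp_continuous_on[OF holomorphic_on_subset[OF holh]])
      show "cball 0 (exp (- 2 * pi)) \<subseteq> ball (0::complex) 1"
      proof
        fix x :: complex assume "x \<in> cball 0 (exp (- 2 * pi))"
        then have "norm x \<le> exp (- 2 * pi)" by simp
        also have "\<dots> < 1" by simp
        finally show "x \<in> ball 0 1" by simp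
      qed
    qed
    then have "bounded (h ` cball 0 (exp (- 2 * pi)))"
      by (intro compact_imp_bounded compact_continuous_image) auto
    then obtain B where "\<forall>w\<in>cball 0 (exp (- 2 * pi)). norm (h w) \<le> B" by (auto simp: bounded_iff)
    then show thesis using that[of B] by (simp add: norm_nome)
  qed
  \<comment> \<open>One factor q, available because n >= 1, already beats every power of the height.
    So \<open>\<phi>\<close> decays at the cusp and its maximum over a compact part of the
    fundamental domain is global.\<close>
  have bound: "\<phi> z \<le> C\<^sup>2 * (exp (- 4 * pi * Im z) * Im z ^ w)" if z: "Im z \<ge> 1" for z
  proof -
    have "norm (f z) \<le> exp (- 2 * pi * Im z) ^ n * C"
      using fh[of z] C[OF z] z by (simp add: norm_mult norm_power norm_nome mult_left_mono)
    also have "\<dots> \<le> exp (- 2 * pi * Im z) ^ 1 * C"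
      using c(2) z C[OF z] order_trans[OF norm_ge_zero C[OF z]] by (intro mult_right_mono power_decreasing) auto
    finally have "norm (f z) \<le> exp (- 2 * pi * Im z) * C" by simp
    then have "(norm (f z))\<^sup>2 \<le> (exp (- 2 * pi * Im z) * C)\<^sup>2" by (intro power_mono) auto
    also have "\<dots> = C\<^sup>2 * exp (- 4 * pi * Im z)" by (simp add: power_mult_distrib flip: exp_double)
    finally show ?thesis using z by (simp add: \<phi>_def mult_right_mono)
  qed
  have "((\<lambda>y::real. C\<^sup>2 * (exp (- 4 * pi * y) * y ^ w)) \<longlongrightarrow> C\<^sup>2 * 0) at_top"
  proof (intro tendsto_mult tendsto_const)
    have "((\<lambda>y::real. y ^ w / exp y) \<longlongrightarrow> 0) at_top" by (rule tendsto_power_div_exp_0)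
    then show "((\<lambda>y::real. exp (- 4 * pi * y) * y ^ w) \<longlongrightarrow> 0) at_top"
    proof (rule Lim_null_comparison[rotated])
      show "eventually (\<lambda>y::real. norm (exp (- 4 * pi * y) * y ^ w) \<le> y ^ w / exp y) at_top"
        using eventually_ge_at_top[of 0]
      proof eventually_elim
        case (elim y)
        have "1 * y \<le> 4 * pi * y" using elim pi_ge_3 by (intro mult_right_mono) auto
        then have "exp (- 4 * pi * y) \<le> exp (- y)" by simp
        then have "exp (- 4 * pi * y) * y ^ w \<le> exp (- y) * y ^ w" using elim by (intro mult_right_mono) auto
        then show ?case using elim by (simp add: exp_minus field_simps abs_mult)
      qed
    qed
  qed
  then have "eventually (\<lambda>y. C\<^sup>2 * (exp (- 4 * pi * y) * y ^ w) < \<phi> z2) at_top"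
    using z2(2) by (intro order_tendstoD(2)) auto
  then obtain Y where Y: "\<And>y. y \<ge> Y \<Longrightarrow> C\<^sup>2 * (exp (- 4 * pi * y) * y ^ w) < \<phi> z2"
    by (auto simp: eventually_at_top_linorder)
  \<comment> \<open>Above this height \<open>\<phi>\<close> stays below its value at
    \<open>z2\<close>, and \<open>z2\<close> itself is kept inside the truncated domain.\<close>
  define Y' where "Y' = max 1 (max Y (Im z2))"
  define K where "K = cbox (Complex (- 1 / 2) (sqrt 3 / 2)) (Complex (1 / 2) Y')"
  have K: "z \<in> K \<longleftrightarrow> z \<in> A \<and> Im z \<le> Y'" for z
    by (auto simp: K_def A_def in_cbox_complex_iff abs_le_iff)
  have "z2 \<in> K" using z2(1) K by (simp add: Y'_def)
  then have "K \<noteq> {}" by blast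
  moreover have "continuous_on K \<phi>"
    unfolding \<phi>_def
  proof (intro continuous_intros)
    show "continuous_on K f"
      by (rule continuous_on_subset[OF holomorphic_on_imp_continuous_on[OF hol]])
        (use K Apos in \<open>auto simp: upper_half_plane_def\<close>)
  qed
  ultimately obtain z0 where z0: "z0 \<in> K" "\<And>z. z \<in> K \<Longrightarrow> \<phi> z \<le> \<phi> z0"
    using continuous_attains_sup[of K \<phi>] by (auto simp: K_def)
  have z20: "\<phi> z2 \<le> \<phi> z0" using z0(2)[of z2] z2(1) K by (simp add: Y'_def)
  have maxA: "\<phi> z \<le> \<phi> z0" if "z \<in> A" for z
  proof (cases "Im z \<le> Y'")
    case True then show ?thesis using z0(2) K that by blast
  next
    case False
    then have "Im z \<ge> 1" "Im z \<ge> Y" by (auto simp: Y'_def)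
    then have "\<phi> z < \<phi> z2" using le_less_trans[OF bound Y] by blast
    then show ?thesis using z20 by simp
  qed
  have max: "\<phi> z \<le> \<phi> z0" if "Im z > 0" for z using red[OF that] maxA by metis
  define y0 where "y0 = Im z0"
  have y0: "y0 \<ge> sqrt 3 / 2" "y0 > 0" using z0(1) K Apos by (auto simp: y0_def A_def)
  have M: "(norm (f z0))\<^sup>2 * y0 ^ w > 0" using z20 z2(2) by (simp add: \<phi>_def y0_def)
  have main: "4 * pi * n \<le> w / y" if y: "0 < y" "y < y0" for y
  proof -
    define r where "r = exp (- 2 * pi * y)"
    have r: "0 < r" "r < 1" using y by (auto simp: r_def)
    \<comment> \<open>On the circle |q| = r all points have height y, so the maximality of z0 bounds
      |f|^2 there by |f(z0)|^2 (y0 / y)^w; division by r^n bounds |h|.\<close>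
    define B where "B = sqrt ((norm (f z0))\<^sup>2 * (y0 / y) ^ w) / r ^ n"
    have "norm (h (nome z0)) \<le> B"
    proof (rule maximum_modulus_frontier[of h "ball 0 r"])
      show "h holomorphic_on interior (ball 0 r)" using holomorphic_on_subset[OF holh, of "ball 0 r"] r subset_ball[of r 1 "0::complex"] by simp
      have "closure (ball 0 r) \<subseteq> ball (0::complex) 1" using r by (auto simp: dist_norm intro: le_less_trans)
      then show "continuous_on (closure (ball 0 r)) h"
        using holomorphic_on_imp_continuous_on holomorphic_on_subset[OF holh] by blast
      show "nome z0 \<in> ball 0 r" using y by (simp add: norm_nome r_def y0_def)
      fix u :: complex assume "u \<in> frontier (ball 0 r)"
      then have u: "norm u = r" using r by (simp add: frontier_ball)
      then have "u \<noteq> 0" using r by auto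
      define z where "z = nome_inv u"
      have nz: "nome z = u" using nome_nome_inv[OF \<open>u \<noteq> 0\<close>] by (simp add: z_def)
      have Imz: "Im z = y" using Im_nome_inv[OF \<open>u \<noteq> 0\<close>] by (simp add: z_def u r_def)
      have "(norm (f z))\<^sup>2 * y ^ w \<le> (norm (f z0))\<^sup>2 * y0 ^ w"
        using max[of z] y by (simp add: \<phi>_def Imz y0_def)
      then have "(norm (f z))\<^sup>2 \<le> (norm (f z0))\<^sup>2 * (y0 / y) ^ w" using y by (simp add: power_divide field_simps)
      then have "norm (f z) \<le> sqrt ((norm (f z0))\<^sup>2 * (y0 / y) ^ w)" by (rule real_le_rsqrt)
      moreover have "norm (f z) = r ^ n * norm (h u)"
        using fh[of z] y by (simp add: Imz nz norm_mult norm_power u)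
      ultimately show "norm (h u) \<le> B" using r by (simp add: B_def field_simps)
    qed auto
    then have "norm (f z0) \<le> norm (nome z0) ^ n * B"
      using fh[of z0] y0 by (simp add: y0_def norm_mult norm_power mult_left_mono)
    also have "\<dots> = (norm (nome z0) / r) ^ n * (norm (f z0) * sqrt ((y0 / y) ^ w))"
    proof -
      have "sqrt ((norm (f z0))\<^sup>2 * (y0 / y) ^ w) = norm (f z0) * sqrt ((y0 / y) ^ w)"
        by (simp only: real_sqrt_mult real_sqrt_abs abs_norm_cancel)
      then have "B = norm (f z0) * sqrt ((y0 / y) ^ w) / r ^ n" by (simp only: B_def)
      then show ?thesis by (simp add: power_divide)
    qed
    also have "norm (nome z0) / r = exp (- 2 * pi * (y0 - y))"
      by (simp add: norm_nome r_def y0_def exp_diff[symmetric] algebra_simps)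
    finally have "1 \<le> exp (- 2 * pi * (y0 - y)) ^ n * sqrt ((y0 / y) ^ w)"
      using M by (simp add: zero_less_mult_iff mult.left_commute)
    then have "1 ^ 2 \<le> (exp (- 2 * pi * (y0 - y)) ^ n * sqrt ((y0 / y) ^ w))\<^sup>2" by (intro power_mono) auto
    also have "\<dots> = exp (- 4 * pi * n * (y0 - y)) * (y0 / y) ^ w"
    proof -
      have "(exp (- 2 * pi * (y0 - y)) ^ n)\<^sup>2 = exp (- 4 * pi * n * (y0 - y))"
        by (simp add: exp_of_nat_mult[symmetric] exp_double[symmetric] algebra_simps)
      moreover have "(sqrt ((y0 / y) ^ w))\<^sup>2 = (y0 / y) ^ w" using y y0 by simp
      ultimately show ?thesis by (simp add: power_mult_distrib)
    qed
    finally have le: "1 \<le> exp (- 4 * pi * n * (y0 - y)) * (y0 / y) ^ w" by simp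
    define X where "X = 4 * pi * n * (y0 - y)"
    have "1 \<le> exp (- X) * (y0 / y) ^ w" using le by (simp add: X_def)
    then have "exp X * 1 \<le> exp X * (exp (- X) * (y0 / y) ^ w)" by (rule mult_left_mono) simp
    then have "exp (4 * pi * n * (y0 - y)) \<le> (y0 / y) ^ w"
      by (simp add: X_def[symmetric] mult.assoc[symmetric] exp_add[symmetric])
    then have "4 * pi * n * (y0 - y) \<le> ln ((y0 / y) ^ w)"
      using y y0 by (subst ln_ge_iff) auto
    also have "\<dots> = w * ln (y0 / y)" using y y0 by (simp add: ln_realpow)
    also have "\<dots> \<le> w * (y0 / y - 1)" using y y0 by (intro mult_left_mono ln_le_minus_one) auto
    also have "\<dots> = w / y * (y0 - y)" using y by (simp add: field_simps)
    finally show ?thesis by (rule mult_right_le_imp_le) (use y in simp)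
  qed
  \<comment> \<open>The passage y -> y0 without a limit: if the claim failed, some y would lie
    strictly between w / (4 pi n) and y0, against \<open>main\<close>.\<close>
  have "4 * pi * n * y0 \<le> w"
  proof (rule ccontr)
    assume "\<not> 4 * pi * n * y0 \<le> w"
    then have "w / (4 * pi * n) < y0" using c(2) by (simp add: field_simps)
    then obtain y where y: "max 0 (w / (4 * pi * n)) < y" "y < y0" using dense[of "max 0 (w / (4 * pi * n))" y0] y0 by auto
    then have y': "0 < y" "w / (4 * pi * n) < y" by linarith+
    then have "4 * pi * n \<le> w / y" using y(2) by (intro main)
    then show False using y' c(2) by (simp add: field_simps)
  qed
  moreover have "10 * real n < 4 * pi * n * y0"
  proof -
    have "10 < 4 * 3 * (17 / 10 / 2 :: real)" by simp
    also have "\<dots> \<le> 4 * pi * y0" using pi_ge_3 y0 s3 by (intro mult_mono) auto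
    finally show ?thesis using c(2) by (simp add: mult.commute mult.left_commute)
  qed
  ultimately show ?thesis by linarith
qed

section \<open>Linear combinations, products and quotients of forms\<close>

lemma modular_formsD:
  assumes "f \<in> modular_forms w"
  shows "f holomorphic_on upper_half_plane"
    and "\<And>a b c d z. a * d - b * c = 1 \<Longrightarrow> z \<in> upper_half_plane \<Longrightarrow>
         f ((of_int a * z + of_int b) / (of_int c * z + of_int d)) = (of_int c * z + of_int d) ^ w * f z"
    and "has_q_expansion f (q_coeff f)"
    and "\<And>z. z \<notin> upper_half_plane \<Longrightarrow> f z = 0"
  using assms has_q_expansion_q_coeff by (auto simp: modular_forms_def)

lemma cusp_forms_iff: "f \<in> cusp_forms w \<longleftrightarrow> f \<in> modular_forms w \<and> q_coeff f 0 = 0"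
  unfolding cusp_forms_def modular_forms_def using q_coeff_eq by auto

lemma open_upper_half_plane: "open upper_half_plane"
  unfolding upper_half_plane_def by (rule open_halfspace_Im_gt)

lemma connected_upper_half_plane: "connected upper_half_plane"
  unfolding upper_half_plane_def by (intro convex_connected convex_halfspace_Im_gt)

lemma modular_forms_lincomb:
  assumes f: "f \<in> modular_forms w" and g: "g \<in> modular_forms w"
  shows "(\<lambda>z. a * f z + b * g z) \<in> modular_forms w"
    and "q_coeff (\<lambda>z. a * f z + b * g z) n = a * q_coeff f n + b * q_coeff g n"
proof -
  have e: "has_q_expansion (\<lambda>z. a * f z + b * g z) (\<lambda>n. a * q_coeff f n + b * q_coeff g n)"
    by (intro has_q_expansion_lincomb modular_formsD(3)[OF f] modular_formsD(3)[OF g])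
  show "q_coeff (\<lambda>z. a * f z + b * g z) n = a * q_coeff f n + b * q_coeff g n"
    by (simp add: q_coeff_eq[OF e])
  show "(\<lambda>z. a * f z + b * g z) \<in> modular_forms w"
    unfolding modular_forms_def
  proof (intro CollectI conjI allI ballI impI)
    show "(\<lambda>z. a * f z + b * g z) holomorphic_on upper_half_plane"
      by (intro holomorphic_intros modular_formsD(1)[OF f] modular_formsD(1)[OF g])
  next
    fix a' b' c' d' :: int and z assume h: "a' * d' - b' * c' = 1" "z \<in> upper_half_plane"
    show "a * f ((of_int a' * z + of_int b') / (of_int c' * z + of_int d')) + b * g ((of_int a' * z + of_int b') / (of_int c' * z + of_int d')) =
      (of_int c' * z + of_int d') ^ w * (a * f z + b * g z)"
      unfolding modular_formsD(2)[OF f h] modular_formsD(2)[OF g h] by (simp add: algebra_simps)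
  next
    show "\<exists>c. has_q_expansion (\<lambda>z. a * f z + b * g z) c" using e by blast
  next
    fix z assume "z \<notin> upper_half_plane"
    then show "a * f z + b * g z = 0" using modular_formsD(4)[OF f] modular_formsD(4)[OF g] by simp
  qed
qed

lemma modular_formsI:
  assumes hol: "f holomorphic_on upper_half_plane"
    and tr: "\<And>a b c d z. a * d - b * c = 1 \<Longrightarrow> z \<in> upper_half_plane \<Longrightarrow>
         f ((of_int a * z + of_int b) / (of_int c * z + of_int d)) = (of_int c * z + of_int d) ^ w * f z"
    and bd: "\<And>z. Im z \<ge> Y \<Longrightarrow> norm (f z) \<le> B"
    and out: "\<And>z. z \<notin> upper_half_plane \<Longrightarrow> f z = 0"
  shows "f \<in> modular_forms w"
proof -
  have "f (z + 1) = f z" if "z \<in> upper_half_plane" for z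
    using tr[of 1 1 1 0 z] that by simp
  then have "\<exists>c. has_q_expansion f c" by (rule q_expansion_exists[OF hol _ bd])
  then show ?thesis unfolding modular_forms_def using hol tr out by blast
qed

text \<open>Along this sequence q tends to 0. The constant term thus becomes a limit, and its
  multiplicativity reduces to the product rule for limits.\<close>

lemma q_coeff_0_limit:
  assumes "has_q_expansion f c"
  shows "(\<lambda>n. f (\<i> * of_nat (Suc n))) \<longlonglongrightarrow> c 0"
proof -
  have "q_series c holomorphic_on ball 0 1" using q_series_holomorphic[OF assms, of 0] by simp
  then have "isCont (q_series c) 0"
    using holomorphic_on_imp_continuous_on continuous_on_interior by (metis centre_in_ball interior_ball zero_less_one)
  moreover have "(\<lambda>n. nome (\<i> * of_nat (Suc n))) \<longlonglongrightarrow> 0"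
  proof (rule tendsto_norm_zero_cancel)
    have "(\<lambda>n. exp (- 2 * pi) ^ Suc n) \<longlonglongrightarrow> (0::real)"
      by (intro LIMSEQ_Suc LIMSEQ_realpow_zero) auto
    moreover have "norm (nome (\<i> * of_nat (Suc n))) = exp (- 2 * pi) ^ Suc n" for n
      by (simp add: norm_nome exp_of_nat_mult[symmetric] algebra_simps del: power_Suc of_nat_Suc)
    ultimately show "(\<lambda>n. norm (nome (\<i> * of_nat (Suc n)))) \<longlonglongrightarrow> 0" by (simp only:)
  qed
  ultimately have "(\<lambda>n. q_series c (nome (\<i> * of_nat (Suc n)))) \<longlonglongrightarrow> q_series c 0"
    by (rule isCont_tendsto_compose)
  then show ?thesis
    using q_series_nome[OF assms] by (simp add: q_series_0 upper_half_plane_def del: of_nat_Suc)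
qed

lemma modular_forms_mult:
  assumes f: "f \<in> modular_forms w" and g: "g \<in> modular_forms v"
  shows "(\<lambda>z. f z * g z) \<in> modular_forms (w + v)"
    and "q_coeff (\<lambda>z. f z * g z) 0 = q_coeff f 0 * q_coeff g 0"
proof -
  obtain B where B: "\<And>z. Im z \<ge> 1 \<Longrightarrow> norm (f z) \<le> B" by (rule q_expansion_bounded[OF modular_formsD(3)[OF f]]) (rule that)
  obtain C where C: "\<And>z. Im z \<ge> 1 \<Longrightarrow> norm (g z) \<le> C" by (rule q_expansion_bounded[OF modular_formsD(3)[OF g]]) (rule that)
  show m: "(\<lambda>z. f z * g z) \<in> modular_forms (w + v)"
  proof (rule modular_formsI)
    show "(\<lambda>z. f z * g z) holomorphic_on upper_half_plane"
      by (intro holomorphic_intros modular_formsD(1)[OF f] modular_formsD(1)[OF g])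
    fix a b c d :: int and z assume h: "a * d - b * c = 1" "z \<in> upper_half_plane"
    show "f ((of_int a * z + of_int b) / (of_int c * z + of_int d)) * g ((of_int a * z + of_int b) / (of_int c * z + of_int d)) =
      (of_int c * z + of_int d) ^ (w + v) * (f z * g z)"
      unfolding modular_formsD(2)[OF f h] modular_formsD(2)[OF g h] by (simp add: power_add)
  next
    fix z :: complex assume "Im z \<ge> 1"
    then show "norm (f z * g z) \<le> B * C"
      unfolding norm_mult using B[of z] C[of z] order_trans[OF norm_ge_zero B[of z]] by (intro mult_mono) auto
  qed (simp add: modular_formsD(4)[OF f])
  have "(\<lambda>n. f (\<i> * of_nat (Suc n)) * g (\<i> * of_nat (Suc n))) \<longlonglongrightarrow> q_coeff f 0 * q_coeff g 0"
    by (intro tendsto_mult q_coeff_0_limit modular_formsD(3)[OF f] modular_formsD(3)[OF g])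
  then show "q_coeff (\<lambda>z. f z * g z) 0 = q_coeff f 0 * q_coeff g 0"
    using q_coeff_0_limit[OF modular_formsD(3)[OF m]] LIMSEQ_unique by blast
qed

text \<open>Both expansions are divided by the same power q^m. The denominator then has a nonzero
  value at q = 0, so the quotient is bounded near the cusp.\<close>

lemma modular_forms_divide:
  assumes f: "f \<in> modular_forms (w + v)" and g: "g \<in> modular_forms v"
    and nz: "\<And>z. z \<in> upper_half_plane \<Longrightarrow> g z \<noteq> 0"
    and ord: "\<And>i. i < m \<Longrightarrow> q_coeff f i = 0" "\<And>i. i < m \<Longrightarrow> q_coeff g i = 0" "q_coeff g m \<noteq> 0"
  shows "(\<lambda>z. f z / g z) \<in> modular_forms w"
proof -
  define hf hg where "hf = q_series (\<lambda>i. q_coeff f (i + m))" and "hg = q_series (\<lambda>i. q_coeff g (i + m))"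
  note ef = modular_formsD(3)[OF f] and eg = modular_formsD(3)[OF g]
  have "hf holomorphic_on ball 0 1" "hg holomorphic_on ball 0 1"
    unfolding hf_def hg_def using q_series_holomorphic[OF ef ord(1)] q_series_holomorphic[OF eg ord(2)] by auto
  then have "isCont hf 0" "isCont hg 0"
    using holomorphic_on_imp_continuous_on continuous_on_interior by (metis centre_in_ball interior_ball zero_less_one)+
  moreover have "hg 0 \<noteq> 0" using ord(3) by (simp add: hg_def q_series_0)
  ultimately have "isCont (\<lambda>q. hf q / hg q) 0" by (intro isCont_divide)
  then obtain d where d: "d > 0" "\<And>q. norm q < d \<Longrightarrow> dist (hf q / hg q) (hf 0 / hg 0) < 1"
    unfolding continuous_at_eps_delta by (metis dist_0_norm dist_commute zero_less_one)
  \<comment> \<open>Since 2 pi >= 1, this height forces |nome z| < d.\<close>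
  define Y where "Y = max 1 (1 - ln d)"
  show ?thesis
  proof (rule modular_formsI)
    show "(\<lambda>z. f z / g z) holomorphic_on upper_half_plane"
      using modular_formsD(1)[OF f] modular_formsD(1)[OF g] nz by (intro holomorphic_intros) auto
    fix a b c d :: int and z assume h: "a * d - b * c = 1" "z \<in> upper_half_plane"
    have "of_int c * z + of_int d \<noteq> 0" using Im_moebius(2)[OF _ h(1), of z] h(2) by (simp add: upper_half_plane_def)
    then show "f ((of_int a * z + of_int b) / (of_int c * z + of_int d)) / g ((of_int a * z + of_int b) / (of_int c * z + of_int d)) =
      (of_int c * z + of_int d) ^ w * (f z / g z)"
      unfolding modular_formsD(2)[OF f h] modular_formsD(2)[OF g h] by (simp add: power_add)
  next
    fix z :: complex assume "Im z \<ge> Y"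
    then have z: "Im z \<ge> 1" "1 - ln d \<le> Im z" by (auto simp: Y_def)
    have "1 * Im z \<le> 2 * pi * Im z" using z pi_ge_3 by (intro mult_right_mono) auto
    then have "- 2 * pi * Im z < ln d" using z by linarith
    then have "exp (- 2 * pi * Im z) < exp (ln d)" by (subst exp_less_cancel_iff)
    then have nd: "norm (nome z) < d" using d(1) by (simp add: norm_nome)
    have H: "z \<in> upper_half_plane" using z by (simp add: upper_half_plane_def)
    have n1: "norm (nome z) < 1" using z by (intro norm_nome_less_1) simp
    have "f z = nome z ^ m * hf (nome z)" "g z = nome z ^ m * hg (nome z)"
      unfolding hf_def hg_def using q_series_nome[OF ef H] q_series_nome[OF eg H]
        q_series_shift(2)[OF ef n1 ord(1)] q_series_shift(2)[OF eg n1 ord(2)] by simp_all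
    then have "f z / g z = hf (nome z) / hg (nome z)" by simp
    then have "dist (f z / g z) (hf 0 / hg 0) < 1" using d(2)[OF nd] by simp
    then show "norm (f z / g z) \<le> norm (hf 0 / hg 0) + 1"
      using norm_triangle_sub[of "f z / g z" "hf 0 / hg 0"] by (simp add: dist_norm)
  qed (simp add: modular_formsD(4)[OF f])
qed

lemma eis_modular_form:
  assumes k: "k \<ge> 3"
  shows "(\<lambda>z. if z \<in> upper_half_plane then eis_sum k z else 0) \<in> modular_forms k"
proof -
  let ?f = "\<lambda>z. if z \<in> upper_half_plane then eis_sum k z else 0"
  obtain B where B: "\<And>z. Im z \<ge> 1 \<Longrightarrow> \<bar>Re z\<bar> \<le> 1 \<Longrightarrow> norm (eis_sum k z) \<le> B" by (rule eis_sum_bounded[OF k]) (rule that)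
  show ?thesis
  proof (rule modular_formsI)
    show "?f holomorphic_on upper_half_plane"
      by (rule holomorphic_transform[OF eis_sum_holomorphic[OF k, folded upper_half_plane_def]]) simp
    fix a b c d :: int and z assume h: "a * d - b * c = 1" "z \<in> upper_half_plane"
    have z: "Im z > 0" using h by (simp add: upper_half_plane_def)
    have "(of_int a * z + of_int b) / (of_int c * z + of_int d) \<in> upper_half_plane"
      using Im_moebius[OF z h(1)] z by (simp add: upper_half_plane_def)
    then show "?f ((of_int a * z + of_int b) / (of_int c * z + of_int d)) = (of_int c * z + of_int d) ^ k * ?f z"
      using eis_sum_modular[OF z h(1)] h(2) by simp
  next
    fix z :: complex assume z: "Im z \<ge> 1"
    define n where "n = - \<lfloor>Re z\<rfloor>"
    have "norm (eis_sum k (z + of_int n)) \<le> B"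
      using z by (intro B) (auto simp: n_def abs_le_iff, linarith+)
    moreover have "eis_sum k (z + of_int n) = eis_sum k z"
      using eis_sum_modular[of z 1 1 n 0 k] z by simp
    ultimately show "norm (?f z) \<le> B" using z by (simp add: upper_half_plane_def)
  qed simp
qed

section \<open>Monomials, the discriminant and forms of small weight\<close>

definition g_mono :: "nat \<Rightarrow> nat \<Rightarrow> complex \<Rightarrow> complex" where
  "g_mono a b = (\<lambda>z. if z \<in> upper_half_plane then g2 z ^ a * g3 z ^ b else 0)"

lemma g_mono_mult: "(\<lambda>z. g_mono a b z * g_mono a' b' z) = g_mono (a + a') (b + b')"
  by (auto simp: g_mono_def fun_eq_iff power_add)

lemma g_mono_base: "g_mono 1 0 \<in> modular_forms 4" "g_mono 0 1 \<in> modular_forms 6" "g_mono 0 0 \<in> modular_forms 0"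
proof -
  have "(\<lambda>z. 60 * (if z \<in> upper_half_plane then eis_sum 4 z else 0) + 0 * (if z \<in> upper_half_plane then eis_sum 4 z else 0)) \<in> modular_forms 4"
    by (intro modular_forms_lincomb eis_modular_form) auto
  also have "(\<lambda>z. 60 * (if z \<in> upper_half_plane then eis_sum 4 z else 0) + 0 * (if z \<in> upper_half_plane then eis_sum 4 z else 0)) = g_mono 1 0"
    by (auto simp: g_mono_def g2_def)
  finally show "g_mono 1 0 \<in> modular_forms 4" .
  have "(\<lambda>z. 140 * (if z \<in> upper_half_plane then eis_sum 6 z else 0) + 0 * (if z \<in> upper_half_plane then eis_sum 6 z else 0)) \<in> modular_forms 6"
    by (intro modular_forms_lincomb eis_modular_form) auto
  also have "(\<lambda>z. 140 * (if z \<in> upper_half_plane then eis_sum 6 z else 0) + 0 * (if z \<in> upper_half_plane then eis_sum 6 z else 0)) = g_mono 0 1"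
    by (auto simp: g_mono_def g3_def)
  finally show "g_mono 0 1 \<in> modular_forms 6" .
  show "g_mono 0 0 \<in> modular_forms 0"
  proof (rule modular_formsI)
    show "g_mono 0 0 holomorphic_on upper_half_plane"
      by (rule holomorphic_transform[of "\<lambda>_. 1"]) (auto simp: g_mono_def)
    fix a b c d :: int and z assume h: "a * d - b * c = 1" "z \<in> upper_half_plane"
    have "(of_int a * z + of_int b) / (of_int c * z + of_int d) \<in> upper_half_plane"
      using Im_moebius[OF _ h(1), of z] h(2) by (simp add: upper_half_plane_def)
    then show "g_mono 0 0 ((of_int a * z + of_int b) / (of_int c * z + of_int d)) = (of_int c * z + of_int d) ^ 0 * g_mono 0 0 z"
      using h by (simp add: g_mono_def)
  next
    show "norm (g_mono 0 0 z) \<le> 1" for z by (simp add: g_mono_def)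
  qed (simp add: g_mono_def)
qed

lemma g_mono_modular: "g_mono a b \<in> modular_forms (4 * a + 6 * b)"
proof (induction a)
  case 0
  show ?case
  proof (induction b)
    case 0 show ?case using g_mono_base by simp
  next
    case (Suc b)
    then show ?case using modular_forms_mult(1)[OF Suc g_mono_base(2)] by (simp add: g_mono_mult algebra_simps)
  qed
next
  case (Suc a)
  then show ?case using modular_forms_mult(1)[OF Suc g_mono_base(1)] by (simp add: g_mono_mult algebra_simps)
qed

text \<open>The matrices fixing \<i> and \<rho> multiply the weight 6 sum at \<i> by -1 and the
  weight 4 sum at \<rho> by (\<rho> + 1)^4 = \<rho>^2, which is not 1; so both vanish. The nonzero
  discriminant then makes the other invariant nonzero at each point.\<close>

lemma g2_g3_special:
  shows "g3 \<i> = 0" "g2 \<i> \<noteq> 0"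
    and "\<exists>\<rho>. Im \<rho> > 0 \<and> g2 \<rho> = 0 \<and> g3 \<rho> \<noteq> 0"
proof -
  have "eis_sum 6 ((of_int 0 * \<i> + of_int (- 1)) / (of_int 1 * \<i> + of_int 0)) = (of_int 1 * \<i> + of_int 0) ^ 6 * eis_sum 6 \<i>"
    by (rule eis_sum_modular) auto
  then have "eis_sum 6 \<i> = \<i> ^ 6 * eis_sum 6 \<i>" by simp
  moreover have "\<i> ^ 6 = - 1" by (simp add: eval_nat_numeral)
  ultimately have "eis_sum 6 \<i> = 0" by (simp add: eq_neg_iff_add_eq_0)
  then show "g3 \<i> = 0" by (simp add: g3_def)
  then show "g2 \<i> \<noteq> 0" using half_wp_props(4)[of \<i>] by auto
  define \<rho> where "\<rho> = Complex (- 1 / 2) (sqrt 3 / 2)"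
  have r2: "\<rho> * \<rho> = - 1 - \<rho>" by (simp add: \<rho>_def complex_eq_iff)
  have im: "Im \<rho> > 0" by (simp add: \<rho>_def)
  then have r0: "\<rho> \<noteq> 0" "\<rho> \<noteq> 1" by auto
  have "\<rho> * (\<rho> + 1) = - 1" using r2 by (simp add: algebra_simps)
  moreover have "\<rho> + 1 \<noteq> 0" using im by (auto simp: complex_eq_iff)
  ultimately have "- 1 / (\<rho> + 1) = \<rho>" by (metis nonzero_divide_eq_eq)
  moreover have "eis_sum 4 ((of_int 0 * \<rho> + of_int (- 1)) / (of_int 1 * \<rho> + of_int 1)) = (of_int 1 * \<rho> + of_int 1) ^ 4 * eis_sum 4 \<rho>"
    by (rule eis_sum_modular) (use im in auto)
  ultimately have "eis_sum 4 \<rho> = (\<rho> + 1) ^ 4 * eis_sum 4 \<rho>" by simp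
  moreover have "(\<rho> + 1) ^ 4 = \<rho> * \<rho>"
  proof -
    have "(\<rho> + 1) * (\<rho> + 1) = \<rho> * \<rho> + 2 * \<rho> + 1" by (simp add: algebra_simps)
    also have "\<dots> = \<rho>" unfolding r2 by simp
    finally have s: "(\<rho> + 1) * (\<rho> + 1) = \<rho>" .
    have "(\<rho> + 1) ^ 4 = ((\<rho> + 1) * (\<rho> + 1)) * ((\<rho> + 1) * (\<rho> + 1))" by (simp only: power4_eq_xxxx mult.assoc)
    then show "(\<rho> + 1) ^ 4 = \<rho> * \<rho>" by (simp only: s)
  qed
  moreover have "\<rho> * \<rho> \<noteq> 1" using im unfolding r2 by (auto simp: complex_eq_iff)
  ultimately have "eis_sum 4 \<rho> = 0" by (metis mult_cancel_right1)
  then have "g2 \<rho> = 0" by (simp add: g2_def)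
  then show "\<exists>\<rho>. Im \<rho> > 0 \<and> g2 \<rho> = 0 \<and> g3 \<rho> \<noteq> 0" using half_wp_props(4)[OF im] im by auto
qed

lemma cusp_form_eq_0:
  assumes f: "f \<in> modular_forms w" and ord: "\<And>i. i < n \<Longrightarrow> q_coeff f i = 0" "n \<ge> 1" and w: "w \<le> 10 * n"
  shows "f = (\<lambda>_. 0)"
proof
  fix z show "f z = 0"
  proof (rule ccontr)
    assume nz: "f z \<noteq> 0"
    then have "z \<in> upper_half_plane" using modular_formsD(4)[OF f] by blast
    then have "10 * real n < real w" using order_bound[OF f modular_formsD(3)[OF f] ord] nz by blast
    then show False using w by linarith
  qed
qed

text \<open>A form of weight at most 10 that is not identically zero has a nonzero constant term by
  the order bound. This covers \<open>g2\<close>, \<open>g3\<close> and the constant 1, and constant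
  terms multiply.\<close>

lemma q_coeff_g_mono: "q_coeff (g_mono a b) 0 \<noteq> 0"
proof -
  have z: "q_coeff f 0 \<noteq> 0" if "f \<in> modular_forms w" "w \<le> 10" "f z \<noteq> 0" for f w z
    using cusp_form_eq_0[OF that(1), of 1] that by auto
  obtain \<rho> where \<rho>: "Im \<rho> > 0" "g2 \<rho> = 0" "g3 \<rho> \<noteq> 0" using g2_g3_special(3) by blast
  have 2: "q_coeff (g_mono 1 0) 0 \<noteq> 0"
    by (rule z[OF g_mono_base(1), of \<i>]) (auto simp: g_mono_def upper_half_plane_def g2_g3_special)
  have 3: "q_coeff (g_mono 0 1) 0 \<noteq> 0"
    by (rule z[OF g_mono_base(2), of \<rho>]) (use \<rho> in \<open>auto simp: g_mono_def upper_half_plane_def\<close>)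
  have c0: "q_coeff (g_mono 0 0) 0 \<noteq> 0"
    by (rule z[OF g_mono_base(3), of \<i>]) (auto simp: g_mono_def upper_half_plane_def)
  show ?thesis
  proof (induction a)
    case 0
    show ?case
    proof (induction b)
      case (Suc b)
      then show ?case using modular_forms_mult(2)[OF g_mono_modular g_mono_base(2), of 0 b] 3 by (simp add: g_mono_mult)
    qed (rule c0)
  next
    case (Suc a)
    then show ?case using modular_forms_mult(2)[OF g_mono_modular g_mono_base(1), of a b] 2 by (simp add: g_mono_mult)
  qed
qed

definition discr :: "complex \<Rightarrow> complex" where
  "discr z = 1 * g_mono 3 0 z + (- 27) * g_mono 0 2 z"

lemma discr_modular: "discr \<in> modular_forms 12"
  unfolding discr_def[abs_def]
proof (rule modular_forms_lincomb(1))
  show "g_mono 3 0 \<in> modular_forms 12" "g_mono 0 2 \<in> modular_forms 12"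
    using g_mono_modular[of 3 0] g_mono_modular[of 0 2] by simp_all
qed

lemma discr_nonzero: "z \<in> upper_half_plane \<Longrightarrow> discr z \<noteq> 0"
  using half_wp_props(4)[of z] by (simp add: discr_def g_mono_def upper_half_plane_def)

lemma modular_forms_0:
  assumes f: "f \<in> modular_forms 0" shows "\<exists>c. \<forall>z. f z = c * g_mono 0 0 z"
proof -
  define c where "c = q_coeff f 0 / q_coeff (g_mono 0 0) 0"
  have "(\<lambda>z. 1 * f z + (- c) * g_mono 0 0 z) = (\<lambda>_. 0)"
  proof (rule cusp_form_eq_0[of _ 0 1])
    show "(\<lambda>z. 1 * f z + (- c) * g_mono 0 0 z) \<in> modular_forms 0"
      by (rule modular_forms_lincomb(1)[OF f g_mono_base(3)])
    show "q_coeff (\<lambda>z. 1 * f z + (- c) * g_mono 0 0 z) i = 0" if "i < 1" for i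
      unfolding modular_forms_lincomb(2)[OF f g_mono_base(3)] using that q_coeff_g_mono[of 0 0] by (simp add: c_def)
  qed auto
  then have "f z - c * g_mono 0 0 z = 0" for z by (auto simp: fun_eq_iff)
  then show ?thesis by (auto intro!: exI[of _ c])
qed

text \<open>If the discriminant had a nonzero constant term, its quotient of \<open>g2\<close> cubed
  would be a form of weight 0, hence constant; but this quotient vanishes at \<rho> and not at \<i>.
  A zero of order two at the cusp contradicts the order bound in weight 12.\<close>

lemma q_coeff_discr: "q_coeff discr 0 = 0" "q_coeff discr 1 \<noteq> 0"
proof -
  show 0: "q_coeff discr 0 = 0"
  proof (rule ccontr)
    assume nz: "q_coeff discr 0 \<noteq> 0"
    have "g_mono 3 0 \<in> modular_forms (0 + 12)" using g_mono_modular[of 3 0] by simp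
    then have "(\<lambda>z. g_mono 3 0 z / discr z) \<in> modular_forms 0"
      by (rule modular_forms_divide[OF _ discr_modular discr_nonzero, where m = 0]) (use nz in auto)
    then obtain c where c: "\<And>z. g_mono 3 0 z / discr z = c * g_mono 0 0 z" using modular_forms_0 by blast
    obtain \<rho> where \<rho>: "Im \<rho> > 0" "g2 \<rho> = 0" "g3 \<rho> \<noteq> 0" using g2_g3_special(3) by blast
    have "c = 0" using c[of \<rho>] \<rho> by (simp add: g_mono_def upper_half_plane_def)
    then have "g_mono 3 0 \<i> / discr \<i> = 0" using c[of \<i>] by simp
    then show False using discr_nonzero[of \<i>] g2_g3_special(2) by (simp add: g_mono_def upper_half_plane_def)
  qed
  show "q_coeff discr 1 \<noteq> 0"
  proof
    assume "q_coeff discr 1 = 0"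
    then have "discr = (\<lambda>_. 0)"
      using 0 by (intro cusp_form_eq_0[OF discr_modular, of 2]) (auto simp: less_2_cases_iff)
    then have "discr \<i> = 0" by (rule fun_cong)
    then show False using discr_nonzero[of \<i>] by (simp add: upper_half_plane_def)
  qed
qed

text \<open>The matrix fixing \<i> gives f(\<i>) = - f(\<i>). The square of f has weight 4 and is
  therefore a multiple of \<open>g2\<close>, which does not vanish at \<i>; so the factor is
  0.\<close>

lemma modular_forms_2:
  assumes f: "f \<in> modular_forms 2" shows "f = (\<lambda>_. 0)"
proof -
  have "f ((of_int 0 * \<i> + of_int (- 1)) / (of_int 1 * \<i> + of_int 0)) = (of_int 1 * \<i> + of_int 0) ^ 2 * f \<i>"
    by (rule modular_formsD(2)[OF f]) (auto simp: upper_half_plane_def)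
  then have fi: "f \<i> = 0" by (simp add: eq_neg_iff_add_eq_0)
  have f2: "(\<lambda>z. f z * f z) \<in> modular_forms 4" using modular_forms_mult(1)[OF f f] by simp
  define c where "c = q_coeff (\<lambda>z. f z * f z) 0 / q_coeff (g_mono 1 0) 0"
  have "(\<lambda>z. 1 * (f z * f z) + (- c) * g_mono 1 0 z) = (\<lambda>_. 0)"
  proof (rule cusp_form_eq_0[of _ 4 1])
    show "(\<lambda>z. 1 * (f z * f z) + (- c) * g_mono 1 0 z) \<in> modular_forms 4"
      by (rule modular_forms_lincomb(1)[OF f2 g_mono_base(1)])
    show "q_coeff (\<lambda>z. 1 * (f z * f z) + (- c) * g_mono 1 0 z) i = 0" if "i < 1" for i
      unfolding modular_forms_lincomb(2)[OF f2 g_mono_base(1)] using that q_coeff_g_mono[of 1 0] by (simp add: c_def)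
  qed auto
  then have e: "f z * f z = c * g_mono 1 0 z" for z by (auto simp: fun_eq_iff)
  have "c = 0" using e[of \<i>] fi g2_g3_special(2) by (simp add: g_mono_def upper_half_plane_def)
  then show ?thesis using e by (auto simp: fun_eq_iff)
qed

section \<open>The monomials of a given weight as a basis\<close>

definition weight_pairs :: "nat \<Rightarrow> (nat \<times> nat) set" where
  "weight_pairs k = {(a, b). 2 * a + 3 * b = k}"

lemma finite_weight_pairs [simp]: "finite (weight_pairs k)"
  by (rule finite_subset[of _ "{..k} \<times> {..k}"]) (auto simp: weight_pairs_def)

lemma weight_pairs_ex: "k \<ge> 2 \<Longrightarrow> weight_pairs k \<noteq> {}"
proof -
  assume "k \<ge> 2"
  then have "2 * ((k - 3 * (k mod 2)) div 2) + 3 * (k mod 2) = k" by presburger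
  then have "((k - 3 * (k mod 2)) div 2, k mod 2) \<in> weight_pairs k" unfolding weight_pairs_def by blast
  then show ?thesis by blast
qed

text \<open>Multiplication by g2^i g3^j shifts the exponents, and the guards single out the
  monomials that arise. Recurrences between sums of different weights are compared termwise over one
  index set in this way.\<close>

lemma weight_pairs_shift:
  assumes "2 * i + 3 * j = s"
  shows "(\<Sum>(a, b)\<in>weight_pairs k. F a b) =
         (\<Sum>(a, b)\<in>weight_pairs (k + s). if i \<le> a \<and> j \<le> b then F (a - i) (b - j) else 0)"
proof -
  have "(\<Sum>(a, b)\<in>weight_pairs (k + s). if i \<le> a \<and> j \<le> b then F (a - i) (b - j) else 0) =
    (\<Sum>(a, b)\<in>{p \<in> weight_pairs (k + s). i \<le> fst p \<and> j \<le> snd p}. F (a - i) (b - j))"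
    by (simp add: sum.inter_filter case_prod_unfold)
  also have "\<dots> = (\<Sum>(a, b)\<in>weight_pairs k. F a b)"
    by (rule sum.reindex_bij_witness[where i = "\<lambda>(a, b). (a + i, b + j)" and j = "\<lambda>(a, b). (a - i, b - j)"])
      (use assms in \<open>auto simp: weight_pairs_def\<close>)
  finally show ?thesis by simp
qed

text \<open>A multiple of one monomial removes the constant term. For k < 6 the weight is at most 10
  and nothing is left; otherwise the rest is divisible by the discriminant, which lowers k by
  6.\<close>

lemma modular_forms_span:
  assumes "f \<in> modular_forms (2 * k)"
  shows "\<exists>c. \<forall>z. f z = (\<Sum>(a, b)\<in>weight_pairs k. c a b * g_mono a b z)"
  using assms
proof (induction k arbitrary: f rule: less_induct)
  case (less k)
  consider "k = 0" | "k = 1" | "k \<ge> 2" by linarith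
  then show ?case
  proof cases
    case 1
    then have "weight_pairs k = {(0, 0)}" by (auto simp: weight_pairs_def)
    moreover obtain c where "\<forall>z. f z = c * g_mono 0 0 z" using modular_forms_0 less.prems 1 by auto
    ultimately show ?thesis by (intro exI[of _ "\<lambda>_ _. c"]) simp
  next
    case 2
    then have "f = (\<lambda>_. 0)" using modular_forms_2 less.prems by simp
    then show ?thesis by (intro exI[of _ "\<lambda>_ _. 0"]) simp
  next
    case 3
    obtain a0 b0 where ab: "(a0, b0) \<in> weight_pairs k" using weight_pairs_ex[OF 3] by auto
    then have w: "4 * a0 + 6 * b0 = 2 * k" by (auto simp: weight_pairs_def)
    have m: "g_mono a0 b0 \<in> modular_forms (2 * k)" using g_mono_modular[of a0 b0] by (simp only: w)
    define t where "t = q_coeff f 0 / q_coeff (g_mono a0 b0) 0"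
    define h where "h = (\<lambda>z. 1 * f z + (- t) * g_mono a0 b0 z)"
    have hm: "h \<in> modular_forms (2 * k)" unfolding h_def by (rule modular_forms_lincomb(1)[OF less.prems m])
    have h0: "q_coeff h 0 = 0"
      unfolding h_def modular_forms_lincomb(2)[OF less.prems m] using q_coeff_g_mono[of a0 b0] by (simp add: t_def)
    have "\<exists>c. \<forall>z. h z = (\<Sum>(a, b)\<in>weight_pairs k. c a b * g_mono a b z)"
    proof (cases "k < 6")
      case True
      then have "h = (\<lambda>_. 0)" using cusp_form_eq_0[OF hm, of 1] h0 by simp
      then show ?thesis by (intro exI[of _ "\<lambda>_ _. 0"]) simp
    next
      case False
      define k' where "k' = k - 6"
      have k: "k = k' + 6" using False by (simp add: k'_def)
      have "2 * k = 2 * k' + 12" by (simp add: k)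
      then have "h \<in> modular_forms (2 * k' + 12)" using hm by simp
      then have "(\<lambda>z. h z / discr z) \<in> modular_forms (2 * k')"
        by (rule modular_forms_divide[OF _ discr_modular discr_nonzero, where m = 1])
          (use h0 q_coeff_discr in auto)
      then obtain c where c: "\<And>z. h z / discr z = (\<Sum>(a, b)\<in>weight_pairs k'. c a b * g_mono a b z)"
        using less.IH[of k'] k by auto
      \<comment> \<open>The coefficients after multiplying back by g2^3 - 27 g3^2.\<close>
      define d where "d = (\<lambda>a b. (if a \<ge> 3 then c (a - 3) b else 0) + (if b \<ge> 2 then - 27 * c a (b - 2) else 0))"
      have "h z = (\<Sum>(a, b)\<in>weight_pairs k. d a b * g_mono a b z)" for z
      proof (cases "z \<in> upper_half_plane")
        case False
        then show ?thesis using modular_formsD(4)[OF hm] by (simp add: g_mono_def case_prod_unfold)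
      next
        case True
        have "h z = discr z * (h z / discr z)" using discr_nonzero[OF True] by simp
        also have "\<dots> = (\<Sum>(a, b)\<in>weight_pairs k'. c a b * (discr z * g_mono a b z))"
          unfolding c by (simp add: sum_distrib_left case_prod_unfold mult_ac)
        also have "\<dots> = (\<Sum>(a, b)\<in>weight_pairs k'. c a b * g_mono (a + 3) b z) + (\<Sum>(a, b)\<in>weight_pairs k'. - 27 * c a b * g_mono a (b + 2) z)"
        proof -
          have "c a b * (discr z * g_mono a b z) = c a b * g_mono (a + 3) b z + - 27 * c a b * g_mono a (b + 2) z" for a b
            using True by (simp add: discr_def g_mono_def power_add algebra_simps power2_eq_square)
          then show ?thesis by (simp only: case_prod_unfold sum.distrib)
        qed
        also have "(\<Sum>(a, b)\<in>weight_pairs k'. c a b * g_mono (a + 3) b z) = (\<Sum>(a, b)\<in>weight_pairs k. (if a \<ge> 3 then c (a - 3) b else 0) * g_mono a b z)"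
        proof -
          have "(\<Sum>(a, b)\<in>weight_pairs k'. c a b * g_mono (a + 3) b z) =
              (\<Sum>(a, b)\<in>weight_pairs (k' + 6). if 3 \<le> a \<and> 0 \<le> b then c (a - 3) (b - 0) * g_mono (a - 3 + 3) (b - 0) z else 0)"
            by (rule weight_pairs_shift) simp
          also have "\<dots> = (\<Sum>(a, b)\<in>weight_pairs k. (if a \<ge> 3 then c (a - 3) b else 0) * g_mono a b z)"
            unfolding k by (rule sum.cong) auto
          finally show ?thesis .
        qed
        also have "(\<Sum>(a, b)\<in>weight_pairs k'. - 27 * c a b * g_mono a (b + 2) z) = (\<Sum>(a, b)\<in>weight_pairs k. (if b \<ge> 2 then - 27 * c a (b - 2) else 0) * g_mono a b z)"
        proof -
          have "(\<Sum>(a, b)\<in>weight_pairs k'. - 27 * c a b * g_mono a (b + 2) z) =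
              (\<Sum>(a, b)\<in>weight_pairs (k' + 6). if 0 \<le> a \<and> 2 \<le> b then - 27 * c (a - 0) (b - 2) * g_mono (a - 0) (b - 2 + 2) z else 0)"
            by (rule weight_pairs_shift) simp
          also have "\<dots> = (\<Sum>(a, b)\<in>weight_pairs k. (if b \<ge> 2 then - 27 * c a (b - 2) else 0) * g_mono a b z)"
            unfolding k by (rule sum.cong) (auto simp del: add_2_eq_Suc')
          finally show ?thesis .
        qed
        finally show ?thesis by (simp only: d_def case_prod_unfold sum.distrib[symmetric] distrib_right[symmetric])
      qed
      then show ?thesis by blast
    qed
    then obtain c where c: "\<And>z. h z = (\<Sum>(a, b)\<in>weight_pairs k. c a b * g_mono a b z)" by blast
    define d where "d = (\<lambda>a b. c a b + (if (a, b) = (a0, b0) then t else 0))"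
    have "f z = (\<Sum>(a, b)\<in>weight_pairs k. d a b * g_mono a b z)" for z
    proof -
      have "(\<Sum>(a, b)\<in>weight_pairs k. (if (a, b) = (a0, b0) then t else 0) * g_mono a b z) = (\<Sum>p\<in>weight_pairs k. if p = (a0, b0) then t * g_mono a0 b0 z else 0)"
        by (rule sum.cong) (auto split: if_splits)
      also have "\<dots> = t * g_mono a0 b0 z" using ab by simp
      finally have "(\<Sum>(a, b)\<in>weight_pairs k. d a b * g_mono a b z) = h z + t * g_mono a0 b0 z"
        unfolding c d_def by (simp add: case_prod_unfold distrib_right sum.distrib)
      then show ?thesis by (simp add: h_def)
    qed
    then show ?thesis by blast
  qed
qed

text \<open>At \<rho>, where \<open>g2\<close> vanishes, only a pure power of \<open>g3\<close>
  survives, so its coefficient is 0. All other monomials contain a factor \<open>g2\<close>;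
  cancelling it lowers k by 2.\<close>

lemma g_mono_independent:
  assumes "\<And>z. z \<in> upper_half_plane \<Longrightarrow> (\<Sum>(a, b)\<in>weight_pairs k. c a b * g_mono a b z) = 0"
    and "(a, b) \<in> weight_pairs k"
  shows "c a b = 0"
  using assms
proof (induction k arbitrary: c a b rule: less_induct)
  case (less k)
  obtain \<rho> where \<rho>: "Im \<rho> > 0" "g2 \<rho> = 0" "g3 \<rho> \<noteq> 0" using g2_g3_special(3) by blast
  have zero: "c 0 b = 0" if b: "(0, b) \<in> weight_pairs k" for b
  proof -
    have "0 = (\<Sum>(a, b)\<in>weight_pairs k. c a b * g_mono a b \<rho>)" using less.prems(1)[of \<rho>] \<rho> by (simp add: upper_half_plane_def)
    also have "\<dots> = (\<Sum>p\<in>weight_pairs k. if p = (0, b) then c 0 b * g3 \<rho> ^ b else 0)"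
    proof (rule sum.cong)
      fix p assume p: "p \<in> weight_pairs k"
      obtain a' b' where ab': "p = (a', b')" by (cases p)
      show "(case p of (a, b) \<Rightarrow> c a b * g_mono a b \<rho>) = (if p = (0, b) then c 0 b * g3 \<rho> ^ b else 0)"
        using p b \<rho> by (cases "a' = 0") (auto simp: ab' weight_pairs_def g_mono_def upper_half_plane_def)
    qed simp
    also have "\<dots> = c 0 b * g3 \<rho> ^ b" using b by simp
    finally show ?thesis using \<rho> by simp
  qed
  show ?case
  proof (cases a)
    case 0
    then show ?thesis using zero less.prems(2) by simp
  next
    case (Suc a')
    define k' where "k' = k - 2"
    have k: "k = k' + 2" using less.prems(2) Suc by (auto simp: weight_pairs_def k'_def)
    define F where "F = (\<lambda>z. \<Sum>(a, b)\<in>weight_pairs k'. c (Suc a) b * (g2 z ^ a * g3 z ^ b))"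
    have F: "g2 z * F z = 0" if z: "z \<in> upper_half_plane" for z
    proof -
      have "0 = (\<Sum>(a, b)\<in>weight_pairs k. c a b * g_mono a b z)" using less.prems(1)[OF z] by simp
      also have "\<dots> = (\<Sum>(a, b)\<in>(\<lambda>(a, b). (Suc a, b)) ` weight_pairs k'. c a b * g_mono a b z)"
      proof (rule sum.mono_neutral_right)
        show "(\<lambda>(a, b). (Suc a, b)) ` weight_pairs k' \<subseteq> weight_pairs k" by (auto simp: weight_pairs_def k)
        show "\<forall>p\<in>weight_pairs k - (\<lambda>(a, b). (Suc a, b)) ` weight_pairs k'. (case p of (a, b) \<Rightarrow> c a b * g_mono a b z) = 0"
        proof
          fix p assume p: "p \<in> weight_pairs k - (\<lambda>(a, b). (Suc a, b)) ` weight_pairs k'"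
          obtain a' b' where ab': "p = (a', b')" by (cases p)
          have "a' = 0"
          proof (cases a')
            case (Suc a'')
            then have "(a'', b') \<in> weight_pairs k'" using p ab' k by (auto simp: weight_pairs_def)
            then have "p \<in> (\<lambda>(a, b). (Suc a, b)) ` weight_pairs k'" using ab' Suc by force
            then show ?thesis using p by blast
          qed
          then show "(case p of (a, b) \<Rightarrow> c a b * g_mono a b z) = 0" using zero p ab' by auto
        qed
      qed simp
      also have "\<dots> = (\<Sum>(a, b)\<in>weight_pairs k'. c (Suc a) b * g_mono (Suc a) b z)"
        by (subst sum.reindex) (auto simp: inj_on_def case_prod_unfold)
      also have "\<dots> = g2 z * F z" using z by (simp add: F_def g_mono_def sum_distrib_left case_prod_unfold mult_ac)
      finally show ?thesis by simp
    qed
    have holg: "g2 holomorphic_on upper_half_plane" "g3 holomorphic_on upper_half_plane"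
      unfolding g2_def[abs_def] g3_def[abs_def] upper_half_plane_def by (intro holomorphic_intros eis_sum_holomorphic; simp)+
    have holF: "F holomorphic_on upper_half_plane"
      unfolding F_def case_prod_unfold by (intro holomorphic_intros holg)
    have contg: "continuous_on upper_half_plane g2" using holg(1) holomorphic_on_imp_continuous_on by blast
    \<comment> \<open>\<open>g2\<close> can be cancelled only where it is nonzero. This set is open
      and nonempty, and the identity theorem extends the vanishing of \<open>F\<close> to the
      half-plane.\<close>
    define U where "U = {z \<in> upper_half_plane. g2 z \<noteq> 0}"
    have "U = upper_half_plane \<inter> g2 -` (- {0})" by (auto simp: U_def)
    then have "open U" using continuous_open_preimage[OF contg open_upper_half_plane, of "- {0}"] by (simp add: open_Compl)
    moreover have "\<i> \<in> U" using g2_g3_special(2) by (simp add: U_def upper_half_plane_def)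
    then have "U \<noteq> {}" by blast
    ultimately have "F z = 0" if "z \<in> upper_half_plane" for z
      using analytic_continuation_open[OF _ open_upper_half_plane _ connected_upper_half_plane _ holF holomorphic_on_const, of U 0 z] F that
      by (auto simp: U_def)
    then have "(\<Sum>(a, b)\<in>weight_pairs k'. c (Suc a) b * g_mono a b z) = 0" if "z \<in> upper_half_plane" for z
      using that by (simp add: F_def g_mono_def)
    moreover have "(a', b) \<in> weight_pairs k'" using less.prems(2) Suc k by (auto simp: weight_pairs_def)
    ultimately have "c (Suc a') b = 0" using less.IH[of k' "\<lambda>a. c (Suc a)" a' b] k by auto
    then show ?thesis using Suc by simp
  qed
qed

subsection \<open>The Hecke operator on monomials\<close>

lemma nome_double: "nome (2 * z) = nome z ^ 2"
  by (simp add: nome_def exp_double[symmetric] algebra_simps)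

lemma nome_half: "nome (z / 2) ^ 2 = nome z" "nome ((z + 1) / 2) = - nome (z / 2)"
proof -
  show "nome (z / 2) ^ 2 = nome z" using nome_double[of "z / 2"] by simp
  have "2 * of_real pi * \<i> * ((z + 1) / 2) = 2 * of_real pi * \<i> * (z / 2) + of_real pi * \<i>"
    by (simp add: field_simps)
  then have "nome ((z + 1) / 2) = nome (z / 2) * exp (of_real pi * \<i>)"
    by (simp only: nome_def exp_add)
  then show "nome ((z + 1) / 2) = - nome (z / 2)" by simp
qed

lemma sums_even_part:
  fixes g :: "nat \<Rightarrow> complex"
  assumes "g sums s" "\<And>n. odd n \<Longrightarrow> g n = 0"
  shows "(\<lambda>n. g (2 * n)) sums s"
  using assms by (subst sums_mono_reindex) (auto simp: strict_mono_def elim!: evenE)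

lemma sums_even_expand:
  fixes g :: "nat \<Rightarrow> complex"
  assumes "g sums s"
  shows "(\<lambda>n. if even n then g (n div 2) else 0) sums s"
proof -
  have "(\<lambda>n. (\<lambda>n. if even n then g (n div 2) else 0) (2 * n)) sums s" using assms by simp
  then show ?thesis
    by (subst (asm) sums_mono_reindex) (auto simp: strict_mono_def elim!: evenE)
qed

text \<open>The nomes of z/2 and (z + 1)/2 are the two opposite square roots of q: adding the two
  values cancels the odd coefficients and doubles the even ones. The value at 2 z supplies the
  coefficients with index n / 2.\<close>

lemma hecke_T2_modular_form:
  assumes f: "f \<in> modular_forms w" and w: "w \<ge> 1"
  shows "z \<in> upper_half_plane \<Longrightarrow> hecke_T2 w f z = (2 ^ w * f (2 * z) + f (z / 2) + f ((z + 1) / 2)) / 2"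
    and "has_q_expansion (hecke_T2 w f) (\<lambda>n. q_coeff f (2 * n) + (if even n then 2 ^ (w - 1) * q_coeff f (n div 2) else 0))"
proof -
  define c where "c = q_coeff f"
  have e: "has_q_expansion f c" unfolding c_def by (rule modular_formsD(3)[OF f])
  have S: "(\<lambda>n. c n * nome z ^ n) sums f z" if "Im z > 0" for z
    using e that by (simp add: has_q_expansion_def upper_half_plane_def nome_def)
  have main: "(\<lambda>n. (c (2 * n) + (if even n then 2 ^ (w - 1) * c (n div 2) else 0)) * nome z ^ n) sums
      ((2 ^ w * f (2 * z) + f (z / 2) + f ((z + 1) / 2)) / 2)" if z: "Im z > 0" for z
  proof -
    define s where "s = nome (z / 2)"
    have s2: "s\<^sup>2 = nome z" by (simp add: s_def nome_half)
    have "(\<lambda>n. c n * s ^ n + c n * (- s) ^ n) sums (f (z / 2) + f ((z + 1) / 2))"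
      using sums_add[OF S[of "z / 2"] S[of "(z + 1) / 2"]] z by (simp add: s_def nome_half)
    then have "(\<lambda>n. c (2 * n) * s ^ (2 * n) + c (2 * n) * (- s) ^ (2 * n)) sums (f (z / 2) + f ((z + 1) / 2))"
      by (rule sums_even_part) (simp add: power_minus_odd)
    moreover have "c (2 * n) * s ^ (2 * n) + c (2 * n) * (- s) ^ (2 * n) = 2 * (c (2 * n) * nome z ^ n)" for n
      by (simp add: power_mult s2)
    ultimately have "(\<lambda>n. 2 * (c (2 * n) * nome z ^ n)) sums (f (z / 2) + f ((z + 1) / 2))"
      by (simp only:)
    then have 1: "(\<lambda>n. c (2 * n) * nome z ^ n) sums ((f (z / 2) + f ((z + 1) / 2)) / 2)"
      using sums_divide[of _ _ 2] by force
    have "(\<lambda>n. 2 ^ (w - 1) * (c n * nome (2 * z) ^ n)) sums (2 ^ (w - 1) * f (2 * z))"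
      by (rule sums_mult) (rule S, use z in simp)
    then have "(\<lambda>n. if even n then 2 ^ (w - 1) * (c (n div 2) * nome (2 * z) ^ (n div 2)) else 0) sums (2 ^ (w - 1) * f (2 * z))"
      by (rule sums_even_expand)
    then have 2: "(\<lambda>n. (if even n then 2 ^ (w - 1) * c (n div 2) else 0) * nome z ^ n) sums (2 ^ (w - 1) * f (2 * z))"
    proof (rule sums_cong[THEN iffD1, rotated])
      fix n show "(if even n then 2 ^ (w - 1) * (c (n div 2) * nome (2 * z) ^ (n div 2)) else 0) =
          (if even n then 2 ^ (w - 1) * c (n div 2) else 0) * nome z ^ n"
        by (auto simp: nome_double power_mult[symmetric])
    qed
    have w2: "(2::complex) ^ w = 2 * 2 ^ (w - 1)" using w by (cases w) auto
    have E: "(2 ^ w * f (2 * z) + f (z / 2) + f ((z + 1) / 2)) / 2 = (f (z / 2) + f ((z + 1) / 2)) / 2 + 2 ^ (w - 1) * f (2 * z)"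
      unfolding w2 by (simp add: field_simps)
    show ?thesis using sums_add[OF 1 2] unfolding E by (simp only: distrib_right)
  qed
  have T: "hecke_T2 w f z = (2 ^ w * f (2 * z) + f (z / 2) + f ((z + 1) / 2)) / 2" if "z \<in> upper_half_plane" for z
    using main[of z, unfolded c_def] that by (simp add: hecke_T2_def upper_half_plane_def nome_def sums_iff)
  show "hecke_T2 w f z = (2 ^ w * f (2 * z) + f (z / 2) + f ((z + 1) / 2)) / 2" if "z \<in> upper_half_plane"
    using T that .
  show "has_q_expansion (hecke_T2 w f) (\<lambda>n. q_coeff f (2 * n) + (if even n then 2 ^ (w - 1) * q_coeff f (n div 2) else 0))"
    unfolding has_q_expansion_def
  proof
    fix z assume z: "z \<in> upper_half_plane"
    show "(\<lambda>n. (q_coeff f (2 * n) + (if even n then 2 ^ (w - 1) * q_coeff f (n div 2) else 0)) *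
        exp (2 * of_real pi * \<i> * z) ^ n) sums hecke_T2 w f z"
      using main[of z, unfolded c_def nome_def] z unfolding T[OF z] by (simp add: upper_half_plane_def)
  qed
qed

text \<open>For the roots of 4 x^3 = G x + H, the power sums have the generating function (12 - G
  t^2) / (4 - G t^2 - H t^3). With X = G t^2, its expansion in H t^3 has (12 - X) / (4 - X)^(b + 1)
  as the coefficient of the b-th power.\<close>

definition pow_sum_fps :: "nat \<Rightarrow> complex fps" where
  "pow_sum_fps b = (12 - fps_X) * inverse (4 - fps_X) ^ (b + 1)"

lemma four_minus_X: "inverse (4 - fps_X :: complex fps) * (4 - fps_X) = 1"
  by (rule inverse_mult_eq_1) (simp add: fps_numeral_nth)

lemma pow_sum_fps_rec:
  "(4 - fps_X) * pow_sum_fps (Suc b) = pow_sum_fps b" "(4 - fps_X) * pow_sum_fps 0 = 12 - fps_X"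
proof -
  have "(4 - fps_X) * pow_sum_fps (Suc b) = (inverse (4 - fps_X) * (4 - fps_X)) * pow_sum_fps b"
    by (simp add: pow_sum_fps_def mult_ac)
  then show "(4 - fps_X) * pow_sum_fps (Suc b) = pow_sum_fps b" by (simp add: four_minus_X)
  have "(4 - fps_X) * pow_sum_fps 0 = (inverse (4 - fps_X) * (4 - fps_X)) * (12 - fps_X)"
    by (simp add: pow_sum_fps_def mult_ac)
  then show "(4 - fps_X) * pow_sum_fps 0 = 12 - fps_X" by (simp add: four_minus_X)
qed

lemma fps_nth_numeral_minus_X:
  "((of_nat c - fps_X) * h) $ n = of_nat c * h $ n - (if n = 0 then 0 else (h :: complex fps) $ (n - 1))"
  by (simp add: left_diff_distrib fps_of_nat[symmetric] del: fps_of_nat)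

lemma pow_sum_coeff_rec:
  "4 * pow_sum_fps (Suc b) $ a = (if a = 0 then 0 else pow_sum_fps (Suc b) $ (a - 1)) + pow_sum_fps b $ a"
  "pow_sum_fps 0 $ 0 = 3" "pow_sum_fps 0 $ 1 = 1 / 2" "a \<ge> 2 \<Longrightarrow> 4 * pow_sum_fps 0 $ a = pow_sum_fps 0 $ (a - 1)"
proof -
  have 4: "((4 - fps_X) * h) $ n = 4 * h $ n - (if n = 0 then 0 else (h :: complex fps) $ (n - 1))" for h n
    using fps_nth_numeral_minus_X[of 4 h n] by simp
  show "4 * pow_sum_fps (Suc b) $ a = (if a = 0 then 0 else pow_sum_fps (Suc b) $ (a - 1)) + pow_sum_fps b $ a"
    using 4[of "pow_sum_fps (Suc b)" a] by (simp add: pow_sum_fps_rec(1))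
  have z: "4 * pow_sum_fps 0 $ n = (if n = 0 then 0 else pow_sum_fps 0 $ (n - 1)) + (12 - fps_X) $ n" for n
    using 4[of "pow_sum_fps 0" n] by (simp add: pow_sum_fps_rec(2))
  show 0: "pow_sum_fps 0 $ 0 = 3" using z[of 0] by (simp add: fps_numeral_nth)
  show "pow_sum_fps 0 $ 1 = 1 / 2" using z[of 1] 0 by (simp add: fps_numeral_nth eq_divide_eq mult.commute)
  show "a \<ge> 2 \<Longrightarrow> 4 * pow_sum_fps 0 $ a = pow_sum_fps 0 $ (a - 1)" using z[of a] by (simp add: fps_numeral_nth)
qed

text \<open>The equation 4 e^3 = G e + H gives 4 p (m + 3) = G p (m + 1) + H p m for the power sums
  p, and the coefficients of \<open>pow_sum_fps\<close> obey the matching recurrence.\<close>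

lemma power_sum_expansion:
  fixes e :: "nat \<Rightarrow> complex"
  assumes e: "e 0 + e 1 + e 2 = 0" "G = - 4 * (e 0 * e 1 + e 0 * e 2 + e 1 * e 2)" "H = 4 * e 0 * e 1 * e 2"
  shows "e 0 ^ n + e 1 ^ n + e 2 ^ n = (\<Sum>(a, b)\<in>weight_pairs n. pow_sum_fps b $ a * (G ^ a * H ^ b))"
proof (induction n rule: less_induct)
  case (less n)
  have wp: "weight_pairs 0 = {(0, 0)}" "weight_pairs 1 = {}" "weight_pairs 2 = {(1, 0)}"
    by (auto simp: weight_pairs_def) presburger+
  have e2: "e 2 = - e 0 - e 1" using e(1) by (simp add: eq_neg_iff_add_eq_0 algebra_simps)
  consider "n = 0" | "n = 1" | "n = 2" | m where "n = m + 3" by (metis One_nat_def Suc_1 add.commute less_Suc0 less_antisym less_Suc_eq le_Suc_ex not_less numeral_3_eq_3)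
  then show ?case
  proof cases
    case 1 then show ?thesis using wp pow_sum_coeff_rec(2) by simp
  next
    case 2 then show ?thesis using wp e(1) by simp
  next
    case 3
    have "e 0 ^ 2 + e 1 ^ 2 + e 2 ^ 2 = 1 / 2 * G" unfolding e(2) e2 by (simp add: power2_eq_square algebra_simps)
    moreover have "(\<Sum>(a, b)\<in>weight_pairs 2. pow_sum_fps b $ a * (G ^ a * H ^ b)) = 1 / 2 * G"
      using pow_sum_coeff_rec(3) by (simp add: wp)
    ultimately show ?thesis by (simp only: 3)
  next
    case (4 m)
    have c: "4 * e i ^ (m + 3) = G * e i ^ (m + 1) + H * e i ^ m" if "i \<in> {0, 1, 2}" for i
    proof -
      have "4 * e i ^ 3 = G * e i + H"
        using that unfolding e(2,3) by (auto simp: e2 power3_eq_cube algebra_simps)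
      then have "(4 * e i ^ 3) * e i ^ m = (G * e i + H) * e i ^ m" by simp
      then show ?thesis by (simp add: algebra_simps power_add)
    qed
    have "4 * (e 0 ^ n + e 1 ^ n + e 2 ^ n) = G * (e 0 ^ (m + 1) + e 1 ^ (m + 1) + e 2 ^ (m + 1)) + H * (e 0 ^ m + e 1 ^ m + e 2 ^ m)"
      using c[of 0] c[of 1] c[of 2] 4 by (simp add: algebra_simps)
    also have "\<dots> = (\<Sum>(a, b)\<in>weight_pairs (m + 1). pow_sum_fps b $ a * (G ^ (a + 1) * H ^ b)) + (\<Sum>(a, b)\<in>weight_pairs m. pow_sum_fps b $ a * (G ^ a * H ^ (b + 1)))"
      using less.IH[of "m + 1"] less.IH[of m] 4 by (simp add: sum_distrib_left case_prod_unfold mult_ac)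
    also have "(\<Sum>(a, b)\<in>weight_pairs (m + 1). pow_sum_fps b $ a * (G ^ (a + 1) * H ^ b)) =
        (\<Sum>(a, b)\<in>weight_pairs (m + 1 + 2). if 1 \<le> a \<and> 0 \<le> b then pow_sum_fps (b - 0) $ (a - 1) * (G ^ (a - 1 + 1) * H ^ (b - 0)) else 0)"
      by (rule weight_pairs_shift) simp
    also have "(\<Sum>(a, b)\<in>weight_pairs m. pow_sum_fps b $ a * (G ^ a * H ^ (b + 1))) =
        (\<Sum>(a, b)\<in>weight_pairs (m + 3). if 0 \<le> a \<and> 1 \<le> b then pow_sum_fps (b - 1) $ (a - 0) * (G ^ (a - 0) * H ^ (b - 1 + 1)) else 0)"
      by (rule weight_pairs_shift) simp
    also have "m + 1 + 2 = n" using 4 by simp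
    also have "m + 3 = n" using 4 by simp
    also have "(\<Sum>(a, b)\<in>weight_pairs n. if 1 \<le> a \<and> 0 \<le> b then pow_sum_fps (b - 0) $ (a - 1) * (G ^ (a - 1 + 1) * H ^ (b - 0)) else 0)
        + (\<Sum>(a, b)\<in>weight_pairs n. if 0 \<le> a \<and> 1 \<le> b then pow_sum_fps (b - 1) $ (a - 0) * (G ^ (a - 0) * H ^ (b - 1 + 1)) else 0)
        = (\<Sum>(a, b)\<in>weight_pairs n. 4 * (pow_sum_fps b $ a * (G ^ a * H ^ b)))"
      unfolding sum.distrib[symmetric]
    proof (rule sum.cong)
      fix p assume p: "p \<in> weight_pairs n"
      obtain a b where ab: "p = (a, b)" by (cases p)
      have w: "2 * a + 3 * b = m + 3" using p 4 by (simp add: weight_pairs_def ab)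
      have r: "4 * pow_sum_fps b $ a = (if 1 \<le> a then pow_sum_fps b $ (a - 1) else 0) + (if 1 \<le> b then pow_sum_fps (b - 1) $ a else 0)"
      proof (cases b)
        case 0
        \<comment> \<open>For b = 0 the recurrence holds only from a = 2 on, and the total weight m
          + 3 guarantees this.\<close>
        then have "a \<ge> 2" using w by simp
        then show ?thesis using pow_sum_coeff_rec(4)[of a] 0 by simp
      next
        case (Suc b')
        then show ?thesis using pow_sum_coeff_rec(1)[of b' a] by (cases a) auto
      qed
      have "(if 1 \<le> a then pow_sum_fps b $ (a - 1) * (G ^ (a - 1 + 1) * H ^ b) else 0) = (if 1 \<le> a then pow_sum_fps b $ (a - 1) else 0) * (G ^ a * H ^ b)"
        by (cases a) auto
      moreover have "(if 1 \<le> b then pow_sum_fps (b - 1) $ a * (G ^ a * H ^ (b - 1 + 1)) else 0) = (if 1 \<le> b then pow_sum_fps (b - 1) $ a else 0) * (G ^ a * H ^ b)"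
        by (cases b) auto
      ultimately show "(case p of (a, b) \<Rightarrow> if 1 \<le> a \<and> 0 \<le> b then pow_sum_fps (b - 0) $ (a - 1) * (G ^ (a - 1 + 1) * H ^ (b - 0)) else 0) +
          (case p of (a, b) \<Rightarrow> if 0 \<le> a \<and> 1 \<le> b then pow_sum_fps (b - 1) $ (a - 0) * (G ^ (a - 0) * H ^ (b - 1 + 1)) else 0) =
          (case p of (a, b) \<Rightarrow> 4 * (pow_sum_fps b $ a * (G ^ a * H ^ b)))"
        using r by (simp add: ab distrib_right[symmetric] mult.assoc[symmetric])
    qed simp
    also have "\<dots> = 4 * (\<Sum>(a, b)\<in>weight_pairs n. pow_sum_fps b $ a * (G ^ a * H ^ b))"
      by (simp add: sum_distrib_left case_prod_unfold)
    finally show ?thesis by (subst (asm) mult_cancel_left) simp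
  qed
qed

text \<open>\<open>homog M n q\<close> is the homogenization \<open>e ^ n * q (g / e\<^sup>2)\<close>, written without division because
  \<open>e\<close> may vanish.\<close>

definition homog :: "nat \<Rightarrow> complex \<Rightarrow> complex \<Rightarrow> nat \<Rightarrow> complex poly \<Rightarrow> complex" where
  "homog M g e n q = (\<Sum>s\<le>M. coeff q s * g ^ s * e ^ (n - 2 * s))"

text \<open>The two bounds on the degree ensure that neither the truncated subtraction in the
  exponent n - 2 s nor the cutoff at \<open>M\<close> affects a nonzero coefficient.\<close>

lemma homog_mult_linear:
  assumes "2 * degree q \<le> n" "degree q < M"
  shows "homog M g e (n + 2) ([:\<alpha>, \<beta>:] * q) = (\<alpha> * e\<^sup>2 + \<beta> * g) * homog M g e n q"
proof -
  have z: "coeff q s = 0" if "2 * s > n \<or> s \<ge> M" for s using that assms by (intro coeff_eq_0) auto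
  have 1: "coeff q s * g ^ s * e ^ (n + 2 - 2 * s) = e\<^sup>2 * (coeff q s * g ^ s * e ^ (n - 2 * s))" for s
  proof (cases "2 * s > n")
    case False
    then have "n + 2 - 2 * s = 2 + (n - 2 * s)" by simp
    then show ?thesis by (simp only: power_add) (simp add: mult_ac)
  qed (use z in simp)
  have "homog M g e (n + 2) ([:\<alpha>, \<beta>:] * q) = (\<Sum>s\<le>M. \<alpha> * (coeff q s * g ^ s * e ^ (n + 2 - 2 * s)) + \<beta> * ((if s = 0 then 0 else coeff q (s - 1)) * g ^ s * e ^ (n + 2 - 2 * s)))"
    unfolding homog_def by (rule sum.cong) (auto simp: coeff_pCons algebra_simps split: nat.splits)
  also have "\<dots> = \<alpha> * (\<Sum>s\<le>M. coeff q s * g ^ s * e ^ (n + 2 - 2 * s)) + \<beta> * (\<Sum>s\<le>M. (if s = 0 then 0 else coeff q (s - 1)) * g ^ s * e ^ (n + 2 - 2 * s))"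
    by (simp add: sum.distrib sum_distrib_left)
  also have "(\<Sum>s\<le>M. coeff q s * g ^ s * e ^ (n + 2 - 2 * s)) = e\<^sup>2 * homog M g e n q"
    unfolding homog_def sum_distrib_left by (rule sum.cong[OF refl 1])
  also have "(\<Sum>s\<le>M. (if s = 0 then 0 else coeff q (s - 1)) * g ^ s * e ^ (n + 2 - 2 * s)) = (\<Sum>s<M. coeff q s * g ^ Suc s * e ^ (n - 2 * s))"
    unfolding lessThan_Suc_atMost[symmetric] sum.lessThan_Suc_shift by simp
  also have "\<dots> = g * homog M g e n q"
    unfolding homog_def lessThan_Suc_atMost[symmetric] using z[of M] by (simp add: sum_distrib_left mult_ac)
  finally show ?thesis by (simp add: algebra_simps)
qed

lemma homog_Suc:
  assumes "2 * degree q \<le> n"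
  shows "homog M g e (Suc n) q = e * homog M g e n q"
  unfolding homog_def sum_distrib_left
proof (rule sum.cong)
  fix s
  show "coeff q s * g ^ s * e ^ (Suc n - 2 * s) = e * (coeff q s * g ^ s * e ^ (n - 2 * s))"
  proof (cases "2 * s > n")
    case True
    then have "coeff q s = 0" using assms by (intro coeff_eq_0) auto
    then show ?thesis by simp
  next
    case False
    then have "Suc n - 2 * s = Suc (n - 2 * s)" by simp
    then show ?thesis by simp
  qed
qed simp

text \<open>With X = g / e^2, the transformed invariants are 60 e^2 - 4 g = e^2 (60 - 4 X) and 88
  e^3 - 8 g e = e^3 (88 - 8 X).\<close>

definition hecke_poly :: "nat \<Rightarrow> nat \<Rightarrow> complex poly" where
  "hecke_poly a b = [:60, - 4:] ^ a * [:88, - 8:] ^ b"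

lemma degree_hecke_poly: "degree (hecke_poly a b) \<le> a + b"
proof -
  have "degree (hecke_poly a b) \<le> degree ([:60, - 4:] ^ a :: complex poly) + degree ([:88, - 8:] ^ b :: complex poly)"
    unfolding hecke_poly_def by (rule degree_mult_le)
  also have "\<dots> \<le> degree [:60, - 4 :: complex:] * a + degree [:88, - 8 :: complex:] * b"
    by (intro add_mono degree_power_le)
  finally show ?thesis by simp
qed

lemma homog_hecke_poly:
  assumes "M \<ge> a + b"
  shows "homog M g e (2 * a + 3 * b) (hecke_poly a b) = (60 * e\<^sup>2 - 4 * g) ^ a * (88 * e ^ 3 - 8 * g * e) ^ b"
  using assms
proof (induction a)
  case 0
  then show ?case
  proof (induction b)
    case 0
    then show ?case
      unfolding homog_def hecke_poly_def by (simp add: sum.atMost_shift)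
  next
    case (Suc b)
    have d: "degree (hecke_poly 0 b) \<le> b" using degree_hecke_poly[of 0 b] by simp
    have d': "degree (hecke_poly 0 (Suc b)) \<le> Suc b" using degree_hecke_poly[of 0 "Suc b"] by simp
    have q: "hecke_poly 0 (Suc b) = [:88, - 8:] * hecke_poly 0 b" by (simp only: hecke_poly_def power_Suc power_0 mult_1)
    have "2 * 0 + 3 * Suc b = Suc (3 * b + 2)" by simp
    then have "homog M g e (2 * 0 + 3 * Suc b) (hecke_poly 0 (Suc b)) = homog M g e (Suc (3 * b + 2)) (hecke_poly 0 (Suc b))"
      by (simp only:)
    also have "\<dots> = e * homog M g e (3 * b + 2) (hecke_poly 0 (Suc b))"
      using d' by (intro homog_Suc) simp
    also have "homog M g e (3 * b + 2) (hecke_poly 0 (Suc b)) = (88 * e\<^sup>2 + (- 8) * g) * homog M g e (3 * b) (hecke_poly 0 b)"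
      unfolding q using d Suc.prems by (intro homog_mult_linear) auto
    also have "homog M g e (3 * b) (hecke_poly 0 b) = (88 * e ^ 3 - 8 * g * e) ^ b" using Suc by simp
    finally show ?case by (simp add: algebra_simps power2_eq_square power3_eq_cube)
  qed
next
  case (Suc a)
  have q: "hecke_poly (Suc a) b = [:60, - 4:] * hecke_poly a b" by (simp only: hecke_poly_def power_Suc mult.assoc)
  have "homog M g e (2 * Suc a + 3 * b) (hecke_poly (Suc a) b) = homog M g e (2 * a + 3 * b + 2) (hecke_poly (Suc a) b)" by simp
  also have "\<dots> = (60 * e\<^sup>2 + (- 4) * g) * homog M g e (2 * a + 3 * b) (hecke_poly a b)"
    unfolding q using degree_hecke_poly[of a b] Suc.prems by (intro homog_mult_linear) auto
  also have "homog M g e (2 * a + 3 * b) (hecke_poly a b) = (60 * e\<^sup>2 - 4 * g) ^ a * (88 * e ^ 3 - 8 * g * e) ^ b"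
    using Suc by simp
  finally show ?case by (simp add: algebra_simps)
qed

text \<open>The coefficient of \<open>g_mono a' b'\<close> in the image of
  \<open>g_mono a b\<close>. The term X^s of \<open>hecke_poly\<close> contributes g2^s times the
  power sum of exponent k - 2 s, so the sum over s is a convolution; 1/2 is the factor of the
  three-lattice formula.\<close>

definition hecke_coeff :: "nat \<Rightarrow> nat \<Rightarrow> nat \<Rightarrow> nat \<Rightarrow> complex" where
  "hecke_coeff a b a' b' = (fps_of_poly (hecke_poly a b) * pow_sum_fps b') $ a' / 2"

lemma hecke_T2_g_mono:
  assumes k: "2 * a + 3 * b = k" "k \<ge> 1"
  shows "hecke_T2 (2 * k) (g_mono a b) z = (\<Sum>(a', b')\<in>weight_pairs k. hecke_coeff a b a' b' * g_mono a' b' z)"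
proof (cases "z \<in> upper_half_plane")
  case False
  then show ?thesis by (simp add: hecke_T2_def g_mono_def case_prod_unfold)
next
  case True
  then have z: "Im z > 0" by (simp add: upper_half_plane_def)
  define e where "e = (\<lambda>i. half_wp i z)"
  define G H where "G = g2 z" and "H = g3 z"
  have w: "4 * a + 6 * b = 2 * k" using k by simp
  have m: "g_mono a b \<in> modular_forms (2 * k)" using g_mono_modular[of a b] by (simp only: w)
  have up: "2 * z \<in> upper_half_plane" "z / 2 \<in> upper_half_plane" "(z + 1) / 2 \<in> upper_half_plane"
    using z by (simp_all add: upper_half_plane_def)
  define Q where "Q = (\<lambda>e::complex. (60 * e\<^sup>2 - 4 * G) ^ a * (88 * e ^ 3 - 8 * G * e) ^ b)"
  have "2 ^ (2 * k) * (g2 (2 * z) ^ a * g3 (2 * z) ^ b) = (2 ^ 4 * g2 (2 * z)) ^ a * (2 ^ 6 * g3 (2 * z)) ^ b"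
  proof -
    have "(2::complex) ^ (2 * k) = (2 ^ 4) ^ a * (2 ^ 6) ^ b"
      unfolding w[symmetric] by (simp only: power_add power_mult)
    then show ?thesis by (simp only: power_mult_distrib mult_ac)
  qed
  also have "\<dots> = Q (e 0)" unfolding g2_g3_superlattices[OF z] by (simp add: Q_def e_def G_def)
  finally have q0: "2 ^ (2 * k) * g_mono a b (2 * z) = Q (e 0)" using up by (simp add: g_mono_def)
  have q1: "g_mono a b (z / 2) = Q (e 1)" "g_mono a b ((z + 1) / 2) = Q (e 2)"
    using up by (simp_all add: g_mono_def g2_g3_superlattices[OF z] Q_def e_def G_def)
  have T: "hecke_T2 (2 * k) (g_mono a b) z = (Q (e 0) + Q (e 1) + Q (e 2)) / 2"
    using hecke_T2_modular_form(1)[OF m _ True] k by (simp add: q0 q1)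
  have QQ: "Q x = (\<Sum>s\<le>k. coeff (hecke_poly a b) s * G ^ s * x ^ (k - 2 * s))" for x
    using homog_hecke_poly[of a b k G x] k by (simp add: homog_def Q_def)
  have "Q (e 0) + Q (e 1) + Q (e 2) = (\<Sum>s\<le>k. coeff (hecke_poly a b) s * G ^ s * (e 0 ^ (k - 2 * s) + e 1 ^ (k - 2 * s) + e 2 ^ (k - 2 * s)))"
    unfolding QQ by (simp add: sum.distrib[symmetric] algebra_simps)
  also have "\<dots> = (\<Sum>s\<le>k. \<Sum>(a', b')\<in>weight_pairs k. (if s \<le> a' then coeff (hecke_poly a b) s * pow_sum_fps b' $ (a' - s) else 0) * (G ^ a' * H ^ b'))"
  proof (rule sum.cong)
    fix s
    show "coeff (hecke_poly a b) s * G ^ s * (e 0 ^ (k - 2 * s) + e 1 ^ (k - 2 * s) + e 2 ^ (k - 2 * s)) =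
      (\<Sum>(a', b')\<in>weight_pairs k. (if s \<le> a' then coeff (hecke_poly a b) s * pow_sum_fps b' $ (a' - s) else 0) * (G ^ a' * H ^ b'))"
    proof (cases "2 * s \<le> k")
      case False
      \<comment> \<open>Where the exponent k - 2 s would be truncated, the degree a + b of the
        polynomial is already exceeded.\<close>
      have "degree (hecke_poly a b) < s" using False k degree_hecke_poly[of a b] by simp
      then have q0: "coeff (hecke_poly a b) s = 0" by (rule coeff_eq_0)
      show ?thesis unfolding q0 by (simp add: case_prod_unfold, rule sum.neutral, simp)
    next
      case True
      define c where "c = coeff (hecke_poly a b) s"
      have ps: "e 0 ^ n + e 1 ^ n + e 2 ^ n = (\<Sum>(a, b)\<in>weight_pairs n. pow_sum_fps b $ a * (G ^ a * H ^ b))" for n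
        by (rule power_sum_expansion) (use half_wp_props[OF z] in \<open>simp_all add: e_def G_def H_def\<close>)
      have "c * G ^ s * (e 0 ^ (k - 2 * s) + e 1 ^ (k - 2 * s) + e 2 ^ (k - 2 * s)) =
         (\<Sum>(a', b')\<in>weight_pairs (k - 2 * s). c * pow_sum_fps b' $ a' * (G ^ (a' + s) * H ^ b'))"
        unfolding ps by (simp add: sum_distrib_left case_prod_unfold power_add mult_ac)
      also have "\<dots> = (\<Sum>(a', b')\<in>weight_pairs (k - 2 * s + 2 * s). if s \<le> a' \<and> 0 \<le> b' then c * pow_sum_fps (b' - 0) $ (a' - s) * (G ^ (a' - s + s) * H ^ (b' - 0)) else 0)"
        by (rule weight_pairs_shift) simp
      also have "k - 2 * s + 2 * s = k" using True by simp
      also have "(\<Sum>(a', b')\<in>weight_pairs k. if s \<le> a' \<and> 0 \<le> b' then c * pow_sum_fps (b' - 0) $ (a' - s) * (G ^ (a' - s + s) * H ^ (b' - 0)) else 0) =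
        (\<Sum>(a', b')\<in>weight_pairs k. (if s \<le> a' then c * pow_sum_fps b' $ (a' - s) else 0) * (G ^ a' * H ^ b'))"
        by (rule sum.cong) auto
      finally show ?thesis unfolding c_def .
    qed
  qed simp
  also have "\<dots> = (\<Sum>(a', b')\<in>weight_pairs k. (\<Sum>s\<le>k. if s \<le> a' then coeff (hecke_poly a b) s * pow_sum_fps b' $ (a' - s) else 0) * (G ^ a' * H ^ b'))"
    by (subst sum.swap) (simp add: case_prod_unfold sum_distrib_right)
  also have "\<dots> = (\<Sum>(a', b')\<in>weight_pairs k. 2 * hecke_coeff a b a' b' * g_mono a' b' z)"
  proof (rule sum.cong)
    fix p assume p: "p \<in> weight_pairs k"
    obtain a' b' where ab: "p = (a', b')" by (cases p)
    have le: "a' \<le> k" using p by (auto simp: ab weight_pairs_def)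
    have "(\<Sum>s\<le>k. if s \<le> a' then coeff (hecke_poly a b) s * pow_sum_fps b' $ (a' - s) else 0) = (\<Sum>s\<in>{0..a'}. coeff (hecke_poly a b) s * pow_sum_fps b' $ (a' - s))"
      by (rule sum.mono_neutral_cong_right) (use le in auto)
    also have "\<dots> = 2 * hecke_coeff a b a' b'" by (simp add: hecke_coeff_def fps_mult_nth)
    finally show "(case p of (a', b') \<Rightarrow> (\<Sum>s\<le>k. if s \<le> a' then coeff (hecke_poly a b) s * pow_sum_fps b' $ (a' - s) else 0) * (G ^ a' * H ^ b')) =
        (case p of (a', b') \<Rightarrow> 2 * hecke_coeff a b a' b' * g_mono a' b' z)"
      using True by (simp add: ab g_mono_def G_def H_def)
  qed simp
  also have "\<dots> = 2 * (\<Sum>(a', b')\<in>weight_pairs k. hecke_coeff a b a' b' * g_mono a' b' z)"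
    by (simp add: sum_distrib_left case_prod_unfold mult_ac)
  finally show ?thesis by (simp add: T)
qed

subsection \<open>Arithmetic of the trace\<close>

text \<open>With \<alpha> and \<beta> the roots of x^2 - x + 2, these are (\<alpha>^n - \<beta>^n) /
  (\<alpha> - \<beta>) for \<open>lucU\<close> and \<alpha>^n + \<beta>^n for \<open>lucV\<close>;
  the discriminant is -7.\<close>

fun lucU :: "nat \<Rightarrow> int" where
  "lucU 0 = 0" | "lucU (Suc 0) = 1" | "lucU (Suc (Suc n)) = lucU (Suc n) - 2 * lucU n"

fun lucV :: "nat \<Rightarrow> int" where
  "lucV 0 = 2" | "lucV (Suc 0) = 1" | "lucV (Suc (Suc n)) = lucV (Suc n) - 2 * lucV n"

text \<open>The shape of the Eichler-Selberg formula for T_2 in weight 2 j + 2: the elements of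
  trace 1 and -1, of discriminant -7, give the Lucas term, those of trace 0, 2 and -2, of
  discriminants -8 and -4, combine to the periodic multiple of 2^j, and the hyperbolic contribution
  is -1.\<close>

definition hecke_tr :: "nat \<Rightarrow> int" where
  "hecke_tr j = - 1 - lucU (2 * j + 1) -
     (if j mod 4 = 0 then 2 ^ j else if j mod 4 = 3 then - (2 ^ j) else 0)"

lemma lucV_eq: "lucV n = 2 * lucU (Suc n) - lucU n"
  by (induction n rule: lucV.induct) auto

lemma lucU_add: "lucU (m + n + 1) = lucU (Suc m) * lucU (Suc n) - 2 * lucU m * lucU n"
proof (induction n arbitrary: m rule: lucU.induct)
  case (3 n)
  have "lucU (m + Suc (Suc n) + 1) = lucU (m + Suc n + 1) - 2 * lucU (m + n + 1)" by simp
  also have "\<dots> = lucU (Suc m) * lucU (Suc (Suc (Suc n))) - 2 * lucU m * lucU (Suc (Suc n))"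
    unfolding 3 by (simp add: algebra_simps)
  finally show ?case .
qed (auto simp: algebra_simps)

lemma lucU_norm: "lucU (Suc n) ^ 2 - lucU (Suc n) * lucU n + 2 * lucU n ^ 2 = 2 ^ n"
  by (induction n) (auto simp: power2_eq_square algebra_simps)

text \<open>The norm of \<alpha>^n = (V + U sqrt(-7)) / 2 is 2^n, as \<alpha> has norm 2.\<close>

lemma lucV_norm: "lucV n ^ 2 + 7 * lucU n ^ 2 = 4 * 2 ^ n"
  using lucU_norm[of n] by (simp add: lucV_eq power2_eq_square algebra_simps)

lemma lucU_shift: "2 * lucU (m + d) = lucU m * lucV d + lucV m * lucU d"
proof -
  have "lucU (m + d) = lucU m * lucU (Suc d) + lucU (Suc m) * lucU d - lucU m * lucU d"
  proof (cases d)
    case 0 then show ?thesis by simp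
  next
    case (Suc d')
    have "lucU (m + d' + 1) = lucU (Suc m) * lucU (Suc d') - 2 * lucU m * lucU d'" by (rule lucU_add)
    then show ?thesis using Suc by (simp add: algebra_simps)
  qed
  then show ?thesis by (simp add: lucV_eq algebra_simps)
qed

lemma lucV_shift: "2 * lucV (m + d) = lucV m * lucV d - 7 * lucU m * lucU d"
proof -
  have "lucU (m + d) = lucU m * lucU (Suc d) + lucU (Suc m) * lucU d - lucU m * lucU d"
    using lucU_shift[of m d] by (simp add: lucV_eq algebra_simps)
  then show ?thesis using lucU_add[of m d] by (simp add: lucV_eq algebra_simps)
qed

lemma lucU_odd: "odd (lucU (Suc n))"
  by (induction n rule: lucU.induct) auto

lemma lucU_nonzero: "n > 0 \<Longrightarrow> lucU n \<noteq> 0"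
proof (cases n)
  case (Suc k)
  then show ?thesis using lucU_odd[of k] by (metis even_zero)
qed simp

text \<open>As for sin (7 x) / sin x, the quotient is a polynomial in U^2 and 2^n, obtained here
  from the addition formulas with 7 = 3 + 4. Inside the bracket all terms but the last are divisible
  by 7, so the bracket is a unit modulo 7 and exactly one factor 7 is gained.\<close>

lemma lucU_times_7:
  "lucU (7 * n) = 7 * lucU n * (- 49 * lucU n ^ 6 + 49 * lucU n ^ 4 * 2 ^ n - 14 * lucU n ^ 2 * (2 ^ n) ^ 2 + (2 ^ n) ^ 3)"
proof -
  define x y z where "x = lucU n" and "y = lucV n" and "z = (2::int) ^ n"
  have yy: "y * y = 4 * z - 7 * x * x"
    using lucV_norm[of n] by (simp add: x_def y_def z_def power2_eq_square)
  have nn: "n + n = 2 * n" and n3: "n + 2 * n = 3 * n" and n4: "2 * n + 2 * n = 4 * n"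
    and n7: "3 * n + 4 * n = 7 * n" by simp_all
  have u2: "2 * lucU (2 * n) = 2 * x * y" using lucU_shift[of n n] unfolding nn x_def y_def by simp
  have v2: "2 * lucV (2 * n) = y * y - 7 * x * x" using lucV_shift[of n n] unfolding nn x_def y_def by simp
  have U2: "lucU (2 * n) = x * y" using u2 by simp
  have V2: "lucV (2 * n) = 2 * z - 7 * x * x" using v2 yy by simp
  have U4: "lucU (4 * n) = x * y * (2 * z - 7 * x * x)"
    using lucU_shift[of "2 * n" "2 * n"] unfolding n4 U2 V2 by simp
  have "2 * lucV (4 * n) = (2 * z - 7 * x * x)^2 - 7 * x * x * (y * y)"
    using lucV_shift[of "2 * n" "2 * n"] unfolding n4 U2 V2 by (simp add: power2_eq_square)
  then have V4: "lucV (4 * n) = 2 * z ^ 2 - 28 * x ^ 2 * z + 49 * x ^ 4"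
    unfolding yy by (simp add: algebra_simps power2_eq_square power4_eq_xxxx)
  have "2 * lucU (3 * n) = x * (2 * z - 7 * x * x) + y * (x * y)"
    using lucU_shift[of n "2 * n"] unfolding n3 U2 V2 by (simp add: x_def y_def)
  also have "y * (x * y) = x * (y * y)" by simp
  also note yy
  finally have U3: "lucU (3 * n) = x * (3 * z - 7 * x * x)" by (simp add: algebra_simps)
  have "2 * lucV (3 * n) = y * (2 * z - 7 * x * x) - 7 * x * (x * y)"
    using lucV_shift[of n "2 * n"] unfolding n3 U2 V2 by (simp add: x_def y_def)
  then have V3: "lucV (3 * n) = y * (z - 7 * x * x)" by (simp add: algebra_simps)
  have "2 * lucU (7 * n) = lucU (3 * n) * lucV (4 * n) + lucV (3 * n) * lucU (4 * n)"
    using lucU_shift[of "3 * n" "4 * n"] unfolding n7 .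
  also have "\<dots> = x * (3 * z - 7 * x * x) * (2 * z ^ 2 - 28 * x ^ 2 * z + 49 * x ^ 4)
     + (y * y) * x * (z - 7 * x * x) * (2 * z - 7 * x * x)"
    unfolding U3 V4 V3 U4 by (simp add: algebra_simps)
  also have "\<dots> = 2 * (7 * x * (- 49 * x ^ 6 + 49 * x ^ 4 * z - 14 * x ^ 2 * z ^ 2 + z ^ 3))"
    unfolding yy by (simp add: algebra_simps eval_nat_numeral)
  finally show ?thesis by (simp add: x_def y_def z_def)
qed

text \<open>Modulo 7, x^2 - x + 2 is (x - 4)^2, so U n is n 4^(n - 1); as 2 is inverse to 4,
  multiplication by 2^n leaves 2 n.\<close>

lemma lucU_cong_7: "[2 ^ n * lucU n = 2 * int n] (mod 7)"
proof (induction n rule: lucU.induct)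
  case (3 n)
  have "[2 * (2 ^ Suc n * lucU (Suc n)) - 8 * (2 ^ n * lucU n) = 2 * (2 * int (Suc n)) - 1 * (2 * int n)] (mod 7)"
    by (intro cong_diff cong_mult 3) (auto simp: cong_def)
  then show ?case by (simp add: algebra_simps)
qed auto

lemma lucU_dvd_7:
  assumes "7 dvd lucU d" shows "7 dvd d"
proof -
  have "[2 ^ d * lucU d = 0] (mod 7)" using assms by (simp add: cong_0_iff)
  then have "[2 * int d = 0] (mod 7)" using lucU_cong_7[of d] cong_sym cong_trans by blast
  then have "7 dvd 2 * int d" by (simp add: cong_0_iff)
  then show ?thesis by presburger
qed

text \<open>If 7 divides U d, then d = 7 e, and U d is 7 times U e times a unit modulo 7; so one
  factor 7 is removed from both sides at a time.\<close>

lemma lucU_dvd_pow_7: "7 ^ k dvd lucU d \<Longrightarrow> 7 ^ k dvd d"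
proof (induction k arbitrary: d)
  case (Suc k)
  then have "7 dvd lucU d" by (metis dvd_mult_left power_Suc)
  then obtain e where e: "d = 7 * e" using lucU_dvd_7 by blast
  define w where "w = - 49 * lucU e ^ 6 + 49 * lucU e ^ 4 * 2 ^ e - 14 * lucU e ^ 2 * (2 ^ e) ^ 2 + (2 ^ e) ^ 3"
  have "7 * 7 ^ k dvd 7 * (lucU e * w)"
    using Suc.prems lucU_times_7[of e] by (simp add: e w_def mult.assoc)
  then have "7 ^ k dvd lucU e * w" by simp
  moreover have "coprime (7 ^ k) w"
  proof -
    have "coprime (7::int) ((2 ^ e) ^ 3)" by simp
    moreover have "w = (2 ^ e) ^ 3 + 7 * (- 7 * lucU e ^ 6 + 7 * lucU e ^ 4 * 2 ^ e - 2 * lucU e ^ 2 * (2 ^ e) ^ 2)"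
      by (simp add: w_def algebra_simps)
    ultimately have "coprime 7 w" by (metis coprime_iff_gcd_eq_1 gcd_add_mult add.commute mult.commute)
    then show ?thesis by simp
  qed
  ultimately have "7 ^ k dvd lucU e" by (simp add: coprime_dvd_mult_left_iff)
  then show ?case using Suc.IH e by simp
qed simp

text \<open>2^3 = 8 is 1 modulo 7, and every factor 7 of n adds another one: x^7 - 1 is x - 1 times
  a sum of seven powers congruent to 1.\<close>

lemma pow_2_lifting: "3 dvd n \<Longrightarrow> 7 ^ k dvd n \<Longrightarrow> (7::int) ^ (k + 1) dvd 2 ^ n - 1"
proof (induction k arbitrary: n)
  case 0
  then obtain m where "n = 3 * m" by blast
  then have "(2::int) ^ n - 1 = 8 ^ m - 1 ^ m" by (simp add: power_mult)
  then show ?case using power_diff_sumr2[of "8::int" m 1] by simp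
next
  case (Suc k)
  then obtain m where m: "n = 7 * m" by (metis dvd_def dvd_mult_left power_Suc)
  have "3 dvd m" using Suc.prems(1) m by presburger
  moreover have "7 ^ k dvd m" using Suc.prems(2) m by simp
  ultimately have IH: "7 ^ (k + 1) dvd (2::int) ^ m - 1" by (rule Suc.IH)
  define x where "x = (2::int) ^ m"
  have "(7::int) dvd x - 1" using IH unfolding x_def by (metis dvd_mult_left power_Suc Suc_eq_plus1)
  then have "[x = 1] (mod 7)" by (simp add: cong_iff_dvd_diff)
  then have "[(\<Sum>i<7. x ^ i) = (\<Sum>i<(7::nat). 1 ^ i)] (mod 7)" by (intro cong_sum cong_pow)
  then have "7 dvd (\<Sum>i<7. x ^ i)" by (simp add: cong_def dvd_eq_mod_eq_0)
  moreover have "(2::int) ^ n - 1 = (x - 1) * (\<Sum>i<7. x ^ i)"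
    using power_diff_1_eq[of x 7] by (simp add: m x_def power_mult mult.commute)
  moreover have "7 ^ (k + 1) dvd x - 1" using IH by (simp only: x_def)
  ultimately show ?case using mult_dvd_mono[of "7 ^ (k + 1)" "x - 1" 7 "\<Sum>i<7. x ^ i"]
    by (metis Suc_eq_plus1 add.commute power_Suc2)
qed

text \<open>The shift 12 n is divisible by 4, which keeps the factor of 2^j, and by 3, which makes
  2^(12 n) congruent to 1 modulo 7. With k the 7-adic valuation of \<open>lucU d\<close>, equality
  of the traces would make every other term of the addition formula divisible by 7^(k + 1), hence
  also \<open>lucV m * lucU d\<close>; but \<open>lucV m\<close> is prime to 7.\<close>

lemma hecke_tr_cong_neq:
  assumes "n > 0" shows "hecke_tr (j + 12 * n) \<noteq> hecke_tr j"
proof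
  assume eq: "hecke_tr (j + 12 * n) = hecke_tr j"
  \<comment> \<open>The Lucas index is 2 j + 1, so a shift of j by 12 n moves it by 24 n.\<close>
  define d where "d = 24 * n"
  define m where "m = 2 * j + 1"
  have d0: "lucU d \<noteq> 0" using assms by (simp add: lucU_nonzero d_def)
  define k where "k = multiplicity 7 (lucU d)"
  have k1: "7 ^ k dvd lucU d" unfolding k_def by (rule multiplicity_dvd)
  have k2: "\<not> 7 ^ (k + 1) dvd lucU d"
    unfolding k_def using d0 by (subst power_dvd_iff_le_multiplicity) auto
  have kd: "7 ^ k dvd d" using lucU_dvd_pow_7[OF k1] .
  have "coprime (7 ^ k) (2 :: nat)" by simp
  then have kn: "7 ^ k dvd 12 * n" using kd unfolding d_def
    by (metis (no_types) coprime_dvd_mult_right_iff mult.assoc mult_2 numeral_Bit0 mult_numeral_1 numeral_times_numeral semiring_norm(12))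
  have p1: "(7::int) ^ (k + 1) dvd 2 ^ (12 * n) - 1"
    by (rule pow_2_lifting[OF _ kn]) simp
  have p2: "(7::int) ^ (k + 1) dvd 2 ^ d - 1"
    by (rule pow_2_lifting[OF _ kd]) (simp add: d_def)
  have c7: "[lucV d = 2] (mod 7)"
  proof -
    have v: "[lucV (3 * i) = 2] (mod 7)" for i
    proof (induction i)
      case (Suc i)
      have "2 * lucV (3 * i + 3) = - 5 * lucV (3 * i) + 7 * lucU (3 * i)"
        using lucV_shift[of "3 * i" 3] lucV_eq[of 3] by (simp add: eval_nat_numeral)
      moreover have "lucV (3 * Suc i) = lucV (3 * i + 3)" by (rule arg_cong[where f = lucV]) simp
      ultimately show ?case using Suc unfolding cong_iff_dvd_diff by presburger
    qed simp
    show ?thesis using v[of "8 * n"] by (simp add: d_def)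
  qed
  \<comment> \<open>The norm equation, rewritten so that V^2 - 4 factors. Since V + 2 is 4 modulo 7,
    all powers of 7 go to V - 2.\<close>
  have "(lucV d - 2) * (lucV d + 2) = 4 * (2 ^ d - 1) - 7 * lucU d ^ 2"
    using lucV_norm[of d] by (simp add: power2_eq_square algebra_simps)
  moreover have "7 ^ (k + 1) dvd 7 * lucU d ^ 2"
    using k1 by (simp add: power2_eq_square dvd_mult mult_dvd_mono)
  ultimately have "7 ^ (k + 1) dvd (lucV d - 2) * (lucV d + 2)" using p2 by (metis dvd_diff dvd_mult)
  moreover have "coprime (7 ^ (k + 1)) (lucV d + 2)"
  proof -
    have "[lucV d + 2 = 4] (mod 7)" using cong_add[OF c7 cong_refl, of 2] by simp
    then have "[4 = lucV d + 2] (mod 7)" by (rule cong_sym)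
    moreover have "coprime ((2::int) ^ 2) 7" by (subst coprime_power_left_iff) simp
    then have "coprime (4::int) 7" by simp
    ultimately have "coprime (lucV d + 2) 7" by (rule cong_imp_coprime)
    then show ?thesis by (simp add: coprime_commute)
  qed
  ultimately have V2: "7 ^ (k + 1) dvd lucV d - 2" by (simp add: coprime_dvd_mult_left_iff)
  have md: "(j + 12 * n) mod 4 = j mod 4" by presburger
  \<comment> \<open>\<open>e\<close> is the factor \<epsilon>, common to both indices because they
    agree modulo 4.\<close>
  obtain e :: int where e: "\<And>i. i mod 4 = j mod 4 \<Longrightarrow> hecke_tr i = - 1 - lucU (2 * i + 1) - e * 2 ^ i"
  proof -
    have "\<And>i. i mod 4 = j mod 4 \<Longrightarrow> hecke_tr i = - 1 - lucU (2 * i + 1) -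
        (if j mod 4 = 0 then 1 else if j mod 4 = 3 then - 1 else 0) * 2 ^ i"
      unfolding hecke_tr_def by simp
    then show ?thesis by (rule that)
  qed
  have c: "lucU (m + d) - lucU m = - e * 2 ^ j * (2 ^ (12 * n) - 1)"
  proof -
    have "2 * (j + 12 * n) + 1 = m + d" by (simp add: m_def d_def)
    then have "- 1 - lucU (m + d) - e * (2 ^ j * 2 ^ (12 * n)) = - 1 - lucU m - e * 2 ^ j"
      using eq unfolding e[OF md] e[OF refl] by (simp only: m_def power_add)
    then show ?thesis by (simp add: algebra_simps)
  qed
  have "lucV m * lucU d = 2 * (lucU (m + d) - lucU m) - lucU m * (lucV d - 2)"
    using lucU_shift[of m d] by (simp add: algebra_simps)
  then have "7 ^ (k + 1) dvd lucV m * lucU d"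
    unfolding c using p1 V2 by (metis dvd_diff dvd_mult)
  moreover have "coprime (7 ^ (k + 1)) (lucV m)"
  proof -
    have "\<not> 7 dvd lucV m"
    proof
      assume "7 dvd lucV m"
      then have "7 dvd lucV m ^ 2 + 7 * lucU m ^ 2" by (simp add: power2_eq_square)
      then have "(7::int) dvd 2 ^ (m + 2)" by (simp add: lucV_norm power_add)
      moreover have "prime (7::int)" by simp
      ultimately have "(7::int) dvd 2" by (rule prime_dvd_power[rotated])
      then show False by simp
    qed
    then have "coprime 7 (lucV m)" by (simp add: prime_imp_coprime)
    then show ?thesis by simp
  qed
  ultimately show False using k2 by (simp add: coprime_dvd_mult_right_iff)
qed

text \<open>A running computation with the state \<open>lucU (2 * j + 1)\<close>,
  \<open>lucU (2 * j + 3)\<close>, 2^j, all modulo 49408, and j mod 4. The final state is appended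
  to the values so that a return to the initial state can be read off.\<close>

fun tr_table :: "nat \<Rightarrow> int \<Rightarrow> int \<Rightarrow> int \<Rightarrow> nat \<Rightarrow> int list" where
  "tr_table 0 x y p i = [x, y, p]" |
  "tr_table (Suc n) x y p i = (- 1 - x - (if i = 0 then p else if i = 3 then - p else 0)) mod 49408 #
     tr_table n y ((- 3 * y - 4 * x) mod 49408) (2 * p mod 49408) (Suc i mod 4)"

lemma lucU_rec2: "lucU (n + 4) = - 3 * lucU (n + 2) - 4 * lucU n"
  by (simp add: eval_nat_numeral)

lemma tr_mod_cong: "y = - 3 * a - 4 * b \<Longrightarrow> (- 3 * (a mod m) - 4 * (b mod m)) mod m = y mod (m::int)"
  by (metis mod_diff_eq mod_mult_right_eq)

lemma tr_table_eq:
  "tr_table n (lucU (2 * j + 1) mod 49408) (lucU (2 * j + 3) mod 49408) (2 ^ j mod 49408) (j mod 4) =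
     map (\<lambda>i. hecke_tr (j + i) mod 49408) [0..<n] @
       [lucU (2 * (j + n) + 1) mod 49408, lucU (2 * (j + n) + 3) mod 49408, 2 ^ (j + n) mod 49408]"
proof (induction n arbitrary: j)
  case (Suc n)
  have 1: "(- 3 * (lucU (2 * j + 3) mod 49408) - 4 * (lucU (2 * j + 1) mod 49408)) mod 49408 = lucU (2 * Suc j + 3) mod 49408"
    by (rule tr_mod_cong) (use lucU_rec2[of "2 * j + 1"] in \<open>simp add: eval_nat_numeral\<close>)
  have 2: "2 * (2 ^ j mod 49408) mod 49408 = (2::int) ^ Suc j mod 49408"
    by (simp add: mod_simps)
  have 3: "Suc (j mod 4) mod 4 = Suc j mod 4" by (simp add: mod_simps)
  have 4: "lucU (2 * j + 3) = lucU (2 * Suc j + 1)" by (rule arg_cong[where f = lucU]) simp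
  have 5: "(- 1 - lucU (2 * j + 1) mod 49408 - (if j mod 4 = 0 then 2 ^ j mod 49408 else if j mod 4 = 3 then - (2 ^ j mod 49408) else 0)) mod 49408 = hecke_tr j mod 49408"
    unfolding hecke_tr_def by (auto intro!: mod_diff_cong mod_add_cong simp: mod_simps)
  show ?case unfolding tr_table.simps 1 2 3 5 unfolding 4 Suc.IH
    by (simp add: upt_conv_Cons del: upt_Suc) (simp add: map_Suc_upt[symmetric] comp_def del: map_Suc_upt upt_Suc)
qed simp

lemma lucU_odd_values:
  "lucU 3 = -1" "lucU 5 = -1" "lucU 7 = 7" "lucU 9 = -17" "lucU 11 = 23" "lucU 13 = -1"
  "lucU 15 = -89" "lucU 17 = 271" "lucU 19 = -457"
proof -
  show 5: "lucU 3 = -1" "lucU 5 = -1" "lucU 7 = 7" by (simp_all add: eval_nat_numeral)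
  show "lucU 9 = -17" "lucU 11 = 23" "lucU 13 = -1" "lucU 15 = -89" "lucU 17 = 271" "lucU 19 = -457"
    using lucU_rec2[of 5] lucU_rec2[of 7] lucU_rec2[of 9] lucU_rec2[of 11] lucU_rec2[of 13] lucU_rec2[of 15]
    by (simp_all add: 5)
qed

lemma tr_table_8:
  "map (\<lambda>i. hecke_tr (8 + i) mod 49408) [0..<96] @
     [lucU (2 * 104 + 1) mod 49408, lucU (2 * 104 + 3) mod 49408, 2 ^ 104 mod 49408] =
   tr_table 96 271 48951 256 0"
  using tr_table_eq[of 96 8] by (simp add: lucU_odd_values del: tr_table.simps upt_Suc)

text \<open>The start 271, 48951, 256 is the state at j = 8, where \<open>lucU\<close> takes the
  values 271 and -457. Entries 93 and 94 belong to j = 101 and 102, where the values at 5 and 6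
  recur modulo 49408; the value 216 at j = 7 never does.\<close>

lemma tr_table_props:
  "distinct (take 96 (tr_table 96 271 48951 256 0))"
  "drop 96 (tr_table 96 271 48951 256 0) = [271, 48951, 256]"
  "tr_table 96 271 48951 256 0 ! 93 = - 24 mod 49408"
  "tr_table 96 271 48951 256 0 ! 94 = 0"
  "216 \<notin> set (take 96 (tr_table 96 271 48951 256 0))"
  by code_simp+

lemma hecke_tr_table: "map (\<lambda>i. hecke_tr (8 + i) mod 49408) [0..<96] = take 96 (tr_table 96 271 48951 256 0)"
  by (subst tr_table_8[symmetric]) simp

text \<open>After 96 steps the state is the initial one, and the state determines all later values;
  j mod 4 returns as well because 4 divides 96.\<close>

lemma hecke_tr_period:
  assumes "j \<ge> 8" shows "hecke_tr (j + 96 * n) mod 49408 = hecke_tr j mod 49408"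
proof -
  have base: "lucU (2 * 104 + 1) mod 49408 = 271" "lucU (2 * 104 + 3) mod 49408 = 48951"
    "(2::int) ^ 104 mod 49408 = 256"
    using tr_table_props(2) unfolding tr_table_8[symmetric] by simp_all
  have "[lucU (2 * (i + 104) + 1) = lucU (2 * (i + 8) + 1)] (mod 49408) \<and>
        [lucU (2 * (i + 104) + 3) = lucU (2 * (i + 8) + 3)] (mod 49408) \<and>
        [2 ^ (i + 104) = 2 ^ (i + 8)] (mod (49408::int))" for i
  proof (induction i)
    case 0
    show ?case using base by (simp add: cong_def lucU_odd_values)
  next
    case (Suc i)
    have e: "lucU (2 * (Suc i + k) + 3) = - 3 * lucU (2 * (i + k) + 3) - 4 * lucU (2 * (i + k) + 1)"
      "lucU (2 * (Suc i + k) + 1) = lucU (2 * (i + k) + 3)" for k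
    proof -
      have "2 * (Suc i + k) + 3 = (2 * (i + k) + 1) + 4" "2 * (i + k) + 3 = (2 * (i + k) + 1) + 2" by simp_all
      then show "lucU (2 * (Suc i + k) + 3) = - 3 * lucU (2 * (i + k) + 3) - 4 * lucU (2 * (i + k) + 1)"
        by (metis lucU_rec2)
      show "lucU (2 * (Suc i + k) + 1) = lucU (2 * (i + k) + 3)" by (rule arg_cong[where f = lucU]) simp
    qed
    have "[2 * 2 ^ (i + 104) = 2 * 2 ^ (i + 8)] (mod (49408::int))"
      using Suc by (intro cong_mult cong_refl) auto
    moreover have "[- 3 * lucU (2 * (i + 104) + 3) - 4 * lucU (2 * (i + 104) + 1) = - 3 * lucU (2 * (i + 8) + 3) - 4 * lucU (2 * (i + 8) + 1)] (mod 49408)"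
      using Suc by (intro cong_diff cong_mult cong_refl) auto
    moreover have "(2::int) ^ (Suc i + 104) = 2 * 2 ^ (i + 104)" "(2::int) ^ (Suc i + 8) = 2 * 2 ^ (i + 8)" by (simp_all only: power_Suc add_Suc)
    ultimately show ?case using Suc unfolding e by metis
  qed
  then have step: "hecke_tr (i + 104) mod 49408 = hecke_tr (i + 8) mod 49408" for i
  proof -
    have m: "(i + 104) mod 4 = (i + 8) mod 4" by presburger
    assume *: "\<And>i. [lucU (2 * (i + 104) + 1) = lucU (2 * (i + 8) + 1)] (mod 49408) \<and>
        [lucU (2 * (i + 104) + 3) = lucU (2 * (i + 8) + 3)] (mod 49408) \<and>
        [2 ^ (i + 104) = 2 ^ (i + 8)] (mod (49408::int))"
    have "[hecke_tr (i + 104) = hecke_tr (i + 8)] (mod 49408)"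
      unfolding hecke_tr_def m using *[of i]
      by (auto intro!: cong_diff cong_add cong_refl)
    then show ?thesis by (simp add: cong_def)
  qed
  show ?thesis
  proof (induction n)
    case (Suc n)
    have "j + 96 * Suc n = (j + 96 * n - 8) + 104" "j + 96 * n - 8 + 8 = j + 96 * n" using assms by simp_all
    then show ?case using step[of "j + 96 * n - 8"] Suc by metis
  qed simp
qed

lemma hecke_tr_cong_imp:
  assumes "i \<ge> 8" "j \<ge> 8" "hecke_tr i mod 49408 = hecke_tr j mod 49408"
  shows "i mod 96 = j mod 96"
proof -
  define r where "r = (\<lambda>i::nat. (i - 8) mod 96)"
  have r: "hecke_tr i mod 49408 = take 96 (tr_table 96 271 48951 256 0) ! r i" "r i < 96" if "i \<ge> 8" for i
  proof -
    show "r i < 96" by (simp add: r_def)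
    have "i = (8 + r i) + 96 * ((i - 8) div 96)" unfolding r_def using that by simp
    then have "hecke_tr i mod 49408 = hecke_tr (8 + r i) mod 49408"
      using hecke_tr_period[of "8 + r i" "(i - 8) div 96"] by simp
    also have "\<dots> = map (\<lambda>i. hecke_tr (8 + i) mod 49408) [0..<96] ! r i"
      using \<open>r i < 96\<close> by (simp del: upt_Suc)
    finally show "hecke_tr i mod 49408 = take 96 (tr_table 96 271 48951 256 0) ! r i"
      unfolding hecke_tr_table .
  qed
  have "length (take 96 (tr_table 96 271 48951 256 0)) = 96"
    by (subst hecke_tr_table[symmetric]) simp
  then have "r i = r j"
    using assms r nth_eq_iff_index_eq[OF tr_table_props(1)] by metis
  then have "((i - 8) + 8) mod 96 = ((j - 8) + 8) mod 96" unfolding r_def by (rule mod_add_cong) simp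
  then show ?thesis using assms(1,2) by simp
qed

lemma hecke_tr_small:
  "hecke_tr 1 = 0" "hecke_tr 2 = 0" "hecke_tr 3 = 0" "hecke_tr 4 = 0"
  "hecke_tr 5 = - 24" "hecke_tr 6 = 0" "hecke_tr 7 = 216"
  by (simp_all add: hecke_tr_def lucU_odd_values)

text \<open>The indices 5 and 6 precede the periodic range, but 101 and 102 have their values modulo
  49408 and their residues modulo 96, and so replace them; 7 is excluded by its value 216. The
  remaining pairs are congruent modulo 96 = 12 * 8, where the 7-adic argument applies.\<close>

lemma hecke_tr_inj:
  assumes "5 \<le> j" "j < j'" shows "hecke_tr j \<noteq> hecke_tr j'"
proof
  assume eq: "hecke_tr j = hecke_tr j'"
  have t: "hecke_tr (8 + i) mod 49408 = tr_table 96 271 48951 256 0 ! i" if "i < 96" for i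
    using arg_cong[OF hecke_tr_table, of "\<lambda>l. l ! i"] that by (simp del: upt_Suc tr_table.simps)
  have "j mod 96 = j' mod 96"
  proof (cases "j' \<ge> 8")
    case j': True
    consider "j \<ge> 8" | "j = 5" | "j = 6" | "j = 7" using assms by linarith
    then show ?thesis
    proof cases
      case 1 then show ?thesis using hecke_tr_cong_imp[of j j'] j' eq by simp
    next
      case 2
      then have "hecke_tr 101 mod 49408 = hecke_tr j' mod 49408"
        using t[of 93] tr_table_props(3) eq by (simp add: hecke_tr_small del: tr_table.simps)
      then show ?thesis using hecke_tr_cong_imp[of 101 j'] j' 2 by simp
    next
      case 3
      then have "hecke_tr 102 mod 49408 = hecke_tr j' mod 49408"
        using t[of 94] tr_table_props(4) eq by (simp add: hecke_tr_small del: tr_table.simps)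
      then show ?thesis using hecke_tr_cong_imp[of 102 j'] j' 3 by simp
    next
      case 4
      define r where "r = (j' - 8) mod 96"
      have "j' = (8 + r) + 96 * ((j' - 8) div 96)" unfolding r_def using j' by simp
      then have "hecke_tr (8 + r) mod 49408 = 216"
        using hecke_tr_period[of "8 + r" "(j' - 8) div 96"] eq 4 by (simp add: hecke_tr_small)
      moreover have "hecke_tr (8 + r) mod 49408 \<in> set (map (\<lambda>i. hecke_tr (8 + i) mod 49408) [0..<96])"
        unfolding set_map by (rule imageI) (simp add: r_def)
      ultimately show ?thesis unfolding hecke_tr_table using tr_table_props(5) by metis
    qed
  next
    case False
    then consider "j = 5 \<and> j' = 6" | "j = 5 \<and> j' = 7" | "j = 6 \<and> j' = 7" using assms by linarith
    then show ?thesis using eq by cases (auto simp: hecke_tr_small)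
  qed
  then obtain n where n: "j' = j + 96 * n" using assms(2) by (metis less_imp_le mod_eq_nat1E)
  then have "j' = j + 12 * (8 * n)" "8 * n > 0" using assms(2) by auto
  then show False using hecke_tr_cong_neq[of "8 * n" j] eq by simp
qed

subsection \<open>The diagonal coefficients\<close>

text \<open>As 60 - 4 X = 4 (15 - X), the factor of \<open>hecke_poly\<close> that comes from g2^a
  is (15 - X)^a up to a power of two, and a diagonal entry asks for the coefficient of X^a.\<close>

definition diag_coeff :: "nat \<Rightarrow> complex fps \<Rightarrow> complex" where
  "diag_coeff a g = ((15 - fps_X) ^ a * g) $ a"

text \<open>One factor 15 - X is split off after cancelling X. For the generating series over a in a
  variable s, this reads X (1 + s) = 15 s: extraction along the diagonal amounts to the substitution
  X = 15 s / (1 + s).\<close>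

lemma diag_coeff_X: "diag_coeff (Suc a) (fps_X * g) + diag_coeff a (fps_X * g) = 15 * diag_coeff a g"
proof -
  have "(15 - fps_X) ^ Suc a * (fps_X * g) = fps_X * ((15 - fps_X) ^ Suc a * g)" by (simp add: mult_ac)
  then have "diag_coeff (Suc a) (fps_X * g) = ((15 - fps_X) ^ Suc a * g) $ a"
    unfolding diag_coeff_def by (simp only: fps_X_mult_nth) simp
  also have "(15 - fps_X) ^ Suc a * g = 15 * ((15 - fps_X) ^ a * g) - (15 - fps_X) ^ a * (fps_X * g)"
    by (simp add: algebra_simps)
  also have "(15 * ((15 - fps_X) ^ a * g) - (15 - fps_X) ^ a * (fps_X * g)) $ a = 15 * diag_coeff a g - diag_coeff a (fps_X * g)"
    unfolding diag_coeff_def fps_sub_nth by (simp add: numeral_fps_const)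
  finally show ?thesis by simp
qed

lemma diag_coeff_X_0: "diag_coeff 0 (fps_X * g) = 0"
  by (simp add: diag_coeff_def)

lemma diag_coeff_linear: "diag_coeff a ((of_nat c - fps_X) * g) = of_nat c * diag_coeff a g - diag_coeff a (fps_X * g)"
proof -
  have "(15 - fps_X) ^ a * ((of_nat c - fps_X) * g) = of_nat c * ((15 - fps_X) ^ a * g) - (15 - fps_X) ^ a * (fps_X * g)"
    by (simp add: algebra_simps)
  then show ?thesis unfolding diag_coeff_def by (simp add: fps_of_nat[symmetric] del: fps_of_nat)
qed

lemma diag_coeff_1: "diag_coeff a 1 = (- 1) ^ a"
proof -
  have "((15 - fps_X :: complex fps) ^ a) $ n = (if n = a then (- 1) ^ a else 0)" if "n \<ge> a" for n
    using that
  proof (induction a arbitrary: n)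
    case (Suc a)
    then obtain m where n: "n = Suc m" by (cases n) auto
    have "((15 - fps_X :: complex fps) ^ Suc a) $ n = 15 * ((15 - fps_X) ^ a) $ n - ((15 - fps_X) ^ a) $ m"
      by (simp add: n left_diff_distrib numeral_fps_const)
    then show ?case using Suc.IH[of n] Suc.IH[of m] Suc.prems n by auto
  qed auto
  then show ?thesis by (simp add: diag_coeff_def)
qed

definition trace_coeff :: "nat \<Rightarrow> nat \<Rightarrow> complex" where
  "trace_coeff a b = diag_coeff a ((11 - fps_X) ^ b * pow_sum_fps b)"

lemma hecke_coeff_diag: "hecke_coeff a b a b = 2 ^ (2 * a + 3 * b) * trace_coeff a b / 2"
proof -
  have "fps_of_poly [:60, - 4 :: complex:] = fps_const 4 * (15 - fps_X)" "fps_of_poly [:88, - 8 :: complex:] = fps_const 8 * (11 - fps_X)"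
    by (rule fps_ext; simp add: coeff_pCons fps_numeral_nth fps_X_def split: nat.splits)+
  then have eq: "fps_of_poly (hecke_poly a b) * pow_sum_fps b = fps_const (4 ^ a * 8 ^ b) * ((15 - fps_X) ^ a * ((11 - fps_X) ^ b * pow_sum_fps b))"
    by (simp only: hecke_poly_def fps_of_poly_mult fps_of_poly_power power_mult_distrib fps_const_power[symmetric] fps_const_mult[symmetric] mult_ac)
  have "hecke_coeff a b a b = 4 ^ a * 8 ^ b * trace_coeff a b / 2"
    unfolding hecke_coeff_def trace_coeff_def diag_coeff_def eq by (simp only: fps_mult_left_const_nth)
  also have "(4::complex) ^ a * 8 ^ b = 2 ^ (2 * a + 3 * b)" by (simp add: power_add power_mult)
  finally show ?thesis .
qed

text \<open>Passing from b to b + 1 multiplies the series by (11 - X) / (4 - X). At X = 15 s / (1 +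
  s) this ratio is (11 - 4 s) / (4 - 11 s), which is the first relation; at a = 0 one has s = 0 and
  the ratio 11 / 4.\<close>

lemma trace_coeff_rec:
  "4 * trace_coeff (Suc a) (Suc b) - 11 * trace_coeff a (Suc b) - 11 * trace_coeff (Suc a) b + 4 * trace_coeff a b = 0"
  "4 * trace_coeff 0 (Suc b) = 11 * trace_coeff 0 b"
proof -
  define K where "K = (11 - fps_X) ^ b * pow_sum_fps (Suc b)"
  have b1: "trace_coeff a (Suc b) = 11 * diag_coeff a K - diag_coeff a (fps_X * K)" for a
    using diag_coeff_linear[of a 11 K] by (simp add: trace_coeff_def K_def mult_ac)
  have "(11 - fps_X) ^ b * pow_sum_fps b = (4 - fps_X) * K"
    unfolding K_def by (subst pow_sum_fps_rec(1)[symmetric]) (simp add: mult_ac)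
  then have b0: "trace_coeff a b = 4 * diag_coeff a K - diag_coeff a (fps_X * K)" for a
    using diag_coeff_linear[of a 4 K] by (simp add: trace_coeff_def)
  have X: "diag_coeff (Suc a) (fps_X * K) = 15 * diag_coeff a K - diag_coeff a (fps_X * K)"
    using diag_coeff_X[of a K] by (simp add: algebra_simps)
  show "4 * trace_coeff (Suc a) (Suc b) - 11 * trace_coeff a (Suc b) - 11 * trace_coeff (Suc a) b + 4 * trace_coeff a b = 0"
    unfolding b1 b0 X by (simp add: algebra_simps)
  show "4 * trace_coeff 0 (Suc b) = 11 * trace_coeff 0 b"
    unfolding b1 b0 diag_coeff_X_0 by simp
qed

text \<open>The same substitution in (12 - X) / (4 - X). The recurrence is inhomogeneous because the
  diagonal coefficients of 1 are the leading coefficients (-1)^a of (15 - X)^a.\<close>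

lemma trace_coeff_0:
  "trace_coeff 0 0 = 3" "4 * trace_coeff (Suc a) 0 - 11 * trace_coeff a 0 = 15 * (- 1) ^ Suc a"
proof -
  show "trace_coeff 0 0 = 3" by (simp add: trace_coeff_def diag_coeff_def pow_sum_coeff_rec)
  define g where "g = pow_sum_fps 0"
  have P: "trace_coeff a 0 = diag_coeff a g" for a by (simp add: trace_coeff_def g_def)
  have r: "4 * diag_coeff a g - diag_coeff a (fps_X * g) = 12 * (- 1) ^ a - diag_coeff a (fps_X * 1)" for a
    using diag_coeff_linear[of a 4 g] diag_coeff_linear[of a 12 1] pow_sum_fps_rec(2) by (simp add: g_def diag_coeff_1)
  have "4 * diag_coeff (Suc a) g - 11 * diag_coeff a g =
     (4 * diag_coeff (Suc a) g - diag_coeff (Suc a) (fps_X * g)) + (4 * diag_coeff a g - diag_coeff a (fps_X * g))"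
    using diag_coeff_X[of a g] by (simp add: algebra_simps)
  also have "\<dots> = 12 * (- 1) ^ Suc a + 12 * (- 1) ^ a - (diag_coeff (Suc a) (fps_X * 1) + diag_coeff a (fps_X * 1))"
    unfolding r by (simp only: diff_add_eq algebra_simps)
  also have "\<dots> = 15 * (- 1) ^ Suc a"
    unfolding diag_coeff_X diag_coeff_1 by simp
  finally show "4 * trace_coeff (Suc a) 0 - 11 * trace_coeff a 0 = 15 * (- 1) ^ Suc a" by (simp add: P)
qed

definition trace_sum :: "nat \<Rightarrow> complex" where
  "trace_sum k = (\<Sum>(a, b)\<in>weight_pairs k. trace_coeff a b)"

text \<open>The two-index recurrence summed along 2 a + 3 b, so that a step in a counts 2 and a step
  in b counts 3. Only the pure power of \<open>g2\<close>, present for even weight index, leaves an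
  inhomogeneous term.\<close>

lemma trace_sum_rec:
  "4 * trace_sum (m + 5) - 11 * trace_sum (m + 3) - 11 * trace_sum (m + 2) + 4 * trace_sum m =
     (if even (m + 5) then 15 * (- 1) ^ ((m + 5) div 2) else 0)"
proof -
  have 1: "trace_sum (m + 3) = (\<Sum>(a, b)\<in>weight_pairs (m + 5). if 1 \<le> a \<and> 0 \<le> b then trace_coeff (a - 1) (b - 0) else 0)"
  proof -
    have "m + 5 = m + 3 + 2" by simp
    then show ?thesis unfolding trace_sum_def by (simp only: weight_pairs_shift[of 1 0 2 trace_coeff "m + 3"] mult_1_right mult_0_right add_0_right)
  qed
  have 2: "trace_sum (m + 2) = (\<Sum>(a, b)\<in>weight_pairs (m + 5). if 0 \<le> a \<and> 1 \<le> b then trace_coeff (a - 0) (b - 1) else 0)"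
  proof -
    have "m + 5 = m + 2 + 3" by simp
    then show ?thesis unfolding trace_sum_def by (simp only: weight_pairs_shift[of 0 1 3 trace_coeff "m + 2"] mult_1_right mult_0_right add_0)
  qed
  have 3: "trace_sum m = (\<Sum>(a, b)\<in>weight_pairs (m + 5). if 1 \<le> a \<and> 1 \<le> b then trace_coeff (a - 1) (b - 1) else 0)"
    unfolding trace_sum_def using weight_pairs_shift[of 1 1 5 trace_coeff m] by simp
  have "4 * trace_sum (m + 5) - 11 * trace_sum (m + 3) - 11 * trace_sum (m + 2) + 4 * trace_sum m =
    (\<Sum>p\<in>weight_pairs (m + 5). if snd p = 0 then 15 * (- 1) ^ fst p else 0)"
    unfolding 1 2 3 trace_sum_def[of "m + 5"] sum_distrib_left sum_subtractf[symmetric] sum.distrib[symmetric]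
  proof (rule sum.cong)
    fix p assume p: "p \<in> weight_pairs (m + 5)"
    obtain a b where ab: "p = (a, b)" by (cases p)
    have w: "2 * a + 3 * b = m + 5" using p by (simp add: ab weight_pairs_def)
    consider a' where "b = 0" "a = Suc a'" | b' where "a = 0" "b = Suc b'" | a' b' where "a = Suc a'" "b = Suc b'"
      using w by (cases a; cases b) auto
    then show "4 * (case p of (a, b) \<Rightarrow> trace_coeff a b) - 11 * (case p of (a, b) \<Rightarrow> if 1 \<le> a \<and> 0 \<le> b then trace_coeff (a - 1) (b - 0) else 0)
       - 11 * (case p of (a, b) \<Rightarrow> if 0 \<le> a \<and> 1 \<le> b then trace_coeff (a - 0) (b - 1) else 0)
       + 4 * (case p of (a, b) \<Rightarrow> if 1 \<le> a \<and> 1 \<le> b then trace_coeff (a - 1) (b - 1) else 0) =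
       (if snd p = 0 then 15 * (- 1) ^ fst p else 0)"
    proof cases
      case 1 then show ?thesis using trace_coeff_0(2)[of a'] by (simp add: ab)
    next
      case 2 then show ?thesis using trace_coeff_rec(2)[of b'] by (simp add: ab)
    next
      case 3 then show ?thesis using trace_coeff_rec(1)[of a' b'] by (simp add: ab)
    qed
  qed simp
  also have "\<dots> = (if even (m + 5) then 15 * (- 1) ^ ((m + 5) div 2) else 0)"
  proof (cases "even (m + 5)")
    case True
    then have "((m + 5) div 2, 0) \<in> weight_pairs (m + 5)" by (simp add: weight_pairs_def)
    moreover have "(if snd p = 0 then 15 * (- 1) ^ fst p else 0) = (if p = ((m + 5) div 2, 0) then 15 * (- 1) ^ ((m + 5) div 2) else (0::complex))"
      if "p \<in> weight_pairs (m + 5)" for p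
      using that by (cases p) (auto simp: weight_pairs_def)
    ultimately show ?thesis using True by (simp cong: sum.cong)
  next
    case False
    have "snd p \<noteq> 0" if "p \<in> weight_pairs (m + 5)" for p
      using that False by (cases p) (auto simp: weight_pairs_def, presburger)
    then have "(\<Sum>p\<in>weight_pairs (m + 5). if snd p = 0 then 15 * (- 1) ^ fst p else (0::complex)) = 0"
      by (intro sum.neutral) auto
    then show ?thesis using False by simp
  qed
  finally show ?thesis .
qed

text \<open>The characteristic polynomial X^5 - 11 X^3 - 22 X^2 + 32 is (X - 4) (X - 1) (X + 2) (X^2
  + 3 X + 4): it annihilates 4^j, the constants and the Lucas terms of odd index. What remains is a
  check on the multiple of 2^j for each residue modulo 4.\<close>

lemma hecke_tr_rec:
  defines "s \<equiv> \<lambda>j. 4 ^ (j + 1) + 2 * hecke_tr j + 2"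
  shows "s (j + 5) = 11 * s (j + 3) + 22 * s (j + 2) - 32 * s j + (if even j then 15 * (- 1) ^ ((j + 6) div 2) * 2 ^ (j + 4) else 0)"
proof -
  define b where "b = (\<lambda>i. lucU (2 * (j + i) + 1))"
  have r: "b (i + 2) = - 3 * b (i + 1) - 4 * b i" for i
  proof -
    have "2 * (j + (i + 2)) + 1 = (2 * (j + i) + 1) + 4" "2 * (j + (i + 1)) + 1 = (2 * (j + i) + 1) + 2" by simp_all
    then show ?thesis unfolding b_def by (metis lucU_rec2)
  qed
  have b: "b 2 = - 3 * b 1 - 4 * b 0" "b 3 = - 3 * b 2 - 4 * b 1" "b 4 = - 3 * b 3 - 4 * b 2" "b 5 = - 3 * b 4 - 4 * b 3"
    using r[of 0] r[of 1] r[of 2] r[of 3] by (simp_all add: eval_nat_numeral)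
  have bb: "b 5 = 11 * b 3 + 22 * b 2 - 32 * b 0" using b by simp
  define d where "d = (\<lambda>i. (if (j + i) mod 4 = 0 then 2 ^ (j + i) else if (j + i) mod 4 = 3 then - (2 ^ (j + i)) else 0) :: int)"
  have s: "s (j + i) = 4 ^ (j + i + 1) - 2 * b i - 2 * d i" for i
    unfolding s_def hecke_tr_def b_def d_def by simp
  have dd: "- 2 * d 5 = - 22 * d 3 - 44 * d 2 + 64 * d 0 + (if even j then 15 * (- 1) ^ ((j + 6) div 2) * 2 ^ (j + 4) else 0)"
  proof -
    obtain q r where q: "j = 4 * q + r" "r < 4" by (metis mod_less_divisor mult_div_mod_eq zero_less_numeral)
    then consider "r = 0" | "r = 1" | "r = 2" | "r = 3" by linarith
    then show ?thesis
    proof cases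
      case 1
      have m: "(j + 0) mod 4 = 0" "(j + 2) mod 4 = 2" "(j + 3) mod 4 = 3" "(j + 5) mod 4 = 1" "even j" "(j + 6) div 2 = 2 * q + 3"
        using q 1 by presburger+
      show ?thesis unfolding d_def m(1-4,6) using m(5) by (simp add: power_add power_mult)
    next
      case 2
      have m: "(j + 0) mod 4 = 1" "(j + 2) mod 4 = 3" "(j + 3) mod 4 = 0" "(j + 5) mod 4 = 2" "odd j"
        using q 2 by presburger+
      show ?thesis unfolding d_def m(1-4) using m(5) by (simp add: power_add)
    next
      case 3
      have m: "(j + 0) mod 4 = 2" "(j + 2) mod 4 = 0" "(j + 3) mod 4 = 1" "(j + 5) mod 4 = 3" "even j" "(j + 6) div 2 = 2 * q + 4"
        using q 3 by presburger+
      show ?thesis unfolding d_def m(1-4,6) using m(5) by (simp add: power_add power_mult)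
    next
      case 4
      have m: "(j + 0) mod 4 = 3" "(j + 2) mod 4 = 1" "(j + 3) mod 4 = 2" "(j + 5) mod 4 = 0" "odd j"
        using q 4 by presburger+
      show ?thesis unfolding d_def m(1-4) using m(5) by (simp add: power_add)
    qed
  qed
  have "s (j + 5) = 4 ^ (j + 6) - 2 * b 5 - 2 * d 5" using s[of 5] by simp
  also have "\<dots> = 11 * s (j + 3) + 22 * s (j + 2) - 32 * s (j + 0) + (if even j then 15 * (- 1) ^ ((j + 6) div 2) * 2 ^ (j + 4) else 0)"
    unfolding s bb using dd by (simp add: power_add algebra_simps)
  finally show ?thesis by simp
qed

text \<open>Five initial values start the recurrence. At j = 0 there are no monomials, and the
  closed form fits with the formal value -3 of \<open>hecke_tr 0\<close>.\<close>

lemma trace_sum_closed: "2 ^ (j + 1) * trace_sum (j + 1) = of_int (4 ^ (j + 1) + 2 * hecke_tr j + 2)"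
proof (induction j rule: less_induct)
  case (less j)
  have T: "trace_coeff 0 0 = 3" "trace_coeff 1 0 = 9 / 2" "trace_coeff 0 1 = 33 / 4" "trace_coeff 2 0 = 129 / 8" "trace_coeff 1 1 = 513 / 16"
  proof -
    show 0: "trace_coeff 0 0 = 3" by (rule trace_coeff_0(1))
    have "4 * trace_coeff 1 0 = 18" using trace_coeff_0(2)[of 0] 0 by (simp add: algebra_simps)
    then show 1: "trace_coeff 1 0 = 9 / 2" by (simp add: eq_divide_eq mult.commute)
    have "4 * trace_coeff 0 1 = 33" using trace_coeff_rec(2)[of 0] 0 by simp
    then show 2: "trace_coeff 0 1 = 33 / 4" by (simp add: eq_divide_eq mult.commute)
    have "4 * trace_coeff 2 0 = 129 / 2" using trace_coeff_0(2)[of 1] 1 by (simp add: numeral_2_eq_2 algebra_simps)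
    then show "trace_coeff 2 0 = 129 / 8" by (simp add: eq_divide_eq mult.commute)
    have "4 * trace_coeff 1 1 = 11 * trace_coeff 0 1 + 11 * trace_coeff 1 0 - 4 * trace_coeff 0 0"
      using trace_coeff_rec(1)[of 0 0] by (simp add: algebra_simps)
    then have "4 * trace_coeff 1 1 = 513 / 4" unfolding 0 1 2 by simp
    then show "trace_coeff 1 1 = 513 / 16" by (simp add: eq_divide_eq mult.commute)
  qed
  have wp: "weight_pairs 1 = {}" "weight_pairs 2 = {(1, 0)}" "weight_pairs 3 = {(0, 1)}" "weight_pairs 4 = {(2, 0)}" "weight_pairs 5 = {(1, 1)}"
    by (auto simp: weight_pairs_def) presburger+
  have h0: "hecke_tr 0 = - 3" by (simp add: hecke_tr_def)
  consider "j = 0" | "j = 1" | "j = 2" | "j = 3" | "j = 4" | i where "j = i + 5"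
  proof -
    have "j = 0 \<or> j = 1 \<or> j = 2 \<or> j = 3 \<or> j = 4 \<or> (\<exists>i. j = i + 5)" by presburger
    then show ?thesis using that by blast
  qed
  then show ?case
  proof cases
    case 6
    have e: "4 * trace_sum (i + 6) = 11 * trace_sum (i + 4) + 11 * trace_sum (i + 3) - 4 * trace_sum (i + 1) +
       (if even i then 15 * (- 1) ^ ((i + 6) div 2) else 0)"
    proof -
      have n: "i + 1 + 5 = i + 6" "i + 1 + 3 = i + 4" "i + 1 + 2 = i + 3" "even (i + 6) = even i" by simp_all
      show ?thesis using trace_sum_rec[of "i + 1"] unfolding n by (simp only: diff_eq_eq add_eq_0_iff2 algebra_simps)
    qed
    have ji: "j + 1 = i + 6" and n: "i + 3 + 1 = i + 4" "i + 2 + 1 = i + 3" using 6 by simp_all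
    have "i + 3 < j" "i + 2 < j" "i < j" using 6 by simp_all
    note ih = less.IH[OF this(1), unfolded n] less.IH[OF this(2), unfolded n] less.IH[OF this(3)]
    have p: "(2::complex) ^ (i + 6) = 2 ^ (i + 4) * 4" "(2::complex) ^ (i + 4) = 16 * 2 ^ i"
      "(2::complex) ^ (i + 3) = 8 * 2 ^ i" "(2::complex) ^ (i + 1) = 2 * 2 ^ i" by (simp_all add: power_add)
    have "2 ^ (j + 1) * trace_sum (j + 1) = 2 ^ (i + 4) * (4 * trace_sum (i + 6))"
      unfolding ji p(1) by (simp only: mult.assoc)
    also have "\<dots> = 11 * (2 ^ (i + 4) * trace_sum (i + 4)) + 22 * (2 ^ (i + 3) * trace_sum (i + 3)) - 32 * (2 ^ (i + 1) * trace_sum (i + 1))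
       + (if even i then 15 * (- 1) ^ ((i + 6) div 2) * 2 ^ (i + 4) else 0)"
      unfolding e p(2-4) by (simp only: distrib_left right_diff_distrib split: if_split) (simp add: algebra_simps)
    also have "\<dots> = of_int (11 * (4 ^ (i + 4) + 2 * hecke_tr (i + 3) + 2) + 22 * (4 ^ (i + 3) + 2 * hecke_tr (i + 2) + 2) - 32 * (4 ^ (i + 1) + 2 * hecke_tr i + 2)
       + (if even i then 15 * (- 1) ^ ((i + 6) div 2) * 2 ^ (i + 4) else 0))"
      unfolding ih by (simp only: of_int_add of_int_diff of_int_mult of_int_numeral of_int_power of_int_minus of_int_1 of_int_0 if_distrib[of of_int])
    also have "\<dots> = of_int (4 ^ (i + 5 + 1) + 2 * hecke_tr (i + 5) + 2)"
      unfolding hecke_tr_rec[of i, unfolded n] by (rule refl)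
    finally show ?thesis unfolding 6 .
  qed (simp_all add: trace_sum_def T T[unfolded One_nat_def] wp wp(1)[unfolded One_nat_def] wp(2)[unfolded numeral_2_eq_2]
    h0 hecke_tr_small hecke_tr_small(1)[unfolded One_nat_def])
qed

subsection \<open>Traces\<close>

context vector_space
begin

notation scale (infixr "\<odot>" 75)

text \<open>The basis \<open>B'\<close> chosen in the definition is unknown. Expanding the images of
  \<open>B'\<close> in \<open>B\<close>, and the vectors of \<open>B\<close> in \<open>B'\<close>,
  turns both diagonal sums into one double sum over products of mixed matrix entries.\<close>

lemma trace_on_eq:
  assumes B: "finite B" "independent B" "B \<subseteq> V" "V \<subseteq> span B" and V: "subspace V"
    and add: "\<And>x y. x \<in> V \<Longrightarrow> y \<in> V \<Longrightarrow> T (x + y) = T x + T y"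
    and scale: "\<And>c x. x \<in> V \<Longrightarrow> T (c \<odot> x) = c \<odot> T x"
    and T: "\<And>x. x \<in> V \<Longrightarrow> T x \<in> V"
  shows "trace_on V T = (\<Sum>b\<in>B. representation B (T b) b)"
proof -
  define B' where "B' = (SOME B. B \<subseteq> V \<and> independent B \<and> V \<subseteq> span B)"
  have B': "B' \<subseteq> V" "independent B'" "V \<subseteq> span B'"
    unfolding B'_def using someI_ex[of "\<lambda>B. B \<subseteq> V \<and> independent B \<and> V \<subseteq> span B"] B by auto
  have fin: "finite B'" using independent_span_bound[OF B(1) B'(2)] B' B(4) by blast
  have T_sum: "T (\<Sum>x\<in>A. c x \<odot> x) = (\<Sum>x\<in>A. c x \<odot> T x)" if "finite A" "A \<subseteq> V" for A c
    using that
  proof (induction A rule: finite_induct)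
    case empty
    show ?case using scale[of 0 0] subspace_0[OF V] by simp
  next
    case (insert x A)
    have "(\<Sum>x\<in>A. c x \<odot> x) \<in> V" using insert.prems by (intro subspace_sum[OF V] subspace_scale[OF V]) auto
    then show ?case using insert by (simp add: add scale subspace_scale[OF V])
  qed
  have "representation B' (T b') b' = (\<Sum>b\<in>B. representation B (T b') b * representation B' b b')" if "b' \<in> B'" for b'
  proof -
    have Tb: "T b' \<in> span B" using that B'(1) T B(4) by blast
    have "T b' = (\<Sum>b\<in>B. representation B (T b') b \<odot> b)"
      using sum_representation_eq[OF B(2) Tb B(1)] by simp
    then have "representation B' (T b') b' = representation B' (\<Sum>b\<in>B. representation B (T b') b \<odot> b) b'" by simp
    also have "\<dots> = (\<Sum>b\<in>B. representation B (T b') b * representation B' b b')"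
    proof (subst representation_sum[OF B'(2)])
      show "representation B (T b') b \<odot> b \<in> span B'" if "b \<in> B" for b
        using that B(3) B'(3) by (intro span_scale) auto
      show "(\<Sum>b\<in>B. representation B' (representation B (T b') b \<odot> b) b') = (\<Sum>b\<in>B. representation B (T b') b * representation B' b b')"
        by (rule sum.cong) (use B(3) B'(3) representation_scale[OF B'(2)] in auto)
    qed
    finally show ?thesis .
  qed
  then have "trace_on V T = (\<Sum>b'\<in>B'. \<Sum>b\<in>B. representation B (T b') b * representation B' b b')"
    unfolding trace_on_def B'_def[symmetric] Let_def by simp
  also have "\<dots> = (\<Sum>b\<in>B. \<Sum>b'\<in>B'. representation B' b b' * representation B (T b') b)"
    by (subst sum.swap) (simp add: mult.commute)
  also have "\<dots> = (\<Sum>b\<in>B. representation B (T b) b)"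
  proof (rule sum.cong)
    fix b assume b: "b \<in> B"
    have bs: "b \<in> span B'" using b B(3) B'(3) by blast
    have "T b = T (\<Sum>b'\<in>B'. representation B' b b' \<odot> b')"
      using sum_representation_eq[OF B'(2) bs fin] by simp
    also have "\<dots> = (\<Sum>b'\<in>B'. representation B' b b' \<odot> T b')" using T_sum[OF fin B'(1)] .
    finally have "representation B (T b) b = representation B (\<Sum>b'\<in>B'. representation B' b b' \<odot> T b') b" by simp
    also have "\<dots> = (\<Sum>b'\<in>B'. representation B' b b' * representation B (T b') b)"
    proof (subst representation_sum[OF B(2)])
      show "representation B' b b' \<odot> T b' \<in> span B" if "b' \<in> B'" for b'
        using that B'(1) T B(4) by (intro span_scale) auto
      show "(\<Sum>b'\<in>B'. representation B (representation B' b b' \<odot> T b') b) = (\<Sum>b'\<in>B'. representation B' b b' * representation B (T b') b)"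
      proof (rule sum.cong)
        fix b' assume "b' \<in> B'"
        then have "T b' \<in> span B" using B'(1) T B(4) by blast
        then show "representation B (representation B' b b' \<odot> T b') b = representation B' b b' * representation B (T b') b"
          using representation_scale[OF B(2)] by auto
      qed simp
    qed
    finally show "(\<Sum>b'\<in>B'. representation B' b b' * representation B (T b') b) = representation B (T b) b" by simp
  qed simp
  finally show ?thesis .
qed

text \<open>The version for an indexed family, with independence stated through coefficients as it
  is known for the monomials; injectivity of the family is a consequence.\<close>

lemma trace_on_family:
  assumes I: "finite I" and ind: "\<And>c. (\<Sum>i\<in>I. c i \<odot> v i) = 0 \<Longrightarrow> \<forall>i\<in>I. c i = 0"
    and v: "v ` I \<subseteq> V" "V \<subseteq> span (v ` I)" and V: "subspace V"
    and add: "\<And>x y. x \<in> V \<Longrightarrow> y \<in> V \<Longrightarrow> T (x + y) = T x + T y"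
    and scale: "\<And>c x. x \<in> V \<Longrightarrow> T (c \<odot> x) = c \<odot> T x"
    and M: "\<And>i. i \<in> I \<Longrightarrow> T (v i) = (\<Sum>j\<in>I. M i j \<odot> v j)"
  shows "trace_on V T = (\<Sum>i\<in>I. M i i)"
proof -
  have inj: "inj_on v I"
  proof (rule inj_onI, rule ccontr)
    fix i j assume ij: "i \<in> I" "j \<in> I" "v i = v j" "i \<noteq> j"
    define c where "c = (\<lambda>k. if k = i then 1 else if k = j then - 1 else 0 :: 'a)"
    have "(\<Sum>k\<in>I. c k \<odot> v k) = (\<Sum>k\<in>{i, j}. c k \<odot> v k)"
      by (rule sum.mono_neutral_right) (use I ij in \<open>auto simp: c_def\<close>)
    also have "\<dots> = 0" using ij by (simp add: c_def)
    finally have "c i = 0" using ind ij by blast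
    then show False by (simp add: c_def)
  qed
  define B where "B = v ` I"
  have fB: "finite B" using I by (simp add: B_def)
  have iB: "independent B"
  proof (rule independent_if_scalars_zero[OF fB])
    fix f x assume s: "(\<Sum>x\<in>B. f x \<odot> x) = 0" and x: "x \<in> B"
    have "(\<Sum>i\<in>I. f (v i) \<odot> v i) = 0" using s unfolding B_def by (subst (asm) sum.reindex[OF inj]) simp
    then show "f x = 0" using ind[of "\<lambda>i. f (v i)"] x by (auto simp: B_def)
  qed
  have rep: "representation B (\<Sum>j\<in>I. c j \<odot> v j) (v i) = c i" if "i \<in> I" for c i
  proof -
    have "representation B (\<Sum>j\<in>I. c j \<odot> v j) (v i) = (\<Sum>j\<in>I. representation B (c j \<odot> v j) (v i))"
    proof (subst representation_sum[OF iB])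
      show "c j \<odot> v j \<in> span B" if "j \<in> I" for j using that by (intro span_scale span_base) (simp add: B_def)
    qed simp
    also have "\<dots> = (\<Sum>j\<in>I. if j = i then c i else 0)"
    proof (rule sum.cong)
      fix j assume j: "j \<in> I"
      then have vj: "v j \<in> B" by (simp add: B_def)
      have "representation B (c j \<odot> v j) (v i) = c j * representation B (v j) (v i)"
        using representation_scale[OF iB span_base[OF vj]] by simp
      also have "representation B (v j) (v i) = (if v i = v j then 1 else 0)"
        using representation_basis[OF iB vj] by simp
      finally show "representation B (c j \<odot> v j) (v i) = (if j = i then c i else 0)"
        using inj_onD[OF inj _ that j] by auto
    qed simp
    finally show ?thesis using that I by simp
  qed
  have TV: "T x \<in> V" if "x \<in> V" for x
  proof -
    have "x \<in> span B" using that v(2) by (auto simp: B_def)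
    then show ?thesis using that
    proof (induction rule: span_induct_alt)
      case base
      show ?case using scale[of 0 0] subspace_0[OF V] by simp
    next
      case (step c b y)
      then obtain i where i: "i \<in> I" "b = v i" by (auto simp: B_def)
      have bV: "b \<in> V" using i v(1) by auto
      then have "c \<odot> b \<in> V" by (rule subspace_scale[OF V])
      moreover have "y \<in> V"
        using subspace_diff[OF V step.prems \<open>c \<odot> b \<in> V\<close>] by simp
      moreover have "T b \<in> V" unfolding i(2) M[OF i(1)] using v(1) by (intro subspace_sum[OF V] subspace_scale[OF V]) auto
      ultimately show ?case using step.IH bV by (simp add: add scale subspace_add[OF V] subspace_scale[OF V])
    qed
  qed
  have "trace_on V T = (\<Sum>b\<in>B. representation B (T b) b)"
    by (rule trace_on_eq[OF fB iB _ _ V add scale TV]) (use v in \<open>auto simp: B_def\<close>)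
  also have "\<dots> = (\<Sum>i\<in>I. representation B (T (v i)) (v i))"
    unfolding B_def by (subst sum.reindex[OF inj]) simp
  also have "\<dots> = (\<Sum>i\<in>I. M i i)" using M rep by (intro sum.cong) simp_all
  finally show ?thesis .
qed

text \<open>A linear map that preserves a hyperplane \<open>W\<close> of \<open>V\<close> acts on the line \<open>V / W\<close> by a scalar.\<close>

lemma trace_on_hyperplane:
  assumes V: "subspace V" and W: "subspace W" "W \<subseteq> V" and F: "finite F" "V \<subseteq> span F"
    and m: "m \<in> V" "m \<notin> W" and dec: "\<And>x. x \<in> V \<Longrightarrow> \<exists>c. x - c \<odot> m \<in> W"
    and add: "\<And>x y. x \<in> V \<Longrightarrow> y \<in> V \<Longrightarrow> T (x + y) = T x + T y"
    and scale: "\<And>c x. x \<in> V \<Longrightarrow> T (c \<odot> x) = c \<odot> T x"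
    and TV: "\<And>x. x \<in> V \<Longrightarrow> T x \<in> V" and TW: "\<And>x. x \<in> W \<Longrightarrow> T x \<in> W"
    and lam: "T m - l \<odot> m \<in> W"
  shows "trace_on V T = trace_on W T + l"
proof -
  obtain B where B: "B \<subseteq> W" "independent B" "W \<subseteq> span B"
    using maximal_independent_subset by blast
  have fB: "finite B" using independent_span_bound[OF F(1) B(2)] B(1) W(2) F(2) by blast
  have sB: "span B \<subseteq> W" using B(1) W(1) by (rule span_minimal)
  have mB: "m \<notin> span B" using m(2) sB by blast
  have iB: "independent (insert m B)" using B(2) mB by (simp add: independent_insert)
  have mB': "m \<notin> B" using mB span_base by blast
  have VB: "V \<subseteq> span (insert m B)"
  proof
    fix x assume "x \<in> V"
    then obtain c where "x - c \<odot> m \<in> W" using dec by blast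
    then have "x - c \<odot> m \<in> span B" using B(3) by blast
    then show "x \<in> span (insert m B)" unfolding span_insert by blast
  qed
  have ext: "representation (insert m B) x = representation B x" if "x \<in> W" for x
    using that B(3) by (intro representation_extend[OF iB]) auto
  have tW: "trace_on W T = (\<Sum>b\<in>B. representation B (T b) b)"
  proof (rule trace_on_eq[OF fB B(2,1,3) W(1)])
    show "T (x + y) = T x + T y" if "x \<in> W" "y \<in> W" for x y using add[of x y] that W(2) by blast
    show "T (c \<odot> x) = c \<odot> T x" if "x \<in> W" for x c using scale[of x c] that W(2) by blast
  qed (rule TW)
  have "trace_on V T = (\<Sum>b\<in>insert m B. representation (insert m B) (T b) b)"
    by (rule trace_on_eq[OF _ iB _ VB V add scale TV]) (use fB m(1) B(1) W(2) in auto)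
  also have "\<dots> = representation (insert m B) (T m) m + (\<Sum>b\<in>B. representation (insert m B) (T b) b)"
    using fB mB' by simp
  also have "(\<Sum>b\<in>B. representation (insert m B) (T b) b) = (\<Sum>b\<in>B. representation B (T b) b)"
    using ext TW B(1) by (intro sum.cong) auto
  also have "representation (insert m B) (T m) m = l"
  proof -
    define y where "y = T m - l \<odot> m"
    have y: "y \<in> W" using lam by (simp add: y_def)
    have "T m = l \<odot> m + y" by (simp add: y_def)
    then have "representation (insert m B) (T m) m = representation (insert m B) (l \<odot> m) m + representation (insert m B) y m"
    proof -
      have "l \<odot> m \<in> span (insert m B)" by (intro span_scale span_base) simp
      moreover have "y \<in> span (insert m B)" using y W(2) VB by blast
      ultimately have "representation (insert m B) (l \<odot> m + y) =
          (\<lambda>b. representation (insert m B) (l \<odot> m) b + representation (insert m B) y b)"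
        using representation_add[OF iB] by blast
      then show ?thesis using \<open>T m = l \<odot> m + y\<close> by simp
    qed
    also have "representation (insert m B) (l \<odot> m) m = l * representation (insert m B) m m"
      using representation_scale[OF iB, of m l] by (simp add: span_base)
    also have "representation (insert m B) m m = 1" using representation_basis[OF iB, of m] by simp
    also have "representation (insert m B) y m = 0"
      unfolding ext[OF y] using mB' representation_ne_zero by blast
    finally show ?thesis by simp
  qed
  finally show ?thesis using tW by (simp add: add.commute)
qed

end

section \<open>The trace on modular forms and on cusp forms\<close>

lemma sum_fun_apply: "(\<Sum>i\<in>A. f i) x = (\<Sum>i\<in>A. f i x)" for f :: "'i \<Rightarrow> 'a \<Rightarrow> 'b::comm_monoid_add"
  by (induction A rule: infinite_finite_induct) auto

lemma modular_forms_subspace: "cfun.subspace (modular_forms (2 * k))"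
proof (rule cfun.subspaceI)
  show zero: "0 \<in> modular_forms (2 * k)"
    unfolding modular_forms_def zero_fun_def
    by (auto simp: has_q_expansion_def intro!: exI[of _ "\<lambda>_. 0"])
  fix f g assume f: "f \<in> modular_forms (2 * k)" and g: "g \<in> modular_forms (2 * k)"
  show "f + g \<in> modular_forms (2 * k)"
    using modular_forms_lincomb(1)[OF f g, of 1 1] by (simp add: plus_fun_def)
next
  fix c f assume f: "f \<in> modular_forms (2 * k)"
  show "(\<lambda>z. c * f z) \<in> modular_forms (2 * k)"
    using modular_forms_lincomb(1)[OF f f, of c 0] by simp
qed

lemma q_coeff_0_add: 
  assumes "f \<in> modular_forms w" "g \<in> modular_forms w"
  shows "q_coeff (f + g) 0 = q_coeff f 0 + q_coeff g 0" "q_coeff (\<lambda>z. c * f z) 0 = c * q_coeff f 0"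
  using modular_forms_lincomb(2)[OF assms, of 1 1 0] modular_forms_lincomb(2)[OF assms, of c 0 0]
  by (simp_all add: plus_fun_def)

lemma cusp_forms_subspace: "cfun.subspace (cusp_forms (2 * k))"
proof (rule cfun.subspaceI)
  have zero: "0 \<in> modular_forms (2 * k)" by (rule cfun.subspace_0[OF modular_forms_subspace])
  have "q_coeff (\<lambda>z. 0 * (0::complex \<Rightarrow> complex) z) 0 = 0 * q_coeff 0 0"
    by (rule q_coeff_0_add(2)[OF zero zero])
  then show "0 \<in> cusp_forms (2 * k)" using zero by (simp add: cusp_forms_iff zero_fun_def)
  fix f g assume "f \<in> cusp_forms (2 * k)" "g \<in> cusp_forms (2 * k)"
  then have f: "f \<in> modular_forms (2 * k)" "q_coeff f 0 = 0" and g: "g \<in> modular_forms (2 * k)" "q_coeff g 0 = 0"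
    by (simp_all add: cusp_forms_iff)
  show "f + g \<in> cusp_forms (2 * k)"
    using cfun.subspace_add[OF modular_forms_subspace f(1) g(1)] q_coeff_0_add(1)[OF f(1) g(1)] f(2) g(2)
    by (simp add: cusp_forms_iff)
next
  fix c f assume "f \<in> cusp_forms (2 * k)"
  then have f: "f \<in> modular_forms (2 * k)" "q_coeff f 0 = 0" by (simp_all add: cusp_forms_iff)
  show "(\<lambda>z. c * f z) \<in> cusp_forms (2 * k)"
    using cfun.subspace_scale[OF modular_forms_subspace f(1)] q_coeff_0_add(2)[OF f(1) f(1)] f(2)
    by (simp add: cusp_forms_iff)
qed

context
  fixes k :: nat
  assumes k: "k \<ge> 2"
begin

lemma g_mono_weight: "p \<in> weight_pairs k \<Longrightarrow> g_mono (fst p) (snd p) \<in> modular_forms (2 * k)"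
proof -
  assume "p \<in> weight_pairs k"
  then have "4 * fst p + 6 * snd p = 2 * k" by (auto simp: weight_pairs_def)
  then show ?thesis using g_mono_modular by metis
qed

lemma modular_forms_eq_sum:
  assumes "f \<in> modular_forms (2 * k)"
  obtains c where "f = (\<Sum>p\<in>weight_pairs k. (\<lambda>z. c p * g_mono (fst p) (snd p) z))"
proof -
  obtain c where "\<forall>z. f z = (\<Sum>(a, b)\<in>weight_pairs k. c a b * g_mono a b z)"
    using modular_forms_span[OF assms] by blast
  then have "f = (\<Sum>p\<in>weight_pairs k. (\<lambda>z. c (fst p) (snd p) * g_mono (fst p) (snd p) z))"
    by (auto simp: fun_eq_iff sum_fun_apply case_prod_unfold)
  then show thesis using that[of "\<lambda>p. c (fst p) (snd p)"] by simp
qed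

lemma modular_forms_subset_span: "modular_forms (2 * k) \<subseteq> cfun.span ((\<lambda>p. g_mono (fst p) (snd p)) ` weight_pairs k)"
proof
  fix f assume "f \<in> modular_forms (2 * k)"
  then obtain c where f: "f = (\<Sum>p\<in>weight_pairs k. (\<lambda>z. c p * g_mono (fst p) (snd p) z))"
    by (rule modular_forms_eq_sum)
  show "f \<in> cfun.span ((\<lambda>p. g_mono (fst p) (snd p)) ` weight_pairs k)"
    unfolding f by (intro cfun.span_sum cfun.span_scale cfun.span_base) auto
qed

lemma hecke_linear:
  assumes f: "f \<in> modular_forms (2 * k)" and g: "g \<in> modular_forms (2 * k)"
  shows "hecke_T2 (2 * k) (\<lambda>z. a * f z + b * g z) = (\<lambda>z. a * hecke_T2 (2 * k) f z + b * hecke_T2 (2 * k) g z)"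
proof
  fix z
  have w: "2 * k \<ge> 1" using k by simp
  show "hecke_T2 (2 * k) (\<lambda>z. a * f z + b * g z) z = a * hecke_T2 (2 * k) f z + b * hecke_T2 (2 * k) g z"
  proof (cases "z \<in> upper_half_plane")
    case True
    show ?thesis
      unfolding hecke_T2_modular_form(1)[OF f w True] hecke_T2_modular_form(1)[OF g w True]
        hecke_T2_modular_form(1)[OF modular_forms_lincomb(1)[OF f g] w True]
      by (simp add: field_simps)
  next
    case False
    then show ?thesis by (simp add: hecke_T2_def)
  qed
qed

lemma hecke_add_scale:
  assumes f: "f \<in> modular_forms (2 * k)"
  shows "g \<in> modular_forms (2 * k) \<Longrightarrow> hecke_T2 (2 * k) (f + g) = hecke_T2 (2 * k) f + hecke_T2 (2 * k) g"
    and "hecke_T2 (2 * k) (\<lambda>z. c * f z) = (\<lambda>z. c * hecke_T2 (2 * k) f z)"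
  using hecke_linear[OF f, of _ 1 1] hecke_linear[OF f f, of c 0] by (simp_all add: plus_fun_def)

lemma hecke_g_mono:
  "p \<in> weight_pairs k \<Longrightarrow> hecke_T2 (2 * k) (g_mono (fst p) (snd p)) =
     (\<Sum>q\<in>weight_pairs k. (\<lambda>z. hecke_coeff (fst p) (snd p) (fst q) (snd q) * g_mono (fst q) (snd q) z))"
  using k by (auto simp: fun_eq_iff sum_fun_apply weight_pairs_def case_prod_unfold hecke_T2_g_mono)

text \<open>Stability of the space is read off from the monomial basis, whose images are
  combinations of monomials of the same weight.\<close>

lemma hecke_modular:
  assumes "f \<in> modular_forms (2 * k)" shows "hecke_T2 (2 * k) f \<in> modular_forms (2 * k)"
proof -
  have "f \<in> cfun.span ((\<lambda>p. g_mono (fst p) (snd p)) ` weight_pairs k)" using modular_forms_subset_span assms by blast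
  then show ?thesis using assms
  proof (induction rule: cfun.span_induct_alt)
    case base
    have "hecke_T2 (2 * k) (\<lambda>z. 0 * (0::complex \<Rightarrow> complex) z) = (\<lambda>z. 0 * hecke_T2 (2 * k) 0 z)"
      by (rule hecke_add_scale(2)[OF base])
    then have "hecke_T2 (2 * k) 0 = 0" by (simp add: zero_fun_def)
    then show ?case using base by (simp only:)
  next
    case (step c b y)
    then obtain p where p: "p \<in> weight_pairs k" "b = g_mono (fst p) (snd p)" by auto
    have b: "b \<in> modular_forms (2 * k)" unfolding p(2) using p(1) by (rule g_mono_weight)
    have cb: "(\<lambda>z. c * b z) \<in> modular_forms (2 * k)" by (rule cfun.subspace_scale[OF modular_forms_subspace b])
    have y: "y \<in> modular_forms (2 * k)"
      using cfun.subspace_diff[OF modular_forms_subspace step.prems cb] unfolding add_diff_cancel_left' .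
    have "hecke_T2 (2 * k) b \<in> modular_forms (2 * k)"
      unfolding p(2) hecke_g_mono[OF p(1)]
      by (intro cfun.subspace_sum[OF modular_forms_subspace] cfun.subspace_scale[OF modular_forms_subspace] g_mono_weight)
    then show ?case
      unfolding hecke_add_scale(1)[OF cb y] hecke_add_scale(2)[OF b]
      by (intro cfun.subspace_add[OF modular_forms_subspace] cfun.subspace_scale[OF modular_forms_subspace] step.IH y)
  qed
qed

text \<open>The constant term is an eigenfunctional with the Eisenstein eigenvalue, so the operator
  preserves the cusp forms and acts on the quotient line by this number.\<close>

lemma q_coeff_hecke:
  assumes "f \<in> modular_forms (2 * k)"
  shows "q_coeff (hecke_T2 (2 * k) f) 0 = (1 + 2 ^ (2 * k - 1)) * q_coeff f 0"
  using q_coeff_eq[OF hecke_T2_modular_form(2)[OF assms]] k by (simp add: algebra_simps)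

lemma trace_modular_forms:
  "cfun.trace_on (modular_forms (2 * k)) (hecke_T2 (2 * k)) = of_int (4 ^ k + 2 * hecke_tr (k - 1) + 2) / 2"
proof -
  have "cfun.trace_on (modular_forms (2 * k)) (hecke_T2 (2 * k)) = (\<Sum>p\<in>weight_pairs k. hecke_coeff (fst p) (snd p) (fst p) (snd p))"
  proof (rule cfun.trace_on_family[where v = "\<lambda>p. g_mono (fst p) (snd p)" and M = "\<lambda>p q. hecke_coeff (fst p) (snd p) (fst q) (snd q)"])
    fix c assume "(\<Sum>p\<in>weight_pairs k. (\<lambda>z. c p * g_mono (fst p) (snd p) z)) = 0"
    then have "(\<Sum>(a, b)\<in>weight_pairs k. c (a, b) * g_mono a b z) = 0" for z
      by (simp add: fun_eq_iff sum_fun_apply case_prod_unfold)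
    then show "\<forall>p\<in>weight_pairs k. c p = 0" using g_mono_independent[where k = k and c = "\<lambda>a b. c (a, b)"] by auto
  qed (use modular_forms_subset_span g_mono_weight modular_forms_subspace hecke_add_scale hecke_g_mono in auto)
  also have "\<dots> = (\<Sum>(a, b)\<in>weight_pairs k. 2 ^ k * trace_coeff a b / 2)"
    by (rule sum.cong) (auto simp: hecke_coeff_diag weight_pairs_def)
  also have "\<dots> = 2 ^ k * trace_sum k / 2"
    by (simp add: trace_sum_def sum_distrib_left sum_divide_distrib case_prod_unfold)
  also have "2 ^ k * trace_sum k = of_int (4 ^ k + 2 * hecke_tr (k - 1) + 2)"
    using trace_sum_closed[of "k - 1"] k by simp
  finally show ?thesis .
qed

text \<open>Any monomial of the weight spans a complement of the cusp forms, because its constant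
  term is nonzero; it need not be an eigenform. Twice the scalar on the quotient is 4^k + 2, the
  part by which the two trace formulas differ.\<close>

lemma trace_T2_eq: "trace_T2 (2 * k) = of_int (hecke_tr (k - 1))"
proof -
  obtain p where p: "p \<in> weight_pairs k" using weight_pairs_ex[OF k] by blast
  define m where "m = g_mono (fst p) (snd p)"
  have m: "m \<in> modular_forms (2 * k)" unfolding m_def by (rule g_mono_weight[OF p])
  have m0: "q_coeff m 0 \<noteq> 0" unfolding m_def by (rule q_coeff_g_mono)
  have sub: "f - (\<lambda>z. c * m z) \<in> modular_forms (2 * k)"
    "q_coeff (f - (\<lambda>z. c * m z)) 0 = q_coeff f 0 - c * q_coeff m 0" if "f \<in> modular_forms (2 * k)" for f c
    using modular_forms_lincomb[OF that m, of 1 "- c"] by (simp_all add: fun_diff_def)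
  have "cfun.trace_on (modular_forms (2 * k)) (hecke_T2 (2 * k)) =
      cfun.trace_on (cusp_forms (2 * k)) (hecke_T2 (2 * k)) + (1 + 2 ^ (2 * k - 1))"
  proof (rule cfun.trace_on_hyperplane[OF modular_forms_subspace cusp_forms_subspace _ _ modular_forms_subset_span m])
    show "\<exists>c. f - (\<lambda>z. c * m z) \<in> cusp_forms (2 * k)" if "f \<in> modular_forms (2 * k)" for f
      using sub[OF that, of "q_coeff f 0 / q_coeff m 0"] m0
      by (intro exI[of _ "q_coeff f 0 / q_coeff m 0"]) (simp add: cusp_forms_iff)
    show "hecke_T2 (2 * k) m - (\<lambda>z. (1 + 2 ^ (2 * k - 1)) * m z) \<in> cusp_forms (2 * k)"
      using sub[OF hecke_modular[OF m], of "1 + 2 ^ (2 * k - 1)"] by (simp add: cusp_forms_iff q_coeff_hecke[OF m])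
  qed (use m0 hecke_add_scale hecke_modular q_coeff_hecke in \<open>auto simp: cusp_forms_iff\<close>)
  then have "of_int (4 ^ k + 2 * hecke_tr (k - 1) + 2) / 2 = trace_T2 (2 * k) + (1 + 2 ^ (2 * k - 1))"
    unfolding trace_T2_def trace_modular_forms .
  moreover have "(4::complex) ^ k = 2 * 2 ^ (2 * k - 1)"
  proof -
    have "(2::complex) * 2 ^ (2 * k - 1) = 2 ^ Suc (2 * k - 1)" by simp
    also have "Suc (2 * k - 1) = 2 * k" using k by simp
    finally show ?thesis by (simp add: power_mult)
  qed
  then have "of_int (4 ^ k + 2 * hecke_tr (k - 1) + 2) = 2 * (of_int (hecke_tr (k - 1)) + (1 + 2 ^ (2 * k - 1)) :: complex)"
    by simp
  ultimately show ?thesis by (simp only: nonzero_mult_div_cancel_left[OF zero_neq_numeral[symmetric]] add_right_cancel)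
qed

end

theorem theorem1:
  "(\<forall>k k' :: nat. k \<ge> 2 \<and> k' \<ge> 2 \<and> k \<noteq> k' \<and> trace_T2 (2 * k) = trace_T2 (2 * k') \<longrightarrow>
      trace_T2 (2 * k) = 0) \<and>
   (\<forall>k :: nat. k \<ge> 2 \<longrightarrow> (trace_T2 (2 * k) = 0 \<longleftrightarrow> k < 6 \<or> k = 7))"
proof -
  have small: "hecke_tr j = 0" if "1 \<le> j" "j < 5 \<or> j = 6" for j
  proof -
    consider "j = 1" | "j = 2" | "j = 3" | "j = 4" | "j = 6" using \<open>1 \<le> j\<close> \<open>j < 5 \<or> j = 6\<close> by linarith
    then show ?thesis by cases (simp_all only: hecke_tr_small)
  qed
  have inj: "i = j" if "hecke_tr i = hecke_tr j" "5 \<le> i" "5 \<le> j" for i j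
    using hecke_tr_inj[of i j] hecke_tr_inj[of j i] that by (metis linorder_neqE_nat)
  have zero: "hecke_tr j = 0 \<longleftrightarrow> j < 5 \<or> j = 6" if "1 \<le> j" for j
  proof
    assume 0: "hecke_tr j = 0"
    show "j < 5 \<or> j = 6"
    proof (rule ccontr)
      assume n: "\<not> (j < 5 \<or> j = 6)"
      \<comment> \<open>Index 6 takes the value 0, so injectivity from index 5 on excludes every
        other zero in that range.\<close>
      have "hecke_tr j = hecke_tr 6" using 0 by (simp add: hecke_tr_small)
      then have "j = 6" by (rule inj) (use n in auto)
      then show False using n by simp
    qed
  qed (rule small[OF that])
  have "trace_T2 (2 * k) = 0 \<longleftrightarrow> k < 6 \<or> k = 7" if "k \<ge> 2" for k
    using zero[of "k - 1"] that by (simp add: trace_T2_eq) linarith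
  moreover have "trace_T2 (2 * k) = 0" if "k \<ge> 2" "k' \<ge> 2" "k \<noteq> k'" "trace_T2 (2 * k) = trace_T2 (2 * k')" for k k'
  proof (rule ccontr)
    assume nz: "trace_T2 (2 * k) \<noteq> 0"
    have eq: "hecke_tr (k - 1) = hecke_tr (k' - 1)" using that by (simp add: trace_T2_eq)
    have "hecke_tr (k - 1) \<noteq> 0" "hecke_tr (k' - 1) \<noteq> 0" using nz that by (simp_all add: trace_T2_eq)
    then have "5 \<le> k - 1" "5 \<le> k' - 1" using zero[of "k - 1"] zero[of "k' - 1"] that(1,2) by linarith+
    then have "k - 1 = k' - 1" using inj eq by blast
    then show False using that(1-3) by simp
  qed
  ultimately show ?thesis by blast
qed

end
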